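(* For real $x>0$, $x\neq 1/2$, let $$f_6(x)=\frac{e^{\pi ix}(56x^2-32x+5)\,\Gamma(x)^3}{(2x-1)^2\,\Gamma(3x+1)}.$$ Then the following series converge and $$\sum_{k=1}^\infty f_6'(k)=\frac{\pi^4}3-4\pi i\zeta(3),\qquad \sum_{k=1}^\infty f_6''(k)=8\pi^2\zeta(3)-288\zeta(5)+\frac23\pi^5 i,$$ $$\sum_{k=1}^\infty f_6'''(k)=1410\zeta(6)-96\zeta(3)^2+16\pi i\big(\pi^2\zeta(3)-54\zeta(5)\big),$$ $$\frac{1}{576}\sum_{k=1}^\infty f_6^{(4)}(k)=36\zeta(2)\zeta(5)-3\zeta(3)\zeta(4)-73\zeta(7)+\frac{\pi i}6\big(85\zeta(6)-4\zeta(3)^2\big),$$ $$\frac{1}{48}\sum_{k=1}^\infty f_6^{(5)}(k)=1715\zeta(8)+240\zeta(2)\zeta(3)^2-480\zeta(3)\zeta(5)+48\zeta(5,3)+60\pi i\big(24\zeta(2)\zeta(5)-73\zeta(7)\big),$$ $$\frac{1}{3840}\sum_{k=1}^\infty f_6^{(6)}(k)=1971\zeta(2)\zeta(7)+12\zeta(3)\zeta(6)-486\zeta(4)\zeta(5)-8\zeta(3)^3-2959\zeta(9)+\frac{\pi i}4\big(1417\zeta(8)+48\zeta(2)\zeta(3)^2-144\zeta(3)\zeta(5)+144\zeta(5,3)\big).$$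
   Context: $i=\sqrt{-1}$, $e^{\pi i x}=\cos(\pi x)+i\sin(\pi x)$, $\Gamma$ is Euler's gamma function, and $f^{(m)}$ (also $f',f'',f'''$) is the $m$-th derivative of the complex-valued function $f$ of the real variable $x$. $\zeta(s)=\sum_{n\ge1}n^{-s}$ is the Riemann zeta function and $\zeta(5,3)=\sum_{k_1>k_2>0}\frac{1}{k_1^5k_2^3}$. Note $f_6(k)=\frac{(-1)^k(56k^2-32k+5)}{(2k-1)^2k^3\binom{2k}{k}\binom{3k}{k}}$ for positive integers $k$.
   Formalization: In the fifth identity the coefficient of ζ(5,3) is 480 instead of the printed 48; the printed value is false, since it contradicts the sixth identity (which forces 480) and ζ(5,3)>0. *)

theory Defs
  imports "HOL-Analysis.Analysis"
begin

(* Meaningful only for Re s > 1, where the Dirichlet series converges. *)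
definition zeta :: "complex \<Rightarrow> complex" where
  "zeta s = (\<Sum>n. of_nat (Suc n) powr (- s))"

(* First argument belongs to the larger summation index: k1 > k2 > 0. *)
definition double_zeta :: "nat \<Rightarrow> nat \<Rightarrow> complex" where
  "double_zeta a b =
     (\<Sum>\<^sub>\<infinity>(k1, k2) \<in> {(k1, k2). k1 > k2 \<and> k2 > (0::nat)}. 1 / (of_nat k1 ^ a * of_nat k2 ^ b))"

definition higher_vector_deriv ::
  "nat \<Rightarrow> (real \<Rightarrow> 'a::real_normed_vector) \<Rightarrow> real \<Rightarrow> 'a" where
  "higher_vector_deriv m f = ((\<lambda>g x. vector_derivative g (at x)) ^^ m) f"

(* Intended for x > 0, x \<noteq> 1/2. The values at other arguments have no influence on the
   derivatives at the positive integers, which are interior points of that domain. *)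
definition f6 :: "real \<Rightarrow> complex" where
  "f6 x = exp (of_real pi * \<i> * of_real x) * of_real (56 * x^2 - 32 * x + 5) * of_real (Gamma x ^ 3)
          / of_real ((2 * x - 1)^2 * Gamma (3 * x + 1))"

end

theory Submission
  imports Defs "HOL-Complex_Analysis.Complex_Analysis"
begin

text \<open>
  Write \<open>x = 1 + t\<close>. The functions
  \<open>F M K = (-1) ^ K (Gamma K)\<^sup>2 Gamma (M - K) / (K Gamma (M + K))\<close> and
  \<open>G M K = 2 (-1) ^ K (Gamma K)\<^sup>2 Gamma (M + 1 - K) / (M\<^sup>2 Gamma (M + K))\<close> form a WZ pair, also for
  non-integer arguments. Summing along the diagonal \<open>M = 2 K - 1\<close> or along \<open>K = 1 + t\<close> turns
  \<open>\<Sum> f6 (x + k)\<close> into \<open>- exp (\<i> \<pi> t) 4 (Gamma x)\<^sup>2 V (2 t) t\<close> with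
  \<open>V a t = \<Sum>n\<ge>1. Gamma (n + a - t) / (Gamma (n + a + t + 1) (n + a)\<^sup>2)\<close>, and summing along \<open>M = 1 + a\<close>
  turns \<open>V a t\<close> into \<open>S a t = \<Sum>i\<ge>1. (i + t)\<^sup>-\<^sup>3 \<Prod>j>i. (1 - a\<^sup>2 / (j + t)\<^sup>2)\<close>, which is even in \<open>a\<close>.

  Now \<open>V a t\<close> is elementary on the lines \<open>t = 0\<close> and \<open>a = - t\<close>. As \<open>S\<close> is a power series in \<open>a\<^sup>2\<close> and \<open>t\<close>, its
  expansion on the line \<open>a = 2 t\<close> up to order 6 follows from those on \<open>a = 0\<close>, \<open>t = 0\<close>, \<open>a = t\<close> and from the
  coefficient of \<open>a\<^sup>2\<close>, a double Hurwitz zeta function. Its Taylor coefficients are double zeta values, which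
  the stuffle, shuffle and sum formulas reduce to zeta values and \<open>\<zeta>(5,3)\<close>.
\<close>

section \<open>The WZ transformation of the series\<close>

text \<open>Why exactly six derivatives: write \<open>S\<close> as the sum of s_jk a^(2j) t^k. The
  coefficients with j = 0, j = 1 or k = 0 are known. In each total degree up to 6 at most one
  coefficient then stays open, that of a^4 t^k, and the line a = t supplies one equation per degree.
  In degree 7 both a^4 t^3 and a^6 t are open.

  Summing along M = 1 + a also produces an alternating series in a that is not elementary. It is the
  same for every t, so \<open>S\<close> is only used in differences S(a,t) - S(a,0), where that
  series cancels.

  The estimates live on -1/4 < t < 0: the line a = -t is summed by a binomial series with parameter
  2a, which needs 0 < 2a < 1. One-sided estimates suffice, because the Taylor coefficients of a
  holomorphic function at 0 can be read off along the negative reals. Hence all inequalities are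
  real, and holomorphy enters only when derivatives are extracted.\<close>

lemma Gamma_Suc_real: "x > 0 \<Longrightarrow> Gamma (x + 1) = x * Gamma (x::real)"
  by (rule Gamma_plus1) (auto elim!: nonpos_Ints_cases)

lemma summable_inverse_square_shift:
  fixes c :: real assumes "c > 0"
  shows "summable (\<lambda>m. 1 / (real m + c)^2)"
  using Polygamma_converges'[of c 2] assms by (simp add: field_simps)

lemma Gamma_quotient_le:
  fixes a b :: real
  assumes "0 < a" "a \<le> b"
  shows "Gamma (a + real m) / Gamma (b + real m) \<le> Gamma a / Gamma b"
proof (induction m)
  case (Suc m)
  have "Gamma (a + real (Suc m)) / Gamma (b + real (Suc m))
      = ((a + m) / (b + m)) * (Gamma (a + real m) / Gamma (b + real m))"
    using assms Gamma_Suc_real[of "a + m"] Gamma_Suc_real[of "b + m"] by (simp add: add_ac)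
  also have "\<dots> \<le> 1 * (Gamma (a + real m) / Gamma (b + real m))"
    using assms by (intro mult_right_mono) (auto intro!: divide_nonneg_nonneg Gamma_real_nonneg)
  finally show ?case using Suc by simp
qed simp

text \<open>The gap of at least 1 between the arguments allows one factor 1 / (a + m) to be split
  off; the quotient that remains is bounded by the preceding monotonicity.\<close>

lemma Gamma_quotient_tendsto_0:
  fixes a b :: real
  assumes "0 < a" "a + 1 \<le> b"
  shows "(\<lambda>m. Gamma (a + real m) / Gamma (b + real m)) \<longlonglongrightarrow> 0"
proof -
  define C where "C = Gamma (a + 1) / Gamma b"
  have "norm (Gamma (a + real m) / Gamma (b + real m)) \<le> C * (1 / (a + real m))" for m
  proof -
    have "Gamma (a + real m) / Gamma (b + real m) \<ge> 0"
      using assms by (intro divide_nonneg_nonneg Gamma_real_nonneg) auto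
    then have "norm (Gamma (a + real m) / Gamma (b + real m)) = Gamma (a + real m) / Gamma (b + real m)"
      by (simp only: real_norm_def abs_of_nonneg)
    also have "\<dots> = Gamma ((a + 1) + real m) / Gamma (b + real m) * (1 / (a + real m))"
    proof -
      have "Gamma ((a + 1) + real m) = (a + real m) * Gamma (a + real m)"
        using Gamma_Suc_real[of "a + real m"] assms by (simp add: add_ac)
      then show ?thesis using assms by simp
    qed
    also have "\<dots> \<le> C * (1 / (a + real m))"
      unfolding C_def using assms by (intro mult_right_mono Gamma_quotient_le) auto
    finally show ?thesis .
  qed
  moreover have "(\<lambda>m. 1 / (a + real m)) \<longlonglongrightarrow> 0"
    by (rule tendsto_divide_0[OF tendsto_const filterlim_at_top_imp_at_infinity[OF
        filterlim_tendsto_add_at_top[OF tendsto_const filterlim_real_sequentially]]])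
  then have "(\<lambda>m. C * (1 / (a + real m))) \<longlonglongrightarrow> 0" by (rule tendsto_mult_right_zero)
  ultimately show ?thesis by (rule Lim_null_comparison[OF always_eventually[OF allI]])
qed

definition V_series :: "real \<Rightarrow> real \<Rightarrow> nat \<Rightarrow> real" where
  "V_series a t m = Gamma (real m + 1 + a - t) / (Gamma (real m + 2 + a + t) * (real m + 1 + a)^2)"

text \<open>For t \<ge> -1/2 the lower Gamma argument exceeds the upper one by 1 + 2t \<ge> 0, so
  the Gamma quotient is bounded and the inverse square decides.\<close>

lemma summable_V_series:
  assumes "1 + a - t > 0" "t \<ge> -1/2" "1 + a > 0"
  shows "summable (V_series a t)"
proof (rule summable_comparison_test')
  show "summable (\<lambda>m. Gamma (1 + a - t) / Gamma (2 + a + t) * (1 / (real m + (1 + a))^2))"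
    using assms by (intro summable_mult summable_inverse_square_shift)
  fix m :: nat
  have le: "Gamma ((1 + a - t) + real m) / Gamma ((2 + a + t) + real m) \<le> Gamma (1 + a - t) / Gamma (2 + a + t)"
    using assms by (intro Gamma_quotient_le) auto
  have eq: "V_series a t m = Gamma ((1 + a - t) + real m) / Gamma ((2 + a + t) + real m) * (1 / (real m + (1 + a))^2)"
    by (simp add: V_series_def algebra_simps)
  have "V_series a t m \<ge> 0"
    unfolding V_series_def using assms by (intro divide_nonneg_nonneg Gamma_real_nonneg mult_nonneg_nonneg) auto
  then have "norm (V_series a t m) = V_series a t m" by simp
  also note eq
  also have "Gamma ((1 + a - t) + real m) / Gamma ((2 + a + t) + real m) * (1 / (real m + (1 + a))^2)
      \<le> Gamma (1 + a - t) / Gamma (2 + a + t) * (1 / (real m + (1 + a))^2)"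
    by (intro mult_right_mono le) auto
  finally show "norm (V_series a t m) \<le> Gamma (1 + a - t) / Gamma (2 + a + t) * (1 / (real m + (1 + a))^2)" .
qed

definition V :: "real \<Rightarrow> real \<Rightarrow> real" where "V a t = (\<Sum>m. V_series a t m)"

text \<open>The real factor of \<open>f6\<close> that remains when the phase exp(pi i x) is removed;
  at x = 1 + t + k the phase contributes only the sign (-1)^k and a factor free of k.\<close>

definition g6 :: "real \<Rightarrow> real" where
  "g6 x = (56 * x^2 - 32 * x + 5) * Gamma x ^ 3 / ((2 * x - 1)^2 * Gamma (3 * x + 1))"

text \<open>
  With \<open>G M K = (Gamma K)\<^sup>2 Gamma (M + 1 - K) / (Gamma (M + K) M\<^sup>2)\<close>, \<open>M = 1 + 2 t + 2 l + m\<close> and \<open>K = 1 + t + l\<close>, the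
  term \<open>q l m\<close> is \<open>G M K\<close> without its sign, and \<open>f m\<close> is the WZ companion of \<open>G\<close>.
\<close>

lemma g6_series_eq_V:
  assumes t: "-1/4 < t" "t < 1/4"
  shows "(\<lambda>k. (-1)^k * g6 (1 + t + real k)) sums (4 * Gamma (1 + t)^2 * V (2 * t) t)"
proof -
  define q where "q = (\<lambda>l m. Gamma (1 + t + real l)^2 * Gamma (1 + t + real l + real m)
      / (Gamma (2 + 3*t + 3 * real l + real m) * (1 + 2*t + 2 * real l + real m)^2))"
  define R where "R = (\<lambda>l. \<Sum>m. q l m)"
  have q0: "q 0 m = Gamma (1+t)^2 * V_series (2*t) t m" for m
    by (simp add: q_def V_series_def algebra_simps)
  have q_nonneg: "q l m \<ge> 0" for l m
    unfolding q_def using t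
    by (intro divide_nonneg_nonneg mult_nonneg_nonneg Gamma_real_nonneg) auto
  \<comment> \<open>The factors K / (x + 1) and K / (x + 2) supply the 1/4. This geometric decay in
    l bounds every row by row 0 and makes the row sums \<open>R\<close> tend to 0.\<close>
  have q_step: "q (Suc l) m \<le> q l m / 4" for l m
  proof -
    define K where "K = 1 + t + real l"
    define x where "x = 2 + 3*t + 3 * real l + real m"
    define M where "M = 1 + 2*t + 2 * real l + real m"
    have pos: "K > 0" "x > 0" "M > 0" using t by (auto simp: K_def x_def M_def)
    have G1: "Gamma (K + 1) = K * Gamma K" "Gamma (K + real m + 1) = (K + m) * Gamma (K + m)"
      using pos by (auto intro: Gamma_Suc_real)
    have G2: "Gamma (x + 3) = (x + 2) * ((x + 1) * (x * Gamma x))"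
      using Gamma_Suc_real[of x] Gamma_Suc_real[of "x+1"] Gamma_Suc_real[of "x+2"] pos
      by (simp add: add_ac)
    have Gx: "Gamma x > 0" using pos by (simp add: Gamma_real_pos)
    have qS: "q (Suc l) m = Gamma (K + 1)^2 * Gamma (K + real m + 1) / (Gamma (x + 3) * (M + 2)^2)"
      by (simp add: q_def K_def x_def M_def algebra_simps)
    have ql: "q l m = Gamma K^2 * Gamma (K + real m) / (Gamma x * M^2)"
      by (simp add: q_def K_def x_def M_def algebra_simps)
    have "q (Suc l) m = q l m * ((K / (x + 1)) * (K / (x + 2)) * ((K + m) / x) * (M / (M + 2))^2)"
    proof -
      have "(K * G)^2 * (y * H) / ((b * (a * (x * X))) * c^2)
          = G^2 * H / (X * M^2) * ((K / a) * (K / b) * (y / x) * (M / c)^2)"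
        if "a > 0" "b > 0" "c > 0" "X > 0" for a b c X y G H :: real
        using that pos by (simp add: divide_simps power2_eq_square)
      then show ?thesis unfolding qS ql G1 G2 using pos Gx by simp
    qed
    also have "\<dots> \<le> q l m * ((1/2) * (1/2) * 1 * 1)"
    proof (intro mult_left_mono mult_mono q_nonneg)
      show "K / (x + 1) \<le> 1/2" "K / (x + 2) \<le> 1/2" "(K + m) / x \<le> 1"
        using pos t by (auto simp: field_simps) (auto simp: K_def x_def)
      show "(M / (M + 2))^2 \<le> 1" using pos by (intro power_le_one) auto
    qed (use pos in auto)
    finally show ?thesis by simp
  qed
  have q_le: "q l m \<le> (1/4)^l * q 0 m" for l m
  proof (induction l)
    case (Suc l) show ?case using q_step[of l m] Suc by simp
  qed simp
  have sum0: "summable (q 0)"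
    unfolding q0 using t by (intro summable_mult summable_V_series) auto
  have sumq: "summable (q l)" for l
  proof (rule summable_comparison_test')
    show "summable (\<lambda>m. (1/4)^l * q 0 m)" by (intro summable_mult sum0)
  qed (use q_nonneg q_le in auto)
  have R0: "R 0 = Gamma (1+t)^2 * V (2*t) t"
    unfolding R_def q0 V_def using t by (intro suminf_mult summable_V_series) auto
  have R_nonneg: "R l \<ge> 0" for l unfolding R_def by (intro suminf_nonneg sumq q_nonneg)
  have R_le: "R l \<le> (1/4)^l * R 0" for l
  proof -
    have "R l \<le> (\<Sum>m. (1/4)^l * q 0 m)" unfolding R_def
      by (intro suminf_le q_le sumq summable_mult sum0)
    also have "\<dots> = (1/4)^l * R 0" unfolding R_def by (intro suminf_mult sum0)
    finally show ?thesis .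
  qed
  have "(\<lambda>l. (1/4)^l * R 0) \<longlonglongrightarrow> 0 * R 0"
    by (intro tendsto_mult LIMSEQ_power_zero tendsto_const) auto
  then have R_lim: "R \<longlonglongrightarrow> 0"
    by (intro Lim_null_comparison[where f = R and g = "\<lambda>l. (1/4)^l * R 0"])
       (auto simp: R_nonneg R_le)
  \<comment> \<open>Raising l by one raises M by two, so \<open>q l (m + 2)\<close> and
    \<open>q (Suc l) m\<close> have the same M and neighbouring K. Their sum is a difference of
    \<open>f\<close>, which telescopes in m; the two entries skipped by the shift and the boundary
    value \<open>f 0\<close> make up the summand.\<close>
  have step: "g6 (1 + t + real l) / 4 = R l + R (Suc l)" for l
  proof -
    define K where "K = 1 + t + real l"
    have K: "K > 3/4" using t by (auto simp: K_def)
    define f where "f = (\<lambda>m. Gamma K ^2 * Gamma (1 + K + real m) / (Gamma (3 * K + 1 + real m) * K))"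
    have f_step: "f m - f (Suc m) = 2 * (q l (m + 2) + q (Suc l) m)" for m
    proof -
      define y where "y = 1 + K + real m"
      define x where "x = 3 * K + 1 + real m"
      define M where "M = 2 * K + 1 + real m"
      have pos: "y > 0" "x > 0" "M > 0" using K by (auto simp: y_def x_def M_def)
      have G: "Gamma (y + 1) = y * Gamma y" "Gamma (x + 1) = x * Gamma x" "Gamma (K + 1) = K * Gamma K"
        using pos K by (auto intro: Gamma_Suc_real)
      have "q l (m + 2) = Gamma K ^2 * Gamma (y + 1) / (Gamma x * M^2)"
        by (simp add: q_def K_def x_def M_def y_def algebra_simps)
      moreover have "q (Suc l) m = Gamma (K + 1)^2 * Gamma y / (Gamma (x + 1) * M^2)"
        by (simp add: q_def K_def x_def M_def y_def algebra_simps)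
      moreover have "f m = Gamma K^2 * Gamma y / (Gamma x * K)"
        by (simp add: f_def x_def y_def)
      moreover have "f (Suc m) = Gamma K^2 * Gamma (y + 1) / (Gamma (x + 1) * K)"
        by (simp add: f_def x_def y_def add_ac)
      moreover have "A^2 * Y / (X * K) - A^2 * (y * Y) / ((x * X) * K)
          = 2 * (A^2 * (y * Y) / (X * M^2) + (K * A)^2 * Y / ((x * X) * M^2))" if "X > 0" for A X Y :: real
      proof -
        \<comment> \<open>Since x = M + K and y = M - K, the WZ identity rests on x - y = 2K and x y
          = M^2 - K^2.\<close>
        have xy: "(x - y) / K = 2" using K by (simp add: x_def y_def)
        have sq: "x * y + K^2 = M^2" by (simp add: x_def y_def M_def power2_eq_square algebra_simps)
        have "A^2 * Y / (X * K) - A^2 * (y * Y) / ((x * X) * K) = A^2 * Y / (X * x) * ((x - y) / K)"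
          using pos K that by (simp add: divide_simps) (simp add: algebra_simps)
        also have "\<dots> = 2 * (A^2 * Y / (X * x) * (M^2 / M^2))" using pos by (simp add: xy)
        also have "\<dots> = 2 * (A^2 * (y * Y) / (X * M^2) + (K * A)^2 * Y / ((x * X) * M^2))"
          unfolding sq[symmetric] using pos that
          by (simp add: divide_simps power2_eq_square add_eq_0_iff) (simp add: algebra_simps)
        finally show ?thesis .
      qed
      moreover have "Gamma x > 0" using pos by (simp add: Gamma_real_pos)
      ultimately show ?thesis by (simp add: G)
    qed
    have "(\<lambda>m. Gamma K ^2 / K * (Gamma (1 + K + real m) / Gamma (3 * K + 1 + real m))) \<longlonglongrightarrow> 0"
      using K by (intro tendsto_mult_right_zero Gamma_quotient_tendsto_0) auto
    then have f_lim: "f \<longlonglongrightarrow> 0" by (simp add: f_def mult_ac)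
    have "(\<lambda>m. f m - f (Suc m)) sums (f 0 - 0)" by (rule telescope_sums'[OF f_lim])
    then have "(\<lambda>m. 2 * (q l (m + 2) + q (Suc l) m)) sums f 0" by (simp add: f_step)
    moreover have "(\<lambda>m. 2 * (q l (m + 2) + q (Suc l) m)) sums (2 * ((R l - (q l 0 + q l 1)) + R (Suc l)))"
    proof (intro sums_mult sums_add)
      show "q (Suc l) sums R (Suc l)" unfolding R_def by (rule summable_sums[OF sumq])
      have "q l sums R l" unfolding R_def by (rule summable_sums[OF sumq])
      from sums_split_initial_segment[OF this, of 2]
      show "(\<lambda>m. q l (m + 2)) sums (R l - (q l 0 + q l 1))"
        by (simp add: numeral_2_eq_2)
    qed
    ultimately have "f 0 = 2 * ((R l - (q l 0 + q l 1)) + R (Suc l))" by (rule sums_unique2)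
    then have "R l + R (Suc l) = q l 0 + q l 1 + f 0 / 2" by (simp add: field_simps)
    also have "\<dots> = g6 K / 4"
    proof -
      have GK: "Gamma (K + 1) = K * Gamma K" "Gamma (3 * K + 1) = 3 * K * Gamma (3 * K)"
         "Gamma (3 * K) = (3 * K - 1) * Gamma (3 * K - 1)"
        using K Gamma_Suc_real[of K] Gamma_Suc_real[of "3*K"] Gamma_Suc_real[of "3*K-1"] by auto
      have "q l 0 = Gamma K ^2 * Gamma K / (Gamma (3 * K - 1) * (2 * K - 1)^2)"
        by (simp add: q_def K_def algebra_simps)
      moreover have "q l 1 = Gamma K ^2 * Gamma (K + 1) / (Gamma (3 * K) * (2 * K)^2)"
        by (simp add: q_def K_def algebra_simps)
      moreover have "f 0 = Gamma K ^2 * Gamma (K + 1) / (Gamma (3 * K + 1) * K)"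
        by (simp add: f_def add_ac)
      moreover have "Gamma (3 * K - 1) > 0" using K by (simp add: Gamma_real_pos)
      moreover have "2 * K - 1 > 0" "3 * K - 1 > 0" "K > 0" using K by auto
      moreover have "Gamma K^2 * Gamma K / (G * d^2) + Gamma K ^2 * (K * Gamma K) / ((e * G) * (2 * K)^2)
           + Gamma K ^2 * (K * Gamma K) / ((3 * K * (e * G)) * K) / 2
         = (12 * K * e + 5 * d^2) * Gamma K ^ 3 / (d^2 * (3 * K * (e * G))) / 4"
        if "G > 0" "d > 0" "e > 0" "K > 0" for G d e
        using that by (simp add: divide_simps) (simp add: power2_eq_square power3_eq_cube algebra_simps)
      \<comment> \<open>Origin of the quadratic polynomial in \<open>f6\<close>: the numerator of
        the three leftover terms over their common denominator.\<close>
      moreover have "12 * K * (3 * K - 1) + 5 * (2 * K - 1)^2 = 56 * K^2 - 32 * K + 5"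
        by (simp add: power2_eq_square algebra_simps)
      ultimately show ?thesis by (simp add: g6_def GK)
    qed
    finally show ?thesis by (simp add: K_def)
  qed
  \<comment> \<open>The alternating sum of R l + R (l + 1) collapses to \<open>R 0\<close>, the row
    that is \<open>V (2 * t) t\<close> up to Gamma(1 + t)^2.\<close>
  have "(\<lambda>l. (-1)^l * R l) \<longlonglongrightarrow> 0"
    using R_lim by (intro Lim_null_comparison[OF _ R_lim] always_eventually) (simp add: abs_mult R_nonneg)
  from telescope_sums'[OF this]
  have "(\<lambda>l. (-1)^l * R l - (-1)^Suc l * R (Suc l)) sums R 0" by simp
  also have "(\<lambda>l. (-1)^l * R l - (-1)^Suc l * R (Suc l)) = (\<lambda>l. (-1)^l * g6 (1 + t + real l) / 4)"
  proof
    fix l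
    have "g6 (1 + t + real l) = 4 * (R l + R (Suc l))" using step[of l] by simp
    then show "(-1)^l * R l - (-1)^Suc l * R (Suc l) = (-1)^l * g6 (1 + t + real l) / 4"
      by (simp add: algebra_simps)
  qed
  finally have "(\<lambda>l. 4 * ((-1)^l * g6 (1 + t + real l) / 4)) sums (4 * R 0)" by (rule sums_mult)
  then show ?thesis by (simp add: R0 mult.assoc)
qed

section \<open>The companion series\<close>

lemma rGamma_reflection_real: "rGamma x * rGamma (1 - x) = sin (pi * x) / (pi::real)"
proof -
  have "complex_of_real (rGamma x * rGamma (1 - x)) = rGamma (of_real x) * rGamma (of_real (1 - x))"
    by (simp only: rGamma_complex_of_real of_real_mult)
  also have "\<dots> = sin (of_real pi * of_real x) / of_real pi"
    using rGamma_reflection_complex[of "of_real x"] by simp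
  also have "\<dots> = of_real (sin (pi * x) / pi)"
    by (simp only: of_real_mult[symmetric] sin_of_real of_real_divide[symmetric])
  finally show ?thesis by (simp only: of_real_eq_iff)
qed

lemma rGamma_pos_real: "x > 0 \<Longrightarrow> rGamma (x::real) > 0"
  by (simp add: rGamma_inverse_Gamma Gamma_real_pos)

lemma rGamma_mult_eqD:
  assumes "rGamma x * rGamma y = z" "y > (0::real)"
  shows "rGamma x = z * Gamma y"
proof -
  have "rGamma y * Gamma y = 1"
    using Gamma_real_pos[OF assms(2)] by (simp add: rGamma_inverse_Gamma)
  then have "rGamma x * (rGamma y * Gamma y) = rGamma x" by simp
  then show ?thesis using assms(1) by (simp only: mult.assoc[symmetric])
qed

text \<open>In Gauss's product for 1 / Gamma the powers of n have exponents s, s - b and s + b. They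
  cancel because (s - b) + (s + b) = 2s, and what remains is a quotient of Pochhammer symbols, that
  is, the Gamma quotient up to its value at n = 0.\<close>

lemma Gamma_triple_quotient_tendsto_1:
  fixes s b :: real
  assumes "s \<notin> \<int>\<^sub>\<le>\<^sub>0" "s - b \<notin> \<int>\<^sub>\<le>\<^sub>0" "s + b \<notin> \<int>\<^sub>\<le>\<^sub>0"
  shows "(\<lambda>n. Gamma (s + real n)^2 * rGamma (s + real n - b) * rGamma (s + real n + b)) \<longlonglongrightarrow> 1"
\<comment> \<open>\<open>rGamma_series s n\<close> contains the Pochhammer symbol of length n + 1,
  so the limit is taken along \<open>Suc n\<close>.\<close>
proof (rule LIMSEQ_imp_Suc)
  define C where "C = Gamma s^2 * rGamma (s - b) * rGamma (s + b)"
  have "(\<lambda>n. rGamma_series s n ^ 2 / (rGamma_series (s - b) n * rGamma_series (s + b) n) * C)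
     \<longlonglongrightarrow> rGamma s ^ 2 / (rGamma (s - b) * rGamma (s + b)) * C"
    using assms by (intro tendsto_mult tendsto_divide tendsto_power rGamma_series_LIMSEQ tendsto_const)
      (auto simp: rGamma_eq_zero_iff)
  also have "rGamma s ^ 2 / (rGamma (s - b) * rGamma (s + b)) * C = 1"
  proof -
    have "x^2 / (y * z) * (X^2 * y * z) = 1" if "y \<noteq> 0" "z \<noteq> 0" "x * X = 1" for x y z X :: real
      using that by (simp add: power_mult_distrib[symmetric])
    moreover have "rGamma s * Gamma s = 1"
      using assms by (simp add: rGamma_inverse_Gamma Gamma_eq_zero_iff)
    ultimately show ?thesis unfolding C_def using assms by (simp only: rGamma_eq_zero_iff not_False_eq_True)
  qed
  also have "(\<lambda>n. rGamma_series s n ^ 2 / (rGamma_series (s - b) n * rGamma_series (s + b) n) * C)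
     = (\<lambda>n. Gamma (s + real (Suc n))^2 * rGamma (s + real (Suc n) - b) * rGamma (s + real (Suc n) + b))"
  proof
    fix n
    have G: "Gamma (z + real (Suc n)) = pochhammer z (Suc n) * Gamma z" if "z \<notin> \<int>\<^sub>\<le>\<^sub>0" for z :: real
      using pochhammer_Gamma[OF that, of "Suc n"] that by (simp add: Gamma_eq_zero_iff)
    have "s + real (Suc n) - b = (s - b) + real (Suc n)" "s + real (Suc n) + b = (s + b) + real (Suc n)"
      by auto
    then have R: "rGamma (s + real (Suc n) - b) = inverse (pochhammer (s - b) (Suc n) * Gamma (s - b))"
       "rGamma (s + real (Suc n) + b) = inverse (pochhammer (s + b) (Suc n) * Gamma (s + b))"
      using G[OF assms(2)] G[OF assms(3)] by (simp_all only: rGamma_inverse_Gamma)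
    have ex: "exp ((s - b) * ln (real n)) * exp ((s + b) * ln (real n)) = exp (s * ln (real n))^2"
      by (simp add: exp_add[symmetric] power2_eq_square algebra_simps)
    have "pochhammer (s - b) (Suc n) \<noteq> 0" "pochhammer (s + b) (Suc n) \<noteq> 0"
      using assms by (auto dest: pochhammer_eq_0_imp_nonpos_Int)
    then have "rGamma_series s n ^ 2 / (rGamma_series (s - b) n * rGamma_series (s + b) n)
       = pochhammer s (Suc n) ^ 2 / (pochhammer (s - b) (Suc n) * pochhammer (s + b) (Suc n))
          * ((exp ((s - b) * ln (real n)) * exp ((s + b) * ln (real n))) / exp (s * ln (real n))^2)"
      by (simp add: rGamma_series_def power_divide power_mult_distrib power2_eq_square mult_ac del: pochhammer_Suc)
    also have "\<dots> = pochhammer s (Suc n) ^ 2 / (pochhammer (s - b) (Suc n) * pochhammer (s + b) (Suc n))"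
      unfolding ex by simp
    finally have eq: "rGamma_series s n ^ 2 / (rGamma_series (s - b) n * rGamma_series (s + b) n)
       = pochhammer s (Suc n) ^ 2 / (pochhammer (s - b) (Suc n) * pochhammer (s + b) (Suc n))" .
    show "rGamma_series s n ^ 2 / (rGamma_series (s - b) n * rGamma_series (s + b) n) * C
        = Gamma (s + real (Suc n))^2 * rGamma (s + real (Suc n) - b) * rGamma (s + real (Suc n) + b)"
    proof -
      have "p^2 / (q * r) * (X^2 * inverse Y * inverse Z) = (p * X)^2 * inverse (q * Y) * inverse (r * Z)"
        for p q r X Y Z :: real by (simp add: divide_inverse power_mult_distrib mult_ac)
      then show ?thesis unfolding eq R G[OF assms(1)] C_def
        by (simp only: rGamma_inverse_Gamma[of "s - b"] rGamma_inverse_Gamma[of "s + b"])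
    qed
  qed
  finally show "(\<lambda>n. Gamma (s + real (Suc n))^2 * rGamma (s + real (Suc n) - b) * rGamma (s + real (Suc n) + b)) \<longlonglongrightarrow> 1" .
qed

text \<open>Closed form of the infinite product of 1 - a^2 / (j + 1 + t)^2 over j \<ge> i; thus
  \<open>c6 a t (Suc i)\<close> is the product beyond i that occurs in \<open>S\<close>. The entire
  function \<open>rGamma\<close> keeps the formula meaningful where \<open>Gamma\<close> has
  poles.\<close>

definition c6 :: "real \<Rightarrow> real \<Rightarrow> nat \<Rightarrow> real" where
  "c6 a t i = Gamma (1 + t + real i)^2 * rGamma (1 + t + real i - a) * rGamma (1 + t + real i + a)"

definition S6 :: "real \<Rightarrow> real \<Rightarrow> real" where
  "S6 a t = (\<Sum>i. c6 a t (Suc i) / (1 + t + real i)^3)"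

lemma not_nonpos_Ints_realI: "x > 0 \<Longrightarrow> (x::real) \<notin> \<int>\<^sub>\<le>\<^sub>0"
  by (auto elim!: nonpos_Ints_cases)

lemma c6_tendsto_1:
  assumes "1 + t > 0" "1 + t + a > 0" "a - t \<notin> \<int>"
  shows "c6 a t \<longlonglongrightarrow> 1"
  unfolding c6_def
proof (rule Gamma_triple_quotient_tendsto_1)
  show "1 + t - a \<notin> \<int>\<^sub>\<le>\<^sub>0"
  proof
    assume "1 + t - a \<in> \<int>\<^sub>\<le>\<^sub>0"
    then have "1 + t - a \<in> \<int>" using nonpos_Ints_subset_Ints by blast
    then have "1 - (1 + t - a) \<in> \<int>" by (rule Ints_diff[OF Ints_1])
    also have "1 - (1 + t - a) = a - t" by simp
    finally show False using assms by simp
  qed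
qed (use assms in \<open>auto intro!: not_nonpos_Ints_realI\<close>)

lemma c6_Suc:
  assumes "1 + t > 0"
  shows "c6 a t i * (1 + t + real i)^2 = c6 a t (Suc i) * ((1 + t + real i)^2 - a^2)"
proof -
  define w where "w = 1 + t + real i"
  have "w > 0" using assms by (simp add: w_def)
  have c: "c6 a t i = Gamma w^2 * rGamma (w - a) * rGamma (w + a)"
     "c6 a t (Suc i) = Gamma (w + 1)^2 * rGamma (w - a + 1) * rGamma (w + a + 1)"
    by (simp_all add: c6_def w_def algebra_simps)
  have r: "rGamma (w - a) = (w - a) * rGamma (w - a + 1)" "rGamma (w + a) = (w + a) * rGamma (w + a + 1)"
    by (simp_all add: rGamma_plus1)
  show ?thesis
    unfolding c r Gamma_Suc_real[OF \<open>w > 0\<close>] w_def[symmetric] by (simp add: power2_eq_square algebra_simps)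
qed

lemma summable_c6_power:
  assumes "1 + t > 0" "1 + t + a > 0" "a - t \<notin> \<int>" "k \<ge> 2"
  shows "summable (\<lambda>i. \<bar>c6 a t (Suc i)\<bar> / (1 + t + real i)^k)"
proof -
  obtain C where C: "\<And>i. norm (c6 a t i) \<le> C"
    using convergent_imp_Bseq[OF convergentI[OF c6_tendsto_1[OF assms(1-3)]]]
    by (auto simp: Bseq_def)
  have "summable (\<lambda>i. C * inverse ((1 + t + real i)^k))"
    using assms by (intro summable_mult Polygamma_converges') auto
  then show ?thesis
  proof (rule summable_comparison_test'[where N = 0])
    fix i
    show "norm (\<bar>c6 a t (Suc i)\<bar> / (1 + t + real i)^k) \<le> C * inverse ((1 + t + real i)^k)"
      using C[of "Suc i"] assms by (simp add: field_simps divide_right_mono)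
  qed
qed

text \<open>
  The alternating series does not depend on \<open>t\<close>, so that the right-hand sides for different \<open>t\<close> can be compared.
\<close>

lemma S6_eq_V:
  assumes t: "-1/4 < t" "t < 1/4" and a: "\<bar>a\<bar> \<le> 1/2" "a \<noteq> 0" "a - t \<notin> \<int>"
  shows "(\<lambda>m. 2 * (-1)^m / (real m + 1 + a)^2) sums
     ((1 - c6 a t 0) / a^2 - a * S6 a t - 2 * Gamma (1 + t)^2 * (sin (pi * (a - t)) / pi) * V a t)"
proof -
  have pos: "1 + t > 0" "1 + t + a > 0" using t a by auto
  define w where "w = (\<lambda>i. 1 + t + real i)"
  define M where "M = (\<lambda>m. 1 + a + real m)"
  have w: "w i \<ge> 3/4" "w (Suc i) = w i + 1" for i using t by (auto simp: w_def)
  have M: "M m \<ge> 1/2" "M (Suc m) = M m + 1" for m using a by (auto simp: M_def)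
  \<comment> \<open>The WZ pair with Gamma(M - K) replaced by 1 / Gamma(K + 1 - M). By the
    reflection formula they differ by a sine that only changes sign under unit shifts, so (-1)^K
    becomes (-1)^m. In this form K can go to infinity for fixed M without meeting poles.\<close>
  define F where "F = (\<lambda>m i. (-1)^m * (Gamma (w i)^2 * rGamma (w i + 1 - M m) * rGamma (w i + M m) / w i))"
  define G where "G = (\<lambda>m i. 2 * (-1)^m * (Gamma (w i)^2 * rGamma (w i - M m) * rGamma (w i + M m) / M m^2))"
  have FG: "F (Suc m) i - F m i = G m i - G m (Suc i)" for m i
  proof -
    define y where "y = w i" define n where "n = M m"
    have p: "y > 0" "n > 0" using w(1)[of i] M(1)[of m] by (auto simp: y_def n_def)
    define r where "r = rGamma (y + 1 - n)" define s where "s = rGamma (y + 1 + n)"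
    have e: "rGamma (y - n) = (y - n) * r" "rGamma (y + n) = (y + n) * s" "Gamma (y + 1) = y * Gamma y"
      using rGamma_plus1[of "y - n"] rGamma_plus1[of "y + n"] Gamma_Suc_real[OF p(1)]
      by (auto simp: r_def s_def algebra_simps)
    have Fs: "F (Suc m) i = (-1)^Suc m * (Gamma y^2 * rGamma (y - n) * s / y)"
        "F m i = (-1)^m * (Gamma y^2 * r * rGamma (y + n) / y)"
      by (simp_all add: F_def M y_def n_def r_def s_def add_ac)
    have Gs: "G m i = 2 * (-1)^m * (Gamma y^2 * rGamma (y - n) * rGamma (y + n) / n^2)"
       "G m (Suc i) = 2 * (-1)^m * (Gamma (y + 1)^2 * r * s / n^2)"
      by (simp_all add: G_def w y_def n_def r_def s_def add_ac)
    have "F (Suc m) i - F m i = (-1)^m * (- (Gamma y^2 * ((y - n) * r) * s / y) - Gamma y^2 * r * ((y + n) * s) / y)"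
      unfolding Fs e using p by (simp add: field_simps)
    also have "\<dots> = (-1)^m * (- 2 * Gamma y^2 * r * s)"
      using p by (simp add: divide_simps) (simp add: algebra_simps)
    also have "\<dots> = (-1)^m * (2 * (Gamma y^2 * ((y - n) * r) * ((y + n) * s) / n^2) - 2 * ((y * Gamma y)^2 * r * s / n^2))"
      using p by (simp add: divide_simps) (simp add: algebra_simps power2_eq_square)
    also have "\<dots> = G m i - G m (Suc i)"
      unfolding Gs e using p by (simp add: field_simps)
    finally show ?thesis .
  qed
  have F0: "F 0 i = c6 a t (Suc i) * (w i - a) / w i^3" for i
  proof -
    define y where "y = w i"
    define r where "r = rGamma (y - a + 1)" define s where "s = rGamma (y + 1 + a)"
    have y: "y > 0" using w(1)[of i] by (simp add: y_def)
    have e: "rGamma (y - a) = (y - a) * r" "Gamma (y + 1) = y * Gamma y"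
      using y by (simp_all add: r_def rGamma_plus1 Gamma_Suc_real)
    have "F 0 i = Gamma y^2 * rGamma (y - a) * s / y" "c6 a t (Suc i) = Gamma (y + 1)^2 * r * s"
      by (simp_all add: F_def M_def c6_def y_def r_def s_def w_def algebra_simps)
    then show ?thesis unfolding e y_def[symmetric] using y by (simp add: power2_eq_square power3_eq_cube)
  qed
  \<comment> \<open>Passing from m to m + 1 replaces a factor M + K by M - K in absolute value.
    Hence \<open>F 0\<close> dominates all \<open>F m\<close>, which is the majorant for Tannery's
    theorem as m tends to infinity.\<close>
  have F_mono: "\<bar>F (Suc m) i\<bar> \<le> \<bar>F m i\<bar>" for m i
  proof -
    define y where "y = w i" define n where "n = M m"
    have p: "y > 0" "n > 0" using w(1)[of i] M(1)[of m] by (auto simp: y_def n_def)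
    define r where "r = rGamma (y + 1 - n)" define s where "s = rGamma (y + 1 + n)"
    have e: "rGamma (y - n) = (y - n) * r" "rGamma (y + n) = (y + n) * s"
      using rGamma_plus1[of "y - n"] rGamma_plus1[of "y + n"]
      by (auto simp: r_def s_def algebra_simps)
    have Fs: "F (Suc m) i = (-1)^Suc m * (Gamma y^2 * rGamma (y - n) * s / y)"
        "F m i = (-1)^m * (Gamma y^2 * r * rGamma (y + n) / y)"
      by (simp_all add: F_def M y_def n_def r_def s_def add_ac)
    have "\<bar>F (Suc m) i\<bar> = Gamma y^2 * \<bar>r\<bar> * \<bar>s\<bar> / y * \<bar>y - n\<bar>"
      unfolding Fs e using p by (simp add: abs_mult)
    also have "\<dots> \<le> Gamma y^2 * \<bar>r\<bar> * \<bar>s\<bar> / y * (y + n)"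
      using p by (intro mult_left_mono) auto
    also have "\<dots> = \<bar>F m i\<bar>"
      unfolding Fs e using p by (simp add: abs_mult)
    finally show ?thesis .
  qed
  have F_le: "\<bar>F m i\<bar> \<le> \<bar>F 0 i\<bar>" for m i
    by (induction m) (auto intro: order.trans[OF F_mono])
  have sumF0: "summable (\<lambda>i. \<bar>F 0 i\<bar>)"
  proof (rule summable_comparison_test'[where N = 0])
    show "summable (\<lambda>i. 2 * (\<bar>c6 a t (Suc i)\<bar> / (1 + t + real i)^2))"
      using pos a by (intro summable_mult summable_c6_power) auto
    fix i
    have "\<bar>w i - a\<bar> \<le> 2 * w i" using w(1)[of i] a by (auto simp: abs_if split: if_splits)
    then have "\<bar>c6 a t (Suc i)\<bar> * \<bar>w i - a\<bar> / w i^3 \<le> \<bar>c6 a t (Suc i)\<bar> * (2 * w i) / w i^3"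
      using w(1)[of i] by (intro divide_right_mono mult_left_mono) auto
    also have "\<dots> = 2 * (\<bar>c6 a t (Suc i)\<bar> / w i^2)"
      using w(1)[of i] by (simp add: power2_eq_square power3_eq_cube)
    finally show "norm \<bar>F 0 i\<bar> \<le> 2 * (\<bar>c6 a t (Suc i)\<bar> / (1 + t + real i)^2)"
      using w(1)[of i] by (simp add: F0 abs_mult) (simp add: w_def)
  qed
  \<comment> \<open>Once M exceeds K, reflection bounds the reciprocal Gamma factor by Gamma(M - K)
    / pi; the quotient against Gamma(M + K) vanishes since the gap 2K is at least 1.\<close>
  have F_lim: "(\<lambda>m. F m i) \<longlonglongrightarrow> 0" for i
  proof -
    obtain m0 :: nat where "w i - 1 - a < real m0" using reals_Archimedean2 by blast
    then have m0: "M m0 - w i > 0" by (simp add: M_def)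
    define C where "C = Gamma (w i)^2 / (pi * w i)"
    have "norm (F (m + m0) i) \<le> C * (Gamma (M m0 - w i + real m) / Gamma (M m0 + w i + real m))" for m
    proof -
      define n where "n = M (m + m0)"
      have n: "n = M m0 + real m" by (simp add: n_def M_def)
      have np: "n - w i > 0" using m0 n by simp
      have "rGamma (w i + 1 - n) * rGamma (n - w i) = sin (pi * (w i + 1 - n)) / pi"
        using rGamma_reflection_real[of "w i + 1 - n"] by (simp add: algebra_simps)
      then have "rGamma (w i + 1 - n) = sin (pi * (w i + 1 - n)) / pi * Gamma (n - w i)"
        by (rule rGamma_mult_eqD[OF _ np])
      then have "\<bar>rGamma (w i + 1 - n)\<bar> \<le> 1 / pi * Gamma (n - w i)"
        using Gamma_real_pos[OF np] abs_sin_le_one[of "pi * (w i + 1 - n)"]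
        by (simp add: abs_mult divide_right_mono mult_right_mono)
      moreover have "rGamma (w i + n) > 0" using np w(1)[of i] by (intro rGamma_pos_real) auto
      moreover have "norm (F (m + m0) i) = Gamma (w i)^2 / w i * rGamma (w i + n) * \<bar>rGamma (w i + 1 - n)\<bar>"
        unfolding F_def n_def[symmetric] using w(1)[of i] calculation(2) by (simp add: abs_mult)
      ultimately have "norm (F (m + m0) i) \<le> Gamma (w i)^2 / w i * rGamma (w i + n) * (1 / pi * Gamma (n - w i))"
        using w(1)[of i] by (simp only:) (intro mult_left_mono, auto)
      also have "\<dots> = C * (Gamma (M m0 - w i + real m) / Gamma (M m0 + w i + real m))"
        by (simp add: C_def n rGamma_inverse_Gamma field_simps)
      finally show ?thesis .
    qed
    moreover have "(\<lambda>m. C * (Gamma (M m0 - w i + real m) / Gamma (M m0 + w i + real m))) \<longlonglongrightarrow> 0"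
      using m0 w(1)[of i] by (intro tendsto_mult_right_zero Gamma_quotient_tendsto_0) auto
    ultimately have "(\<lambda>m. F (m + m0) i) \<longlonglongrightarrow> 0"
      by (rule Lim_null_comparison[OF always_eventually[OF allI]])
    then show ?thesis by (rule LIMSEQ_offset)
  qed
  define B where "B = (\<lambda>m. \<Sum>i. F m i)"
  have sumF: "summable (F m)" for m
    by (rule summable_comparison_test'[OF sumF0, of 0]) (use F_le in auto)
  have "eventually (\<lambda>(i, m). norm (F m i) \<le> \<bar>F 0 i\<bar>) (at_top \<times>\<^sub>F at_top)"
    using F_le by (intro always_eventually) auto
  from tannerys_theorem[OF F_lim this sumF0]
  have "B \<longlonglongrightarrow> (\<Sum>i. 0)" unfolding B_def by simp
  then have B_lim: "B \<longlonglongrightarrow> 0" by simp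
  \<comment> \<open>The boundary term at K = infinity does not vanish: it is the source of the
    alternating series, and it no longer contains t.\<close>
  have G_lim: "G m \<longlonglongrightarrow> 2 * (-1)^m / M m^2" for m
  proof -
    have "1 + t - M m \<notin> \<int>\<^sub>\<le>\<^sub>0"
    proof
      assume "1 + t - M m \<in> \<int>\<^sub>\<le>\<^sub>0"
      then have "1 + t - M m \<in> \<int>" using nonpos_Ints_subset_Ints by blast
      then have "- (1 + t - M m) - of_nat m \<in> \<int>" by (rule Ints_diff[OF Ints_minus Ints_of_nat])
      also have "- (1 + t - M m) - of_nat m = a - t" by (simp add: M_def)
      finally show False using a by simp
    qed
    then have "(\<lambda>n. Gamma (1 + t + real n)^2 * rGamma (1 + t + real n - M m) * rGamma (1 + t + real n + M m)) \<longlonglongrightarrow> 1"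
      using pos M(1)[of m] by (intro Gamma_triple_quotient_tendsto_1) (auto intro!: not_nonpos_Ints_realI)
    then have "(\<lambda>n. 2 * (-1)^m / M m^2 * (Gamma (1 + t + real n)^2 * rGamma (1 + t + real n - M m) * rGamma (1 + t + real n + M m)))
        \<longlonglongrightarrow> 2 * (-1)^m / M m^2 * 1"
      by (intro tendsto_mult tendsto_const)
    then show ?thesis by (simp add: G_def w_def field_simps)
  qed
  \<comment> \<open>At the other end, reflection returns to Gamma(M - t). The two signs (-1)^m
    cancel, so the sine factor does not depend on m and can be pulled out of the sum giving
    \<open>V\<close>.\<close>
  have G0: "G m 0 = - (2 * Gamma (1+t)^2 * (sin (pi * (a - t)) / pi) * V_series a t m)" for m
  proof -
    have p: "M m - t > 0" using M(1)[of m] t by auto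
    have "rGamma (1 + t - M m) * rGamma (M m - t) = sin (pi * (1 + t - M m)) / pi"
      using rGamma_reflection_real[of "1 + t - M m"] by (simp add: algebra_simps)
    moreover have "sin (pi * (1 + t - M m)) = - ((-1)^m * sin (pi * (a - t)))"
    proof -
      have "sin (pi * (1 + t - M m)) = sin (- (pi * (a - t)) - pi * real m)" by (simp add: M_def algebra_simps)
      also have "\<dots> = sin (- (pi * (a - t))) * cos (real m * pi) - cos (- (pi * (a - t))) * sin (real m * pi)"
        by (simp only: sin_diff mult.commute[of pi "real m"])
      finally show ?thesis by (simp only: cos_npi sin_npi) simp
    qed
    ultimately have r: "rGamma (1 + t - M m) = - ((-1)^m * (sin (pi * (a - t)) / pi)) * Gamma (M m - t)"
      by (intro rGamma_mult_eqD[OF _ p]) simp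
    have V: "V_series a t m = Gamma (M m - t) * rGamma (1 + t + M m) / M m^2"
      by (simp add: V_series_def M_def rGamma_inverse_Gamma field_simps)
    have "(-1)^m * (-1)^m = (1::real)" by (simp flip: power_add)
    then show ?thesis unfolding V G_def w_def
      by (simp add: r field_simps)
  qed
  have step: "B m - B (Suc m) = 2 * (-1)^m / M m^2 + 2 * Gamma (1+t)^2 * (sin (pi * (a - t)) / pi) * V_series a t m" for m
  proof -
    have "(\<lambda>i. G m i - G m (Suc i)) sums (G m 0 - 2 * (-1)^m / M m^2)"
      by (rule telescope_sums'[OF G_lim])
    then have "(\<lambda>i. F (Suc m) i - F m i) sums (G m 0 - 2 * (-1)^m / M m^2)" by (simp add: FG)
    moreover have "(\<lambda>i. F (Suc m) i - F m i) sums (B (Suc m) - B m)"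
      unfolding B_def by (intro sums_diff summable_sums sumF)
    ultimately have "B (Suc m) - B m = G m 0 - 2 * (-1)^m / M m^2" by (rule sums_unique2[rotated])
    then show ?thesis by (simp add: G0)
  qed
  have "(\<lambda>m. B m - B (Suc m)) sums (B 0 - 0)" by (rule telescope_sums'[OF B_lim])
  moreover have "(\<lambda>m. 2 * Gamma (1+t)^2 * (sin (pi * (a - t)) / pi) * V_series a t m) sums
      (2 * Gamma (1+t)^2 * (sin (pi * (a - t)) / pi) * V a t)"
    unfolding V_def using t a by (intro sums_mult summable_sums summable_V_series) auto
  ultimately have "(\<lambda>m. (B m - B (Suc m)) - 2 * Gamma (1+t)^2 * (sin (pi * (a - t)) / pi) * V_series a t m) sums
      (B 0 - 0 - 2 * Gamma (1+t)^2 * (sin (pi * (a - t)) / pi) * V a t)"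
    by (rule sums_diff)
  then have "(\<lambda>m. 2 * (-1)^m / M m^2) sums (B 0 - 2 * Gamma (1+t)^2 * (sin (pi * (a - t)) / pi) * V a t)"
    by (simp add: step)
  \<comment> \<open>\<open>F 0 i\<close> splits into c / w^2 - a c / w^3 with c =
    \<open>c6 a t (Suc i)\<close>. By the recurrence of \<open>c6\<close>, a^2 c / w^2 is a
    difference and telescopes; the second part is \<open>S6\<close>.\<close>
  moreover have "B 0 = (1 - c6 a t 0) / a^2 - a * S6 a t"
  proof -
    have "(\<lambda>i. c6 a t (Suc i) - c6 a t i) sums (1 - c6 a t 0)"
      using pos a by (intro telescope_sums c6_tendsto_1) auto
    moreover have "c6 a t (Suc i) - c6 a t i = a^2 * (c6 a t (Suc i) / w i^2)" for i
    proof -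
      have "c6 a t i = c6 a t (Suc i) * (w i^2 - a^2) / w i^2"
      proof -
        have "c6 a t i * w i^2 = c6 a t (Suc i) * (w i^2 - a^2)"
          using c6_Suc[OF pos(1), of a i] by (simp only: w_def)
        then show ?thesis using w(1)[of i] by (simp add: field_simps)
      qed
      then show ?thesis using w(1)[of i] by (simp add: field_simps)
    qed
    ultimately have "(\<lambda>i. a^2 * (c6 a t (Suc i) / w i^2)) sums (1 - c6 a t 0)" by simp
    then have "(\<lambda>i. a^2 * (c6 a t (Suc i) / w i^2) / a^2) sums ((1 - c6 a t 0) / a^2)" by (rule sums_divide)
    then have "(\<lambda>i. c6 a t (Suc i) / w i^2) sums ((1 - c6 a t 0) / a^2)" using a by simp
    moreover have "(\<lambda>i. c6 a t (Suc i) / w i^3) sums S6 a t"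
    proof -
      have "summable (\<lambda>i. \<bar>c6 a t (Suc i) / w i^3\<bar>)"
        using summable_c6_power[of t a 3] pos a w(1) by (simp add: w_def)
      from summable_sums[OF summable_rabs_cancel[OF this]] show ?thesis unfolding S6_def w_def .
    qed
    ultimately have "(\<lambda>i. c6 a t (Suc i) / w i^2 - a * (c6 a t (Suc i) / w i^3)) sums ((1 - c6 a t 0) / a^2 - a * S6 a t)"
      by (intro sums_diff sums_mult)
    moreover have "c6 a t (Suc i) / w i^2 - a * (c6 a t (Suc i) / w i^3) = F 0 i" for i
      unfolding F0 using w(1)[of i] by (simp add: field_simps power2_eq_square power3_eq_cube)
    ultimately show ?thesis unfolding B_def by (simp add: sums_iff)
  qed
  ultimately show ?thesis by (simp add: M_def algebra_simps)
qed

section \<open>The well-poised case\<close>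

lemma Gamma_real_nonzero: "x > 0 \<Longrightarrow> Gamma (x::real) \<noteq> 0"
  using Gamma_real_pos[of x] by linarith

text \<open>Expand (1 - x)^(-c) in Euler's integral for Beta(z, 1 - c) and integrate termwise. For c
  > 0 the binomial coefficients are nonnegative, so monotone convergence applies up to the singular
  end point.\<close>

lemma binomial_Beta_sums:
  fixes z c :: real
  assumes z: "z > 0" and c: "0 < c" "c < 1"
  shows "(\<lambda>n. pochhammer c n / fact n / (real n + z)) sums Beta z (1 - c)"
proof -
  define b where "b = (\<lambda>n. pochhammer c n / (fact n :: real))"
  have b_nonneg: "b n \<ge> 0" for n using c by (auto simp: b_def intro!: divide_nonneg_nonneg pochhammer_nonneg)
  define f where "f = (\<lambda>k x. \<Sum>n<k. b n * x powr (real n + z - 1))"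
  define g where "g = (\<lambda>x::real. x powr (z - 1) * (1 - x) powr ((1 - c) - 1))"
  have g_int: "(g has_integral Beta z (1 - c)) {0<..<1}"
    using has_integral_Beta_real[of z "1 - c"] z c by (simp add: g_def has_integral_Icc_iff_Ioo)
  have f_int: "(f k has_integral (\<Sum>n<k. b n / (real n + z))) {0<..<1}" for k
  proof -
    have "((\<lambda>x. b n * x powr (real n + z - 1)) has_integral b n * (1 / (real n + z))) {0<..<1}" for n
    proof (rule has_integral_mult_right)
      have "((\<lambda>x. x powr (real n + z - 1)) has_integral 1 powr (real n + z - 1 + 1) / (real n + z - 1 + 1)) {0..1}"
        using z by (intro has_integral_powr_from_0) auto
      then show "((\<lambda>x. x powr (real n + z - 1)) has_integral 1 / (real n + z)) {0<..<1}"
        by (simp add: has_integral_Icc_iff_Ioo)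
    qed
    then show ?thesis unfolding f_def by (intro has_integral_sum) auto
  qed
  have f_lim: "(\<lambda>k. f k x) \<longlonglongrightarrow> g x" if x: "x \<in> {0<..<1}" for x
  proof -
    have "(\<lambda>n. ((-c) gchoose n) * (-x)^n) sums (1 + (-x)) powr (-c)"
      using x by (intro gen_binomial_real) auto
    moreover have "((-c) gchoose n) * (-x)^n = b n * x^n" for n
    proof -
      have "((-c) gchoose n) = (-1)^n * b n"
        by (simp add: b_def gbinomial_pochhammer)
      moreover have "(-1)^n * (-1)^n = (1::real)" by (simp flip: power_mult_distrib)
      ultimately show ?thesis by (simp add: power_minus[of x n] mult_ac)
    qed
    ultimately have "(\<lambda>n. b n * x^n) sums (1 - x) powr (-c)" by simp
    then have "(\<lambda>n. x powr (z - 1) * (b n * x^n)) sums (x powr (z - 1) * (1 - x) powr (-c))"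
      by (rule sums_mult)
    moreover have "x powr (z - 1) * (b n * x^n) = b n * x powr (real n + z - 1)" for n
    proof -
      have "x powr (real n + z - 1) = x powr real n * x powr (z - 1)" by (simp add: powr_add[symmetric] algebra_simps)
      then show ?thesis using x by (simp add: powr_realpow)
    qed
    ultimately show ?thesis by (simp add: sums_def f_def g_def)
  qed
  have f_le: "f k x \<le> g x" if x: "x \<in> {0<..<1}" for k x
  proof (rule incseq_le[OF _ f_lim[OF x]])
    show "incseq (\<lambda>k. f k x)"
      by (intro incseq_SucI) (auto simp: f_def b_nonneg)
  qed
  have "(\<lambda>k. integral {0<..<1} (f k)) \<longlonglongrightarrow> integral {0<..<1} g"
  proof (rule monotone_convergence_increasing[THEN conjunct2])
    show "f k integrable_on {0<..<1}" for k using f_int by blast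
    show "f k x \<le> f (Suc k) x" for k x by (auto simp: f_def b_nonneg)
    show "bounded (range (\<lambda>k. integral {0<..<1} (f k)))"
    proof (rule boundedI)
      fix y assume "y \<in> range (\<lambda>k. integral {0<..<1} (f k))"
      then obtain k where y: "y = integral {0<..<1} (f k)" by auto
      have "0 \<le> y" unfolding y by (intro integral_nonneg has_integral_integrable[OF f_int])
        (auto simp: f_def b_nonneg intro!: sum_nonneg)
      moreover have "y \<le> integral {0<..<1} g" unfolding y
        by (intro integral_le has_integral_integrable[OF f_int] has_integral_integrable[OF g_int] f_le)
      ultimately show "norm y \<le> integral {0<..<1} g" by simp
    qed
  qed (use f_lim in auto)
  then have "(\<lambda>k. \<Sum>n<k. b n / (real n + z)) \<longlonglongrightarrow> Beta z (1 - c)"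
    using integral_unique[OF f_int] integral_unique[OF g_int] by simp
  then show ?thesis by (simp add: sums_def b_def)
qed

text \<open>The derivative in z of the previous expansion, up to sign. On the half-line beyond z/2
  the differentiated series is dominated by the original one at z/2, so termwise differentiation is
  justified.\<close>

lemma binomial_Beta_deriv_sums:
  fixes z c :: real
  assumes z: "z > 0" and c: "0 < c" "c < 1"
  shows "(\<lambda>n. pochhammer c n / fact n / (real n + z)^2) sums
    (Beta z (1 - c) * (Digamma (z + (1 - c)) - Digamma z))"
proof -
  define b where "b = (\<lambda>n. pochhammer c n / (fact n :: real))"
  have b_nonneg: "b n \<ge> 0" for n using c by (auto simp: b_def intro!: divide_nonneg_nonneg pochhammer_nonneg)
  define A where "A = {z/2<..}"
  have h: "(\<lambda>n. b n / (real n + x)) sums Beta x (1 - c)" if "x > 0" for x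
    using binomial_Beta_sums[OF that c] by (simp add: b_def)
  have bound: "norm (- (b n / (real n + x)^2)) \<le> 2 / z * (b n / (real n + z/2))" if "x \<in> A" for n x
  proof -
    have x: "x > z / 2" using that by (simp add: A_def)
    have "norm (- (b n / (real n + x)^2)) = b n / ((real n + x) * (real n + x))"
      using b_nonneg by (simp add: power2_eq_square)
    also have "\<dots> \<le> b n / ((real n + z/2) * (z/2))"
      using x z b_nonneg by (intro divide_left_mono mult_mono) auto
    also have "\<dots> = 2 / z * (b n / (real n + z/2))" using z by (simp add: field_simps)
    finally show ?thesis .
  qed
  have sum_bound: "summable (\<lambda>n. 2 / z * (b n / (real n + z/2)))"
    using h[of "z/2"] z by (intro summable_mult) (auto simp: sums_iff)
  have unif: "uniformly_convergent_on A (\<lambda>k x. \<Sum>n<k. - (b n / (real n + x)^2))"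
    by (rule Weierstrass_m_test'[OF bound sum_bound])
  have d: "((\<lambda>x. \<Sum>n. b n / (real n + x)) has_field_derivative (\<Sum>n. - (b n / (real n + z)^2))) (at z)"
  proof (rule has_field_derivative_series'(2)[of A])
    show "convex A" by (simp add: A_def)
    show "((\<lambda>x. b n / (real n + x)) has_field_derivative - (b n / (real n + x)^2)) (at x within A)"
      if "x \<in> A" for n x
    proof -
      have "x > z / 2" using that by (simp add: A_def)
      then show ?thesis using z
        by (auto intro!: derivative_eq_intros simp: power2_eq_square)
    qed
    show "z \<in> A" "z \<in> interior A" using z by (auto simp: A_def interior_open[OF open_greaterThan])
    show "summable (\<lambda>n. b n / (real n + z))" using h[OF z] by (simp add: sums_iff)
  qed (use unif in auto)
  have beta: "((\<lambda>x. Beta x (1 - c)) has_field_derivative Beta z (1 - c) * (Digamma z - Digamma (z + (1 - c)))) (at z)"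
    using z c by (intro has_field_derivative_Beta1) (auto intro!: not_nonpos_Ints_realI)
  have ev: "eventually (\<lambda>x. Beta x (1 - c) = (\<Sum>n. b n / (real n + x))) (nhds z)"
    using eventually_nhds_in_open[of "{0<..}" z] z by (auto elim!: eventually_mono simp: h sums_unique)
  have "((\<lambda>x. \<Sum>n. b n / (real n + x)) has_field_derivative Beta z (1 - c) * (Digamma z - Digamma (z + (1 - c)))) (at z)"
    by (rule iffD1[OF DERIV_cong_ev[OF refl ev refl] beta])
  from DERIV_unique[OF d this]
  have e: "(\<Sum>n. - (b n / (real n + z)^2)) = Beta z (1 - c) * (Digamma z - Digamma (z + (1 - c)))" .
  have "z \<in> A" using z by (simp add: A_def)
  have "summable (\<lambda>n. - (b n / (real n + z)^2))"
    by (rule summable_comparison_test'[OF sum_bound, of 0]) (use bound[OF \<open>z \<in> A\<close>] in auto)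
  then have "(\<lambda>n. - (b n / (real n + z)^2)) sums (Beta z (1 - c) * (Digamma z - Digamma (z + (1 - c))))"
    using e by (simp add: sums_iff)
  from sums_minus[OF this] show ?thesis by (simp add: b_def algebra_simps)
qed

definition hurwitz3 :: "real \<Rightarrow> real" where
  "hurwitz3 x = (\<Sum>m. 1 / (real m + 1 + x)^3)"

lemma V_at_0: "x > -1 \<Longrightarrow> V x 0 = hurwitz3 x"
proof -
  assume x: "x > -1"
  have "V_series x 0 m = 1 / (real m + 1 + x)^3" for m
  proof -
    define y where "y = real m + 1 + x"
    have "y > 0" using x by (simp add: y_def)
    have "V_series x 0 m = Gamma y / (Gamma (y + 1) * y^2)" by (simp add: V_series_def y_def add_ac)
    also have "\<dots> = 1 / y^3" using \<open>y > 0\<close>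
      by (simp add: Gamma_Suc_real Gamma_real_nonzero power2_eq_square power3_eq_cube)
    finally show ?thesis by (simp add: y_def)
  qed
  then show ?thesis by (simp add: V_def hurwitz3_def)
qed

text \<open>For a = s and t = -s the summand is Gamma(n + 1 + 2s) / ((n + 1)! (n + 1 + s)^2), that
  is Gamma(2s) times a term of the differentiated binomial series with c = 2s and z = s. The
  reflection formula cancels Gamma(2s) against the sine on the left.\<close>

lemma V_antidiagonal:
  assumes s: "0 < s" "s < 1/4"
  shows "sin (2 * pi * s) / pi * Gamma (1 - 2 * s) * V s (-s)
     = (Gamma (1 + s) * Gamma (1 - 2 * s) / Gamma (1 - s) * (1 + s * (Digamma (1 - s) - Digamma (1 + s))) - 1) / s^2"
proof -
  define c where "c = 2 * s"
  have c: "0 < c" "c < 1" using s by (auto simp: c_def)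
  define B where "B = Beta s (1 - c) * (Digamma (s + (1 - c)) - Digamma s)"
  have "(\<lambda>n. pochhammer c n / fact n / (real n + s)^2) sums B"
    unfolding B_def using s c by (intro binomial_Beta_deriv_sums)
  \<comment> \<open>\<open>V\<close> starts at index 1 of the binomial series, so its term 1 / s^2
    at index 0 is split off.\<close>
  then have "(\<lambda>n. pochhammer c (Suc n) / fact (Suc n) / (real (Suc n) + s)^2) sums (B - 1 / s^2)"
    using sums_split_initial_segment[of _ B 1] by fastforce
  then have "(\<lambda>n. Gamma c * (pochhammer c (Suc n) / fact (Suc n) / (real (Suc n) + s)^2)) sums (Gamma c * (B - 1 / s^2))"
    by (rule sums_mult)
  moreover have "Gamma c * (pochhammer c (Suc n) / fact (Suc n) / (real (Suc n) + s)^2) = V_series s (-s) n" for n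
  proof -
    have "Gamma c * pochhammer c (Suc n) = Gamma (c + real (Suc n))"
      using c pochhammer_Gamma[of c "Suc n"] by (simp add: not_nonpos_Ints_realI Gamma_real_nonzero)
    moreover have "c + real (Suc n) = real n + 1 + s + s" by (simp add: c_def)
    moreover have "Gamma (real n + 2) = fact (Suc n)"
      using Gamma_fact[of "Suc n", where 'a = real] by (simp add: add_ac)
    ultimately show ?thesis by (simp add: V_series_def add_ac del: fact_Suc pochhammer_Suc)
  qed
  ultimately have V: "V s (-s) = Gamma c * (B - 1 / s^2)" by (simp add: V_def sums_iff)
  have "sin (pi * c) / pi * Gamma (1 - c) * Gamma c = (rGamma c * Gamma c) * (rGamma (1 - c) * Gamma (1 - c))"
    unfolding rGamma_reflection_real[symmetric] by (simp only: mult_ac)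
  then have refl: "sin (pi * c) / pi * Gamma (1 - c) * Gamma c = 1"
    using c by (simp add: rGamma_inverse_Gamma Gamma_real_nonzero)
  have "sin (2 * pi * s) / pi * Gamma (1 - 2 * s) * V s (-s) = (sin (pi * c) / pi * Gamma (1 - c) * Gamma c) * (B - 1 / s^2)"
    unfolding V by (simp add: c_def mult_ac)
  also have "\<dots> = B - 1 / s^2" by (simp only: refl mult_1_left)
  also have "B = Gamma (1 + s) * Gamma (1 - 2 * s) / Gamma (1 - s) * (1 + s * (Digamma (1 - s) - Digamma (1 + s))) / s^2"
  proof -
    have "Gamma (1 + s) = s * Gamma s" using Gamma_Suc_real[of s] s by (simp add: add_ac)
    then have Gs: "Gamma s = Gamma (1 + s) / s" using s by simp
    have "Digamma (1 + s) = Digamma s + 1 / s" using Digamma_plus1[of s] s by (simp add: add_ac)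
    then have Ds: "Digamma s = Digamma (1 + s) - 1 / s" by simp
    have "s + (1 - c) = 1 - s" by (simp add: c_def)
    then show ?thesis unfolding B_def Beta_def Gs Ds c_def using s
      by (simp add: field_simps power2_eq_square)
  qed
  finally show ?thesis by (simp add: diff_divide_distrib)
qed

text \<open>Two evaluations of the same alternating series with a = s = -t, at shift t and at shift
  0, are subtracted. \<open>V\<close> is elementary in the first and a Hurwitz zeta value in the
  second. As \<open>S6\<close> is even in a, the result on a = -t is one on a = t.\<close>

lemma S6_difference_diagonal:
  assumes t: "-1/4 < t" "t < 0"
  shows "t^3 * (S6 t t - S6 t 0) =
     2 * (Gamma (1 + t) * Gamma (1 - t) * (1 + t * (Digamma (1 - t) - Digamma (1 + t))))
     - Gamma (1 + t)^2 / Gamma (1 + 2 * t) - sin (pi * t) / (pi * t) + 2 * t^2 * (sin (pi * t) / pi) * hurwitz3 (-t)"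
proof -
  define s where "s = - t"
  have s: "0 < s" "s < 1/4" using t by (auto simp: s_def)
  have nI: "y \<notin> \<int>" if "0 < y" "y < 1" for y :: real
    using that by (auto elim!: Ints_cases)
  define h where "h = 1 + s * (Digamma (1 - s) - Digamma (1 + s))"
  define E where "E = Gamma (1 - s)^2 / Gamma (1 - 2 * s)"
  have sym: "S6 s u = S6 (-s) u" for u
    by (simp add: S6_def c6_def mult_ac)
  have pos: "Gamma (1 - s) > 0" "Gamma (1 + s) > 0" "Gamma (1 - 2 * s) > 0"
    using s by (auto intro!: Gamma_real_pos)
  have 1: "(\<lambda>m. 2 * (-1)^m / (real m + 1 + s)^2) sums
     ((1 - c6 s (-s) 0) / s^2 - s * S6 s (-s) - 2 * Gamma (1 + (-s))^2 * (sin (pi * (s - (-s))) / pi) * V s (-s))"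
    using s nI[of "s + s"] by (intro S6_eq_V) auto
  have 2: "(\<lambda>m. 2 * (-1)^m / (real m + 1 + s)^2) sums
     ((1 - c6 s 0 0) / s^2 - s * S6 s 0 - 2 * Gamma (1 + 0)^2 * (sin (pi * (s - 0)) / pi) * V s 0)"
    using s nI[of s] by (intro S6_eq_V) auto
  have c1: "c6 s (-s) 0 = E" by (simp add: c6_def E_def rGamma_inverse_Gamma divide_inverse)
  have c2: "c6 s 0 0 = sin (pi * s) / (pi * s)"
  proof -
    have "rGamma (1 + s) * s = rGamma s" using rGamma_plus1[of s] by (simp add: add_ac mult_ac)
    then have "rGamma (1 - s) * rGamma (1 + s) * s = rGamma s * rGamma (1 - s)"
      by (metis mult.assoc mult.commute)
    then have "rGamma (1 - s) * rGamma (1 + s) * s = sin (pi * s) / pi" by (simp only: rGamma_reflection_real)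
    then show ?thesis using s by (simp add: c6_def field_simps)
  qed
  have V1: "2 * Gamma (1 + (-s))^2 * (sin (pi * (s - (-s))) / pi) * V s (-s)
      = 2 * (Gamma (1 + s) * Gamma (1 - s) * h - E) / s^2"
  proof -
    have "2 * Gamma (1 + (-s))^2 * (sin (pi * (s - (-s))) / pi) * V s (-s)
       = 2 * E * (sin (2 * pi * s) / pi * Gamma (1 - 2 * s) * V s (-s))"
      using pos by (simp add: E_def mult_ac)
    also have "\<dots> = 2 * E * ((Gamma (1 + s) * Gamma (1 - 2 * s) / Gamma (1 - s) * h - 1) / s^2)"
      unfolding V_antidiagonal[OF s] h_def ..
    also have "\<dots> = 2 * ((E * (Gamma (1 + s) * Gamma (1 - 2 * s) / Gamma (1 - s))) * h - E) / s^2"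
    proof -
      have "2 * E * ((X * h - 1) / s^2) = 2 * ((E * X) * h - E) / s^2" for X by (simp add: algebra_simps)
      then show ?thesis .
    qed
    also have "E * (Gamma (1 + s) * Gamma (1 - 2 * s) / Gamma (1 - s)) = Gamma (1 + s) * Gamma (1 - s)"
      using s by (simp add: E_def power2_eq_square Gamma_real_nonzero)
    finally show ?thesis .
  qed
  have "(1 - E) / s^2 - s * S6 s (-s) - 2 * (Gamma (1 + s) * Gamma (1 - s) * h - E) / s^2
     = (1 - sin (pi * s) / (pi * s)) / s^2 - s * S6 s 0 - 2 * (sin (pi * s) / pi) * hurwitz3 s"
    using sums_unique2[OF 1 2] unfolding c1 c2 V1 using s by (simp add: V_at_0)
  then have eq: "s^2 * ((1 - E) / s^2 - s * S6 s (-s) - 2 * (Gamma (1 + s) * Gamma (1 - s) * h - E) / s^2)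
     = s^2 * ((1 - sin (pi * s) / (pi * s)) / s^2 - s * S6 s 0 - 2 * (sin (pi * s) / pi) * hurwitz3 s)"
    by (rule arg_cong)
  have "(1 - E) - s^3 * S6 s (-s) - 2 * (Gamma (1 + s) * Gamma (1 - s) * h - E)
     = (1 - sin (pi * s) / (pi * s)) - s^3 * S6 s 0 - 2 * s^2 * (sin (pi * s) / pi) * hurwitz3 s"
  proof -
    have "s^2 * (A / s^2 - s * Y - Z / s^2) = A - s^3 * Y - Z" "s^2 * (A / s^2 - s * Y - 2 * Z * W) = A - s^3 * Y - 2 * s^2 * Z * W"
      for A Y Z W :: real using s by (simp_all add: right_diff_distrib power3_eq_cube power2_eq_square)
    note e = this
    show ?thesis using eq unfolding e .
  qed
  then have "- (s^3) * (S6 s (-s) - S6 s 0) = 2 * (Gamma (1 + s) * Gamma (1 - s) * h)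
      - E - sin (pi * s) / (pi * s) - 2 * s^2 * (sin (pi * s) / pi) * hurwitz3 s"
    by (simp add: algebra_simps)
  then show ?thesis
    unfolding sym unfolding h_def E_def s_def by (simp add: mult_ac algebra_simps)
qed

text \<open>The same subtraction with a = 2t. Here \<open>V (2 * t) t\<close> is not elementary: it
  is the function whose expansion is wanted, and this equation ties it to \<open>S6\<close>.\<close>

lemma S6_difference_double:
  assumes t: "-1/4 < t" "t < 0"
  shows "8 * t^3 * (S6 (2*t) t - S6 (2*t) 0) =
     - (Gamma (1 + t)^2 / (Gamma (1 - t) * Gamma (1 + 3 * t))) + sin (2 * pi * t) / (2 * pi * t)
     - 8 * t^2 * Gamma (1 + t)^2 * (sin (pi * t) / pi) * V (2 * t) t
     + 8 * t^2 * (sin (2 * pi * t) / pi) * hurwitz3 (2 * t)"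
proof -
  have nI: "y \<notin> \<int>" if "0 < -y" "-y < 1" for y :: real
    using that by (auto elim!: Ints_cases)
  define E where "E = Gamma (1 + t)^2 / (Gamma (1 - t) * Gamma (1 + 3 * t))"
  have 1: "(\<lambda>m. 2 * (-1)^m / (real m + 1 + 2 * t)^2) sums
     ((1 - c6 (2*t) t 0) / (2*t)^2 - (2*t) * S6 (2*t) t - 2 * Gamma (1 + t)^2 * (sin (pi * (2*t - t)) / pi) * V (2*t) t)"
    using t nI[of "2 * t - t"] by (intro S6_eq_V) auto
  have 2: "(\<lambda>m. 2 * (-1)^m / (real m + 1 + 2 * t)^2) sums
     ((1 - c6 (2*t) 0 0) / (2*t)^2 - (2*t) * S6 (2*t) 0 - 2 * Gamma (1 + 0)^2 * (sin (pi * (2*t - 0)) / pi) * V (2*t) 0)"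
    using t nI[of "2 * t"] by (intro S6_eq_V) auto
  have c1: "c6 (2*t) t 0 = E"
    by (simp add: c6_def E_def rGamma_inverse_Gamma divide_inverse algebra_simps)
  have c2: "c6 (2*t) 0 0 = sin (2 * pi * t) / (2 * pi * t)"
  proof -
    have "rGamma (1 + 2*t) * (2*t) = rGamma (2*t)" using rGamma_plus1[of "2*t"] by (simp add: add_ac mult_ac)
    then have "rGamma (1 - 2*t) * rGamma (1 + 2*t) * (2*t) = rGamma (2*t) * rGamma (1 - 2*t)"
      by (metis mult.assoc mult.commute)
    then have "rGamma (1 - 2*t) * rGamma (1 + 2*t) * (2*t) = sin (pi * (2*t)) / pi" by (simp only: rGamma_reflection_real)
    then show ?thesis using t by (simp add: c6_def field_simps)
  qed
  have eq: "(2*t)^2 * ((1 - E) / (2*t)^2 - (2*t) * S6 (2*t) t - 2 * Gamma (1 + t)^2 * (sin (pi * t) / pi) * V (2*t) t)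
     = (2*t)^2 * ((1 - sin (2 * pi * t) / (2 * pi * t)) / (2*t)^2 - (2*t) * S6 (2*t) 0 - 2 * (sin (2 * pi * t) / pi) * hurwitz3 (2*t))"
    using sums_unique2[OF 1 2] unfolding c1 c2 using t by (simp add: V_at_0 mult_ac)
  have e: "(2*t)^2 * (X / (2*t)^2 - (2*t) * Y - Z) = X - 8 * t^3 * Y - 4 * t^2 * Z" for X Y Z
    using t by (simp add: right_diff_distrib power3_eq_cube power2_eq_square)
  show ?thesis using eq unfolding e E_def by (simp add: algebra_simps)
qed

section \<open>Elimination of the higher symmetric functions\<close>

text \<open>The elementary symmetric polynomial of degree r in u_0, ..., u_(n-1), sorted by its
  largest index; this form makes bounds uniform in n provable by induction on r.\<close>

primrec esym :: "nat \<Rightarrow> (nat \<Rightarrow> real) \<Rightarrow> nat \<Rightarrow> real" where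
  "esym 0 u n = 1"
| "esym (Suc r) u n = (\<Sum>j<n. u j * esym r u j)"

lemma esym_nonneg: "(\<And>j. u j \<ge> 0) \<Longrightarrow> esym r u n \<ge> 0"
  by (induction r arbitrary: n) (auto intro!: sum_nonneg)

lemma esym_le:
  assumes "\<And>j. 0 \<le> u j" "\<And>j. u j \<le> v j" "\<And>n. (\<Sum>j<n. v j) \<le> s"
  shows "esym r u n \<le> s ^ r"
proof (induction r arbitrary: n)
  case (Suc r)
  have s: "s \<ge> 0" using assms(3)[of 0] by simp
  have "(\<Sum>j<n. u j * esym r u j) \<le> (\<Sum>j<n. v j * s ^ r)"
    using assms Suc s by (intro sum_mono mult_mono esym_nonneg) (auto intro: order.trans)
  also have "\<dots> = (\<Sum>j<n. v j) * s ^ r" by (simp add: sum_distrib_right)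
  also have "\<dots> \<le> s * s ^ r" using assms s by (intro mult_right_mono) auto
  finally show ?case by simp
qed simp

text \<open>Exchanging u for u' one factor at a time costs a relative error e in each of the r
  factors; the majorant v bounds the others.\<close>

lemma esym_diff_le:
  assumes u: "\<And>j. 0 \<le> u j" "\<And>j. u j \<le> v j" and u': "\<And>j. 0 \<le> u' j" "\<And>j. u' j \<le> v j"
    and d: "\<And>j. \<bar>u j - u' j\<bar> \<le> e * v j" and s: "\<And>n. (\<Sum>j<n. v j) \<le> s" and e: "e \<ge> 0"
  shows "\<bar>esym r u n - esym r u' n\<bar> \<le> real r * e * s ^ r"
proof (induction r arbitrary: n)
  case (Suc r)
  have s0: "s \<ge> 0" using s[of 0] by simp
  have v0: "v j \<ge> 0" for j using u order.trans by blast
  have "\<bar>esym (Suc r) u n - esym (Suc r) u' n\<bar>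
      = \<bar>\<Sum>j<n. (u j - u' j) * esym r u j + u' j * (esym r u j - esym r u' j)\<bar>"
    by (simp add: sum_subtractf[symmetric] algebra_simps)
  also have "\<dots> \<le> (\<Sum>j<n. \<bar>(u j - u' j) * esym r u j + u' j * (esym r u j - esym r u' j)\<bar>)"
    by (rule sum_abs)
  also have "\<dots> \<le> (\<Sum>j<n. v j * (real (Suc r) * e * s ^ r))"
  proof (rule sum_mono)
    fix j
    have "\<bar>(u j - u' j) * esym r u j\<bar> \<le> (e * v j) * s ^ r"
      unfolding abs_mult using d[of j] esym_le[OF u s, of r j] esym_nonneg[of u r j] u(1) e v0
      by (intro mult_mono) auto
    moreover have "\<bar>u' j * (esym r u j - esym r u' j)\<bar> \<le> v j * (real r * e * s ^ r)"
      unfolding abs_mult using u'[of j] Suc[of j] v0 by (intro mult_mono) auto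
    ultimately show "\<bar>(u j - u' j) * esym r u j + u' j * (esym r u j - esym r u' j)\<bar> \<le> v j * (real (Suc r) * e * s ^ r)"
      by (intro order.trans[OF abs_triangle_ineq]) (simp add: algebra_simps)
  qed
  also have "\<dots> = (\<Sum>j<n. v j) * (real (Suc r) * e * s ^ r)" by (simp add: sum_distrib_right)
  also have "\<dots> \<le> s * (real (Suc r) * e * s ^ r)" using s s0 e by (intro mult_right_mono) auto
  finally show ?case by (simp add: algebra_simps)
qed simp

text \<open>A further factor maps the remainder R to R (1 - y u_n) + y^4 u_n e_3. The multiplier
  lies in [0,1], so the remainder never grows by more than the added term, and e_3 \<le> s^3 sums to
  y^4 s^4 without dependence on n.\<close>

lemma prod_one_minus_expansion:
  assumes u: "\<And>j. 0 \<le> u j" "\<And>j. y * u j \<le> 1" and y: "y \<ge> 0" and s: "\<And>n. (\<Sum>j<n. u j) \<le> s"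
  shows "\<bar>(\<Prod>j<n. 1 - y * u j) - (1 - y * esym 1 u n + y^2 * esym 2 u n - y^3 * esym 3 u n)\<bar> \<le> y^4 * s^4"
proof -
  define R where "R = (\<lambda>n. (\<Prod>j<n. 1 - y * u j) - (1 - y * esym 1 u n + y^2 * esym 2 u n - y^3 * esym 3 u n))"
  have s0: "s \<ge> 0" using s[of 0] by simp
  have E: "esym (Suc r) u (Suc n) = esym (Suc r) u n + u n * esym r u n" for r n by simp
  have step: "R (Suc n) = R n * (1 - y * u n) + y^4 * (u n * esym 3 u n)" for n
    unfolding R_def using E[of 0 n] E[of 1 n] E[of 2 n]
    by (simp add: numeral_2_eq_2 numeral_3_eq_3 del: esym.simps(2)) (simp add: algebra_simps power_numeral_reduce)
  have "\<bar>R n\<bar> \<le> y^4 * (s^3 * (\<Sum>j<n. u j))"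
  proof (induction n)
    case 0 show ?case by (simp add: R_def numeral_2_eq_2 numeral_3_eq_3)
  next
    case (Suc n)
    have "\<bar>R n * (1 - y * u n)\<bar> \<le> \<bar>R n\<bar> * 1"
      unfolding abs_mult using u[of n] y by (intro mult_left_mono) auto
    moreover have "\<bar>y^4 * (u n * esym 3 u n)\<bar> \<le> y^4 * (u n * s^3)"
      using esym_le[OF u(1) order_refl s, of 3 n] esym_nonneg[of u 3 n] u(1) y
      by (simp add: abs_mult mult_left_mono)
    ultimately show ?case using Suc unfolding step
      by (intro order.trans[OF abs_triangle_ineq]) (simp add: algebra_simps)
  qed
  also have "\<dots> \<le> y^4 * (s^3 * s)" using y s s0 by (intro mult_left_mono) auto
  finally show ?thesis by (simp add: R_def power_numeral_reduce)
qed

text \<open>The weights \<open>-16\<close>, \<open>15\<close>, \<open>-12\<close> are chosen to kill the symmetric functions of degree 0, 1 and 2.\<close>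

lemma prod_combination_expansion:
  assumes u: "\<And>j. 0 \<le> u j" "\<And>j. 4 * y * u j \<le> 1" and y: "y \<ge> 0" and s: "\<And>n. (\<Sum>j<n. u j) \<le> s"
  shows "\<bar>(\<Prod>j<n. 1 - 4 * y * u j) - 16 * (\<Prod>j<n. 1 - y * u j) + 15 - 12 * y * (\<Sum>j<n. u j)
     + 48 * y^3 * esym 3 u n\<bar> \<le> 272 * y^4 * s^4"
proof -
  define P4 where "P4 = (\<Prod>j<n. 1 - 4 * y * u j)"
  define P1 where "P1 = (\<Prod>j<n. 1 - y * u j)"
  have "y * u j \<le> 1" for j using u[of j] y mult_nonneg_nonneg[OF y u(1)[of j]] by auto
  then have "\<bar>P1 - (1 - y * esym 1 u n + y^2 * esym 2 u n - y^3 * esym 3 u n)\<bar> \<le> y^4 * s^4"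
    unfolding P1_def using u y s by (intro prod_one_minus_expansion) auto
  \<comment> \<open>The cubic coefficient left over is 4^3 - 16 = 48, and the two errors add up to
    4^4 + 16 = 272.\<close>
  moreover have "\<bar>P4 - (1 - (4*y) * esym 1 u n + (4*y)^2 * esym 2 u n - (4*y)^3 * esym 3 u n)\<bar> \<le> (4*y)^4 * s^4"
    unfolding P4_def using u y s by (intro prod_one_minus_expansion) auto
  moreover have "esym 1 u n = (\<Sum>j<n. u j)" by simp
  ultimately show ?thesis unfolding P4_def[symmetric] P1_def[symmetric] power_mult_distrib
    by (simp add: abs_le_iff algebra_simps)
qed

text \<open>A double Hurwitz zeta function with exponents 2 and 3, the larger index carrying the 2.
  It is minus the coefficient of a^2 in \<open>S6 a t\<close>, since each factor of the product
  contributes -a^2 / (j + 1 + t)^2 to first order.\<close>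

definition D6 :: "real \<Rightarrow> real" where
  "D6 t = (\<Sum>i. (\<Sum>j. 1 / (real (Suc i + j) + 1 + t)^2) / (real i + 1 + t)^3)"

lemma inverse_square_sum_le: "(\<Sum>j<n. 1 / (real (i + j) + 1)^2) \<le> 2"
proof -
  have "(\<Sum>j<n. 1 / (real (i + j) + 1)^2) \<le> (\<Sum>j<n. 1 / (real (Suc j))^2)"
    by (intro sum_mono divide_left_mono power_mono) auto
  also have "\<dots> \<le> (\<Sum>j. 1 / (real (Suc j))^2)"
    using inverse_squares_sums by (intro sum_le_suminf) (auto simp: sums_iff add_ac)
  also have "\<dots> = pi^2 / 6" using inverse_squares_sums by (simp add: sums_iff add_ac)
  also have "\<dots> \<le> 2"
    using power_mono[of pi "3.2" 2] pi_approx by (simp add: power2_eq_square)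
  finally show ?thesis .
qed

lemma c6_uminus: "c6 (-a) t i = c6 a t i"
  by (simp add: c6_def mult_ac)

lemma c6_eq_prod:
  assumes "1 + t > 0"
  shows "c6 a t i = c6 a t (i + n) * (\<Prod>j<n. 1 - a^2 * (1 / (real (i + j) + 1 + t)^2))"
proof (induction n)
  case (Suc n)
  define w where "w = real (i + n) + 1 + t"
  have w: "w > 0" using assms by (simp add: w_def)
  have "c6 a t (i + n) * w^2 = c6 a t (Suc (i + n)) * (w^2 - a^2)"
    using c6_Suc[OF assms, of a "i + n"] by (simp add: w_def add_ac)
  then have "c6 a t (i + n) = c6 a t (i + Suc n) * (1 - a^2 * (1 / w^2))" using w by (simp add: field_simps)
  then show ?case using Suc by (simp add: w_def mult_ac)
qed simp

text \<open>The finite product is the quotient of \<open>c6\<close> at i and at i + n, and the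
  latter tends to 1.\<close>

lemma c6_prod_LIMSEQ:
  assumes "1 + t > 0" "1 + t + a > 0" "a - t \<notin> \<int>"
  shows "(\<lambda>n. \<Prod>j<n. 1 - a^2 * (1 / (real (i + j) + 1 + t)^2)) \<longlonglongrightarrow> c6 a t i"
proof -
  have lim: "(\<lambda>n. c6 a t (i + n)) \<longlonglongrightarrow> 1"
    using LIMSEQ_ignore_initial_segment[OF c6_tendsto_1[OF assms], of i] by (simp add: add_ac)
  then have "(\<lambda>n. c6 a t i / c6 a t (i + n)) \<longlonglongrightarrow> c6 a t i / 1"
    by (intro tendsto_divide tendsto_const) auto
  moreover have "eventually (\<lambda>n. c6 a t (i + n) \<noteq> 0) sequentially"
    using lim by (rule tendsto_imp_eventually_ne) simp
  then have "eventually (\<lambda>n. c6 a t i / c6 a t (i + n) = (\<Prod>j<n. 1 - a^2 * (1 / (real (i + j) + 1 + t)^2))) sequentially"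
  proof eventually_elim
    case (elim n)
    show ?case using c6_eq_prod[OF assms(1), of a i n] elim by (metis nonzero_mult_div_cancel_left)
  qed
  ultimately show ?thesis by (simp add: tendsto_cong)
qed

definition I6 :: "real \<Rightarrow> nat \<Rightarrow> real" where
  "I6 t i = (\<Sum>j. 1 / (real (Suc i + j) + 1 + t)^2)"

lemma summable_I6: "t > -1 \<Longrightarrow> summable (\<lambda>j. 1 / (real (Suc i + j) + 1 + t)^2)"
  using summable_inverse_square_shift[of "real i + 2 + t"] by (simp add: add_ac)

text \<open>Contribution of a single i to the combination of \<open>S6\<close> at 2t and t, with
  products and \<open>I6\<close> in place of the sums; its leading term is -48 t^6 times the third
  symmetric function.\<close>

definition delta6 :: "real \<Rightarrow> real \<Rightarrow> nat \<Rightarrow> real" where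
  "delta6 t s i = c6 (2 * t) s (Suc i) - 16 * c6 t s (Suc i) + 15 - 12 * t^2 * I6 s i"

text \<open>For finite products the value is -48 t^6 e_3 + O(t^8). This gives order 6 at once; in
  the difference of the shifts t and 0, e_3 itself changes only by O(t), which gains one more order.
  Both bounds are uniform in i and survive the limit.\<close>

lemma delta6_bounds:
  assumes t: "-1/4 < t" "t < 0"
  shows "\<bar>delta6 t t i - delta6 t 0 i\<bar> \<le> 50000 * \<bar>t\<bar>^7" (is ?A)
    and "\<bar>delta6 t 0 i\<bar> \<le> 8000 * \<bar>t\<bar>^6" (is ?B)
proof -
  have nI: "y \<notin> \<int>" if "0 < -y" "-y < 1" for y :: real
    using that by (auto elim!: Ints_cases)
  have nI': "y \<notin> \<int>" if "0 < y" "y < 1" for y :: real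
    using that by (auto elim!: Ints_cases)
  define x where "x = (\<lambda>j. real (Suc i + j) + 1)"
  define u where "u = (\<lambda>s j. 1 / (x j + s)^2)"
  \<comment> \<open>A majorant common to all shifts s in (-1/4, 0]: x \<ge> 2 gives x + s \<ge> 7/8
    x, and (7/8)^2 > 1/2.\<close>
  define v where "v = (\<lambda>j. 2 / x j^2)"
  define y where "y = t^2"
  have x: "x j \<ge> 2" for j by (simp add: x_def)
  have v0: "v j > 0" for j using x[of j] by (simp add: v_def)
  have u_nonneg: "u s j \<ge> 0" for s j by (simp add: u_def)
  have y: "y \<ge> 0" "y \<le> 1/16"
    using t power_mono[of "-t" "1/4" 2] by (auto simp: y_def power2_eq_square)
  have u_le: "u s j \<le> v j" if s: "-1/4 < s" "s \<le> 0" for s j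
  proof -
    have "x j + s \<ge> 7/8 * x j" using s x[of j] by simp
    then have "(x j + s)^2 \<ge> (7/8 * x j)^2" using x[of j] by (intro power_mono) auto
    also have "(7/8 * x j)^2 \<ge> x j^2 / 2" by (simp add: power_mult_distrib power2_eq_square)
    finally have "1 / (x j + s)^2 \<le> 1 / (x j^2 / 2)" using x[of j] s by (intro divide_left_mono mult_pos_pos) auto
    then show ?thesis by (simp add: u_def v_def)
  qed
  have v_sum: "(\<Sum>j<n. v j) \<le> 4" for n
  proof -
    have "(\<Sum>j<n. v j) = 2 * (\<Sum>j<n. 1 / (real (Suc i + j) + 1)^2)"
      by (simp add: v_def x_def sum_distrib_left)
    then show ?thesis using inverse_square_sum_le[of "Suc i" n] by simp
  qed
  have u_diff: "\<bar>u t j - u 0 j\<bar> \<le> \<bar>t\<bar> * v j" for j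
  proof -
    define X where "X = x j"
    have X: "X \<ge> 2" using x by (simp add: X_def)
    have pos: "X + t > 0" using X t by simp
    have "u t j - u 0 j = (-t) * (2 * X + t) / (X^2 * (X + t)^2)"
    proof -
      have "1 / Y^2 - 1 / X^2 = (X - Y) * (X + Y) / (X^2 * Y^2)" if "Y > 0" for Y
        using X that by (simp add: divide_simps) (simp add: power2_eq_square algebra_simps)
      from this[OF pos] show ?thesis unfolding u_def X_def[symmetric] by (simp add: algebra_simps)
    qed
    also have "\<dots> = (-t) * (1 / X^2) * ((2 * X + t) / (X + t)^2)" by simp
    finally have "\<bar>u t j - u 0 j\<bar> = (-t) * (1 / X^2) * ((2 * X + t) / (X + t)^2)"
      using X t by (simp add: abs_mult)
    also have "\<dots> \<le> (-t) * (1 / X^2) * 2"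
    proof (intro mult_left_mono)
      have "2 * X + t \<le> 2 * ((X + t) * (7/4))" using X t by simp
      also have "\<dots> \<le> 2 * ((X + t) * (X + t))" using X t by (intro mult_left_mono) auto
      finally show "(2 * X + t) / (X + t)^2 \<le> 2" using pos by (subst pos_divide_le_eq) (simp_all add: power2_eq_square)
    qed (use X t in \<open>auto intro: mult_nonneg_nonneg divide_nonpos_nonneg\<close>)
    finally show ?thesis using t by (simp add: v_def X_def)
  qed
  have us: "(\<Sum>j<n. u s j) \<le> 4" if s: "-1/4 < s" "s \<le> 0" for s n
    using sum_mono[of "{..<n}" "u s" v] u_le[OF s] v_sum[of n] by force
  define Q where "Q = (\<lambda>s n. (\<Prod>j<n. 1 - 4 * y * u s j) - 16 * (\<Prod>j<n. 1 - y * u s j) + 15 - 12 * y * (\<Sum>j<n. u s j))"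
  have Q: "\<bar>Q s n + 48 * y^3 * esym 3 (u s) n\<bar> \<le> 272 * y^4 * 4^4" if s: "-1/4 < s" "s \<le> 0" for s n
    unfolding Q_def
  proof (rule prod_combination_expansion)
    show "4 * y * u s j \<le> 1" for j
    proof -
      have "v j \<le> 1" using x[of j] power_mono[of 2 "x j" 2] by (simp add: v_def)
      then have "4 * y * u s j \<le> 4 * (1/16) * 1"
        using y u_le[OF s, of j] u_nonneg by (intro mult_mono) auto
      then show ?thesis by simp
    qed
  qed (use u_nonneg y us[OF s] in auto)
  have Qlim: "Q s \<longlonglongrightarrow> delta6 t s i" if s: "s = t \<or> s = 0" for s
  proof -
    have w: "x j + s = real (Suc i + j) + 1 + s" for j by (simp add: x_def)
    have "(\<lambda>n. \<Prod>j<n. 1 - (2*t)^2 * (1 / (real (Suc i + j) + 1 + s)^2)) \<longlonglongrightarrow> c6 (2*t) s (Suc i)"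
      using s t nI[of "2*t - s"] by (intro c6_prod_LIMSEQ) auto
    \<comment> \<open>For a = s = t the difference a - s would be the integer 0, which the product
      lemma excludes; evenness in a permits -t instead.\<close>
    moreover have "(\<lambda>n. \<Prod>j<n. 1 - (-t)^2 * (1 / (real (Suc i + j) + 1 + s)^2)) \<longlonglongrightarrow> c6 (-t) s (Suc i)"
      using s t nI'[of "-t - s"] by (intro c6_prod_LIMSEQ) auto
    moreover have "(\<lambda>n. \<Sum>j<n. 1 / (real (Suc i + j) + 1 + s)^2) \<longlonglongrightarrow> I6 s i"
      using summable_I6[of s i] s t unfolding I6_def by (intro summable_LIMSEQ) auto
    ultimately show ?thesis
      unfolding Q_def delta6_def u_def w y_def c6_uminus power2_minus
      by (auto intro!: tendsto_add tendsto_diff tendsto_mult tendsto_const simp: power_mult_distrib mult.assoc)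
  qed
  have y3: "y^3 = \<bar>t\<bar>^6" "y^4 = \<bar>t\<bar>^8" unfolding y_def by (simp_all flip: power_mult)
  have t8: "\<bar>t\<bar>^8 \<le> \<bar>t\<bar>^7 / 4" "\<bar>t\<bar>^8 \<le> \<bar>t\<bar>^6 / 16"
  proof -
    have a: "\<bar>t\<bar>^8 = \<bar>t\<bar>^7 * \<bar>t\<bar>" "\<bar>t\<bar>^8 = \<bar>t\<bar>^6 * y" by (simp_all add: y_def power_numeral_reduce)
    show "\<bar>t\<bar>^8 \<le> \<bar>t\<bar>^7 / 4" unfolding a(1) using t mult_left_mono[of "\<bar>t\<bar>" "1/4" "\<bar>t\<bar>^7"] by simp
    show "\<bar>t\<bar>^8 \<le> \<bar>t\<bar>^6 / 16" unfolding a(2) using y mult_left_mono[of y "1/16" "\<bar>t\<bar>^6"] by simp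
  qed
  have s0: "-1/4 < (0::real)" "(0::real) \<le> 0" by auto
  have st: "-1/4 < t" "t \<le> 0" using t by auto
  show ?A
  proof (rule LIMSEQ_le_const2)
    show "(\<lambda>n. \<bar>Q t n - Q 0 n\<bar>) \<longlonglongrightarrow> \<bar>delta6 t t i - delta6 t 0 i\<bar>"
      by (intro tendsto_rabs tendsto_diff Qlim) auto
    have "\<bar>Q t n - Q 0 n\<bar> \<le> 50000 * \<bar>t\<bar>^7" for n
    proof -
      have "\<bar>esym 3 (u t) n - esym 3 (u 0) n\<bar> \<le> real 3 * \<bar>t\<bar> * 4^3"
        using u_nonneg u_le st s0 u_diff v_sum by (intro esym_diff_le[where v = v]) auto
      then have "48 * y^3 * \<bar>esym 3 (u t) n - esym 3 (u 0) n\<bar> \<le> 48 * y^3 * (real 3 * \<bar>t\<bar> * 4^3)"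
        using y by (intro mult_left_mono) auto
      moreover have "y^3 * \<bar>t\<bar> = \<bar>t\<bar>^7" unfolding y3 by (simp add: power_numeral_reduce)
      ultimately have "\<bar>48 * y^3 * (esym 3 (u t) n - esym 3 (u 0) n)\<bar> \<le> 9216 * \<bar>t\<bar>^7"
      proof -
        assume a: "48 * y^3 * \<bar>esym 3 (u t) n - esym 3 (u 0) n\<bar> \<le> 48 * y^3 * (real 3 * \<bar>t\<bar> * 4^3)" and b: "y^3 * \<bar>t\<bar> = \<bar>t\<bar>^7"
        have "\<bar>48 * y^3 * (esym 3 (u t) n - esym 3 (u 0) n)\<bar> = 48 * y^3 * \<bar>esym 3 (u t) n - esym 3 (u 0) n\<bar>"
          unfolding abs_mult using y by simp
        also note a
        also have "48 * y^3 * (real 3 * \<bar>t\<bar> * 4^3) = 9216 * (y^3 * \<bar>t\<bar>)" by simp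
        finally show ?thesis unfolding b .
      qed
      moreover have "Q t n - Q 0 n = (Q t n + 48 * y^3 * esym 3 (u t) n) - (Q 0 n + 48 * y^3 * esym 3 (u 0) n)
           - 48 * y^3 * (esym 3 (u t) n - esym 3 (u 0) n)" by (simp add: algebra_simps)
      moreover note Q[OF st, of n] Q[OF s0, of n]
      \<comment> \<open>9216 = 48 * 3 * 4^3 comes from e_3 with r = 3 and s = 4; the remainder of
        order 8 costs at most 2 * 272 * 4^4 / 4 because |t| \<le> 1/4.\<close>
      ultimately have "\<bar>Q t n - Q 0 n\<bar> \<le> 9216 * \<bar>t\<bar>^7 + 2 * (272 * y^4 * 4^4)" by linarith
      also have "\<dots> \<le> 50000 * \<bar>t\<bar>^7"
      proof -
        have "9216 * p + 2 * (272 * q * 4^4) \<le> 50000 * p" if "q \<le> p / 4" "p \<ge> 0" for p q :: real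
          using that by simp
        from this[OF t8(1)] show ?thesis unfolding y3 by simp
      qed
      finally show ?thesis .
    qed
    then show "\<exists>N. \<forall>n\<ge>N. \<bar>Q t n - Q 0 n\<bar> \<le> 50000 * \<bar>t\<bar>^7" by blast
  qed
  show ?B
  proof (rule LIMSEQ_le_const2)
    show "(\<lambda>n. \<bar>Q 0 n\<bar>) \<longlonglongrightarrow> \<bar>delta6 t 0 i\<bar>"
      by (intro tendsto_rabs Qlim) auto
    have "\<bar>Q 0 n\<bar> \<le> 8000 * \<bar>t\<bar>^6" for n
    proof -
      have "0 \<le> esym 3 (u 0) n" using u_nonneg by (intro esym_nonneg)
      moreover have "esym 3 (u 0) n \<le> 4^3" using u_nonneg us[OF s0] by (intro esym_le[where v = "u 0"]) auto
      ultimately have "\<bar>48 * y^3 * esym 3 (u 0) n\<bar> \<le> 48 * y^3 * 4^3"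
        unfolding abs_mult using y by (intro mult_mono) auto
      then have "\<bar>Q 0 n\<bar> \<le> 48 * y^3 * 4^3 + 272 * y^4 * 4^4" using Q[OF s0, of n] by linarith
      also have "\<dots> \<le> 8000 * \<bar>t\<bar>^6"
      proof -
        have "48 * p * 4^3 + 272 * q * 4^4 \<le> 8000 * p" if "q \<le> p / 16" "p \<ge> 0" for p q :: real
          using that by simp
        from this[OF t8(2)] show ?thesis unfolding y3 by simp
      qed
      finally show ?thesis .
    qed
    then show "\<exists>N. \<forall>n\<ge>N. \<bar>Q 0 n\<bar> \<le> 8000 * \<bar>t\<bar>^6" by blast
  qed
qed

lemma summable_cube: "t > -1 \<Longrightarrow> summable (\<lambda>i. 1 / (real i + 1 + t)^3)"
  using Polygamma_converges'[of "1 + t" 3] by (simp add: field_simps add_ac)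

lemma I6_bounds:
  assumes "t > -1/4"
  shows "0 \<le> I6 t i" "I6 t i \<le> 4"
proof -
  show "0 \<le> I6 t i" unfolding I6_def using assms by (intro suminf_nonneg summable_I6) auto
  show "I6 t i \<le> 4" unfolding I6_def
  proof (rule suminf_le_const)
    show "summable (\<lambda>j. 1 / (real (Suc i + j) + 1 + t)^2)" using assms by (intro summable_I6) auto
    fix n
    have "(\<Sum>j<n. 1 / (real (Suc i + j) + 1 + t)^2) \<le> (\<Sum>j<n. 2 * (1 / (real (i + j) + 1)^2))"
    proof (intro sum_mono)
      fix j
      have "(real (i + j) + 1)^2 \<le> (real (Suc i + j) + 1 + t)^2" using assms by (intro power_mono) auto
      then have "1 / (real (Suc i + j) + 1 + t)^2 \<le> 1 / (real (i + j) + 1)^2" by (intro divide_left_mono) (auto intro!: mult_pos_pos simp: add_pos_nonneg)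
      then show "1 / (real (Suc i + j) + 1 + t)^2 \<le> 2 * (1 / (real (i + j) + 1)^2)"
        using zero_le_divide_1_iff[of "(real (i + j) + 1)^2"] by (smt (verit) zero_le_power2)
    qed
    also have "\<dots> \<le> 4" using inverse_square_sum_le[of i n] unfolding sum_distrib_left[symmetric] by simp
    finally show "(\<Sum>j<n. 1 / (real (Suc i + j) + 1 + t)^2) \<le> 4" .
  qed
qed

lemma D6_alt: "D6 t = (\<Sum>i. I6 t i / (real i + 1 + t)^3)"
  by (simp add: D6_def I6_def)

lemma delta6_sums:
  assumes t: "-1/4 < t" "t < 0" and s: "s = t \<or> s = 0"
  shows "(\<lambda>i. delta6 t s i / (real i + 1 + s)^3) sums
    (S6 (2 * t) s - 16 * S6 t s + 15 * hurwitz3 s - 12 * t^2 * D6 s)"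
proof -
  have nI: "y \<notin> \<int>" if "0 < -y" "-y < 1" for y :: real
    using that by (auto elim!: Ints_cases)
  have nI': "y \<notin> \<int>" if "0 < y" "y < 1" for y :: real
    using that by (auto elim!: Ints_cases)
  have S: "(\<lambda>i. c6 a s (Suc i) / (real i + 1 + s)^3) sums S6 a s" if "1 + s + a > 0" "a - s \<notin> \<int>" for a
  proof -
    have "summable (\<lambda>i. \<bar>c6 a s (Suc i) / (1 + s + real i)^3\<bar>)"
      using summable_c6_power[of s a 3] that s t by (auto simp: abs_divide power_abs)
    from summable_sums[OF summable_rabs_cancel[OF this]] show ?thesis by (simp add: S6_def add_ac)
  qed
  have 1: "(\<lambda>i. c6 (2*t) s (Suc i) / (real i + 1 + s)^3) sums S6 (2*t) s"
    using s t nI[of "2*t - s"] by (intro S) auto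
  have 2: "(\<lambda>i. c6 t s (Suc i) / (real i + 1 + s)^3) sums S6 t s"
    using S[of "-t"] s t nI'[of "-t - s"] by (auto simp: S6_def c6_uminus)
  have 3: "(\<lambda>i. 1 / (real i + 1 + s)^3) sums hurwitz3 s"
    unfolding hurwitz3_def using s t by (intro summable_sums summable_cube) auto
  have 4: "(\<lambda>i. I6 s i / (real i + 1 + s)^3) sums D6 s"
    unfolding D6_alt
  proof (intro summable_sums)
    have st: "s > -1/4" using s t by auto
    show "summable (\<lambda>i. I6 s i / (real i + 1 + s)^3)"
    proof (rule summable_comparison_test'[where N = 0])
      show "summable (\<lambda>i. 4 * (1 / (real i + 1 + s)^3))" using st by (intro summable_mult summable_cube) auto
      fix i
      show "norm (I6 s i / (real i + 1 + s)^3) \<le> 4 * (1 / (real i + 1 + s)^3)"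
        using I6_bounds[OF st, of i] st by (simp add: divide_right_mono)
    qed
  qed
  have "(\<lambda>i. c6 (2*t) s (Suc i) / (real i + 1 + s)^3 - 16 * (c6 t s (Suc i) / (real i + 1 + s)^3)
      + 15 * (1 / (real i + 1 + s)^3) - 12 * t^2 * (I6 s i / (real i + 1 + s)^3)) sums
      (S6 (2 * t) s - 16 * S6 t s + 15 * hurwitz3 s - 12 * t^2 * D6 s)"
    by (intro sums_diff sums_add sums_mult 1 2 3 4)
  then show ?thesis by (simp add: delta6_def diff_divide_distrib add_divide_distrib)
qed

text \<open>Within one shift the combination is only of order 6. Subtracting its value at shift 0
  removes the a^6 term and leaves order 7, the gain that the sixth derivative depends on.\<close>

lemma S6_combination_bound:
  "\<exists>K. \<forall>t. -1/4 < t \<and> t < 0 \<longrightarrow>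
    \<bar>(S6 (2 * t) t - 16 * S6 t t + 15 * hurwitz3 t - 12 * t^2 * D6 t)
      - (S6 (2 * t) 0 - 16 * S6 t 0 + 15 * hurwitz3 0 - 12 * t^2 * D6 0)\<bar> \<le> K * \<bar>t\<bar>^7"
proof (intro exI allI impI)
  fix t :: real assume "-1/4 < t \<and> t < 0"
  then have t: "-1/4 < t" "t < 0" by auto
  have d: "(\<lambda>i. delta6 t t i / (real i + 1 + t)^3 - delta6 t 0 i / (real i + 1 + 0)^3) sums
    ((S6 (2 * t) t - 16 * S6 t t + 15 * hurwitz3 t - 12 * t^2 * D6 t)
      - (S6 (2 * t) 0 - 16 * S6 t 0 + 15 * hurwitz3 0 - 12 * t^2 * D6 0))" (is "?f sums ?s")
    using t by (intro sums_diff delta6_sums) auto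
  have bound: "\<bar>?f i\<bar> \<le> 246000 * \<bar>t\<bar>^7 * (1 / (real i + 1 + 0)^3)" for i
  proof -
    define w where "w = real i + 1"
    have w: "w \<ge> 1" by (simp add: w_def)
    define W where "W = w + t"
    have W: "W \<ge> 3/4 * w" "W \<le> w" using t w by (auto simp: W_def)
    have Wpos: "W > 0" using W w by auto
    have "(3/4 * w)^3 \<le> W^3" using W w by (intro power_mono) auto
    then have "w^3 * 27 \<le> W^3 * 64" by (simp add: power_mult_distrib power3_eq_cube)
    then have "w^3 \<le> 3 * W^3" using Wpos zero_less_power[of W 3] by linarith
    then have iW: "1 / W^3 \<le> 3 * (1 / w^3)" using w Wpos by (simp add: field_simps)
    have "1 / W^3 - 1 / w^3 = (w - W) * (w^2 + w * W + W^2) / (W^3 * w^3)"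
      using w Wpos by (simp add: field_simps power2_eq_square power3_eq_cube)
    also have "\<dots> \<le> (w - W) * (3 * w^2) / (W^3 * w^3)"
    proof -
      have "w * W \<le> w * w" "W * W \<le> w * w" using W w Wpos by (intro mult_mono; simp)+
      then have "w^2 + w * W + W^2 \<le> 3 * w^2" unfolding power2_eq_square by linarith
      then show ?thesis using W w Wpos by (intro divide_right_mono mult_left_mono) auto
    qed
    also have "\<dots> = 3 * (w - W) / w * (1 / W^3)" using w Wpos by (simp add: field_simps power2_eq_square power3_eq_cube)
    also have "\<dots> \<le> 3 * \<bar>t\<bar> * (3 * (1 / w^3))"
    proof (intro mult_mono iW)
      show "3 * (w - W) / w \<le> 3 * \<bar>t\<bar>" using w t mult_left_mono[of 1 w "-t"] by (simp add: W_def field_simps)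
    qed (use w Wpos in auto)
    finally have dW: "1 / W^3 - 1 / w^3 \<le> 9 * \<bar>t\<bar> * (1 / w^3)" by simp
    have dW0: "0 \<le> 1 / W^3 - 1 / w^3"
      using W Wpos power_mono[of W w 3] by (simp add: divide_left_mono frac_le)
    \<comment> \<open>The shift acts on the numerator and on the weight 1 / (i + 1 + t)^3. Changing
      the numerator costs order 7; changing the weight costs a factor t on a numerator of order
      6.\<close>
    have "?f i = (delta6 t t i - delta6 t 0 i) * (1 / W^3) + delta6 t 0 i * (1 / W^3 - 1 / w^3)"
      by (simp add: W_def w_def diff_divide_distrib algebra_simps)
    also have "\<bar>\<dots>\<bar> \<le> \<bar>delta6 t t i - delta6 t 0 i\<bar> * (1 / W^3) + \<bar>delta6 t 0 i\<bar> * (1 / W^3 - 1 / w^3)"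
      using Wpos dW0 by (intro order.trans[OF abs_triangle_ineq]) (simp add: abs_mult)
    also have "\<dots> \<le> 50000 * \<bar>t\<bar>^7 * (3 * (1 / w^3)) + 8000 * \<bar>t\<bar>^6 * (9 * \<bar>t\<bar> * (1 / w^3))"
      using delta6_bounds[OF t, of i] iW dW dW0 Wpos by (intro add_mono mult_mono) auto
    also have "\<dots> = 222000 * \<bar>t\<bar>^7 * (1 / w^3)" by (simp add: power_numeral_reduce)
    also have "\<dots> \<le> 246000 * \<bar>t\<bar>^7 * (1 / w^3)" using w by (intro mult_right_mono) auto
    finally show ?thesis by (simp add: w_def)
  qed
  have "\<bar>?s\<bar> \<le> (\<Sum>i. 246000 * \<bar>t\<bar>^7 * (1 / (real i + 1 + 0)^3))"
  proof -
    have sb: "summable (\<lambda>i. 246000 * \<bar>t\<bar>^7 * (1 / (real i + 1 + 0)^3))"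
      using summable_cube[of 0] by (intro summable_mult) auto
    have "\<bar>suminf ?f\<bar> \<le> (\<Sum>i. 246000 * \<bar>t\<bar>^7 * (1 / (real i + 1 + 0)^3))"
      using norm_suminf_le[of ?f, OF _ sb] bound by simp
    moreover have "suminf ?f = ?s" using d by (simp add: sums_iff)
    ultimately show ?thesis by simp
  qed
  also have "\<dots> = (246000 * (\<Sum>i. 1 / (real i + 1 + 0)^3)) * \<bar>t\<bar>^7"
    using summable_cube[of 0] by (subst suminf_mult) auto
  finally show "\<bar>?s\<bar> \<le> (246000 * (\<Sum>i. 1 / (real i + 1 + 0)^3)) * \<bar>t\<bar>^7" .
qed

section \<open>Double zeta values\<close>

definition zetar :: "nat \<Rightarrow> real" where
  "zetar k = (\<Sum>n. 1 / (real n + 1)^k)"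

text \<open>Mordell-Tornheim double series in x = m + 1 and y = n + 1, with exponents of x + y, x
  and y. For r = 0 it is a product of zeta values and for b = 0 a double zeta value, so partial
  fractions lead from one to the other inside a single family.\<close>

definition tornheim_term :: "nat \<Rightarrow> nat \<Rightarrow> nat \<Rightarrow> nat \<times> nat \<Rightarrow> real" where
  "tornheim_term r a b = (\<lambda>(m, n). 1 / ((real m + real n + 2)^r * (real m + 1)^a * (real n + 1)^b))"

definition tornheim :: "nat \<Rightarrow> nat \<Rightarrow> nat \<Rightarrow> real" where
  "tornheim r a b = infsum (tornheim_term r a b) UNIV"

abbreviation mzv2 :: "nat \<Rightarrow> nat \<Rightarrow> real" where
  "mzv2 a b \<equiv> tornheim a b 0"

lemma tornheim_term_nonneg: "tornheim_term r a b p \<ge> 0"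
  by (cases p) (auto simp: tornheim_term_def)

lemma summable_on_zetar: "k \<ge> 2 \<Longrightarrow> (\<lambda>n. 1 / (real n + 1)^k) summable_on UNIV"
  using Polygamma_converges'[of "1::real" k]
  by (intro summable_nonneg_imp_summable_on) (auto simp: field_simps)

lemma infsum_zetar: "k \<ge> 2 \<Longrightarrow> infsum (\<lambda>n. 1 / (real n + 1)^k) UNIV = zetar k"
  using has_sum_imp_sums[OF has_sum_infsum[OF summable_on_zetar]] by (simp add: zetar_def sums_iff)

text \<open>All cases come from sqrt(x y) \<le> x + y and sqrt(x y) \<le> x y. The power 3/2 is
  convenient since it yields a product of two convergent single series as majorant.\<close>

lemma powr_three_halves_le:
  fixes x y :: real
  assumes "x \<ge> 1" "y \<ge> 1"
  shows "(x * y) powr (3/2) \<le> (x + y) * x * y" "(x * y) powr (3/2) \<le> (x + y)^2 * x"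
    "(x * y) powr (3/2) \<le> (x * y)^2"
proof -
  have e: "(x * y) powr (3/2) = x * y * sqrt (x * y)"
    using assms powr_add[of "x * y" 1 "1/2"] by (simp add: powr_half_sqrt)
  have s: "sqrt (x * y) \<le> x + y" "sqrt (x * y) \<le> x * y"
  proof -
    have "x * y \<le> (x + y)^2" using assms by (simp add: power2_eq_square algebra_simps)
    then show "sqrt (x * y) \<le> x + y" using assms by (intro real_le_lsqrt) auto
    have "1 * 1 \<le> x * y" using assms by (intro mult_mono) auto
    then have "x * y * 1 \<le> x * y * (x * y)" by (intro mult_left_mono) auto
    then show "sqrt (x * y) \<le> x * y" using assms by (intro real_le_lsqrt) (auto simp: power2_eq_square)
  qed
  show 1: "(x * y) powr (3/2) \<le> (x + y) * x * y"
    unfolding e using mult_left_mono[OF s(1), of "x * y"] assms by (simp add: mult_ac)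
  show "(x * y) powr (3/2) \<le> (x * y)^2"
    unfolding e using mult_left_mono[OF s(2), of "x * y"] assms by (simp add: power2_eq_square)
  have "(x + y) * x * y \<le> (x + y) * x * (x + y)" using assms by (intro mult_left_mono) auto
  with 1 show "(x * y) powr (3/2) \<le> (x + y)^2 * x" by (simp add: power2_eq_square mult_ac)
qed

text \<open>A sufficient condition for absolute convergence, with one disjunct for each kind of
  exponent triple that the partial fraction recursion meets.\<close>

definition tornheim_ok :: "nat \<Rightarrow> nat \<Rightarrow> nat \<Rightarrow> bool" where
  "tornheim_ok r a b \<longleftrightarrow> 1 \<le> r \<and> 1 \<le> a \<and> 1 \<le> b \<or> 2 \<le> r \<and> 1 \<le> a \<or> 2 \<le> r \<and> 1 \<le> b \<or> 2 \<le> a \<and> 2 \<le> b"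

lemma tornheim_term_le:
  assumes "tornheim_ok r a b"
  shows "tornheim_term r a b (m, n) \<le> (real m + 1) powr (-3/2) * (real n + 1) powr (-3/2)"
proof -
  define x where "x = real m + 1"
  define y where "y = real n + 1"
  have xy: "x \<ge> 1" "y \<ge> 1" by (auto simp: x_def y_def)
  have "(x * y) powr (3/2) \<le> (x + y)^r * x^a * y^b"
  proof -
    have mono: "(x + y)^r' * x^a' * y^b' \<le> (x + y)^r * x^a * y^b" if "r' \<le> r" "a' \<le> a" "b' \<le> b" for r' a' b'
      using that xy by (intro mult_mono power_increasing) auto
    from assms consider "1 \<le> r" "1 \<le> a" "1 \<le> b" | "2 \<le> r" "1 \<le> a" | "2 \<le> r" "1 \<le> b" | "2 \<le> a" "2 \<le> b"
      unfolding tornheim_ok_def by blast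
    then show ?thesis
    proof cases
      case 1 show ?thesis using powr_three_halves_le(1)[OF xy] mono[OF 1] by simp
    next
      case 2 show ?thesis using powr_three_halves_le(2)[OF xy] mono[OF 2, of 0] by simp
    next
      case 3 show ?thesis
        using powr_three_halves_le(2)[of y x] xy mono[of 2 0 1] 3 by (simp add: mult_ac add_ac)
    next
      case 4 show ?thesis
        using powr_three_halves_le(3)[OF xy] mono[of 0 2 2] 4 by (simp add: power_mult_distrib)
    qed
  qed
  moreover have "(x * y) powr (3/2) > 0" using xy by simp
  ultimately have "1 / ((x + y)^r * x^a * y^b) \<le> 1 / (x * y) powr (3/2)"
    using xy by (intro divide_left_mono mult_pos_pos) auto
  also have "\<dots> = x powr (-3/2) * y powr (-3/2)" using xy by (simp add: powr_mult powr_minus_divide)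
  also have "x + y = real m + real n + 2" by (simp add: x_def y_def)
  finally show ?thesis by (simp add: tornheim_term_def x_def y_def)
qed

lemma summable_tornheim:
  assumes "tornheim_ok r a b"
  shows "tornheim_term r a b summable_on A"
proof -
  have "summable (\<lambda>n. real n powr (-3/2))" by (simp add: summable_real_powr_iff)
  then have "summable (\<lambda>n. real (Suc n) powr (-3/2))" by (subst summable_Suc_iff)
  then have p: "(\<lambda>n. (real n + 1) powr (-3/2)) summable_on UNIV"
    by (intro summable_nonneg_imp_summable_on) (auto simp: add_ac)
  have "(\<lambda>(m, n). (real m + 1) powr (-3/2) * (real n + 1) powr (-3/2)) summable_on (UNIV \<times> UNIV)"
  proof (rule summable_on_SigmaI)
    fix m :: nat
    show "((\<lambda>n. case (m, n) of (m, n) \<Rightarrow> (real m + 1) powr (-3/2) * (real n + 1) powr (-3/2))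
       has_sum ((real m + 1) powr (-3/2) * infsum (\<lambda>n. (real n + 1) powr (-3/2)) UNIV)) UNIV"
      using has_sum_cmult_right[OF has_sum_infsum[OF p]] by simp
  next
    show "(\<lambda>m. (real m + 1) powr (-3/2) * infsum (\<lambda>n. (real n + 1) powr (-3/2)) UNIV) summable_on UNIV"
      by (rule summable_on_cmult_left[OF p])
  qed auto
  then have "(\<lambda>(m, n). (real m + 1) powr (-3/2) * (real n + 1) powr (-3/2)) summable_on (UNIV :: (nat \<times> nat) set)"
    by simp
  then have "tornheim_term r a b summable_on UNIV"
    by (rule summable_on_comparison_test) (use tornheim_term_le[OF assms] tornheim_term_nonneg in auto)
  then show ?thesis by (rule summable_on_subset) auto
qed

text \<open>Partial fractions: \<open>1 / (x y) = (1 / x + 1 / y) / (x + y)\<close>. Iterating this gives the shuffle product.\<close>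

lemma tornheim_rec:
  assumes "tornheim_ok (Suc r) a (Suc b)" "tornheim_ok (Suc r) (Suc a) b"
  shows "tornheim r (Suc a) (Suc b) = tornheim (Suc r) a (Suc b) + tornheim (Suc r) (Suc a) b"
proof -
  have "tornheim_term r (Suc a) (Suc b) p = tornheim_term (Suc r) a (Suc b) p + tornheim_term (Suc r) (Suc a) b p" for p
  proof -
    obtain m n where p: "p = (m, n)" by (cases p)
    define x where "x = real m + 1"
    define y where "y = real n + 1"
    have xy: "x > 0" "y > 0" by (auto simp: x_def y_def)
    have s: "real m + real n + 2 = x + y" by (simp add: x_def y_def)
    have "1 / (s^r * x^Suc a * y^Suc b) = 1 / (s^Suc r * x^a * y^Suc b) + 1 / (s^Suc r * x^Suc a * y^b)"
      if "s = x + y" for s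
    proof -
      have sp: "s > 0" using xy that by simp
      have "1 / (s^Suc r * x^a * y^Suc b) + 1 / (s^Suc r * x^Suc a * y^b)
        = 1 / (s^r * x^a * y^b) * ((x + y) / (s * x * y))"
        using xy sp by (simp add: divide_simps)
      also have "(x + y) / (s * x * y) = 1 / (x * y)" unfolding that[symmetric] using sp by simp
      finally show ?thesis by (simp add: mult_ac)
    qed
    then show ?thesis unfolding p tornheim_term_def prod.case s x_def[symmetric] y_def[symmetric] by blast
  qed
  then have "tornheim_term r (Suc a) (Suc b) = (\<lambda>p. tornheim_term (Suc r) a (Suc b) p + tornheim_term (Suc r) (Suc a) b p)"
    by (rule ext)
  then show ?thesis unfolding tornheim_def
    using infsum_add[OF summable_tornheim[OF assms(1)] summable_tornheim[OF assms(2)], of UNIV] by simp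
qed

lemma tornheim_swap: "tornheim r a b = tornheim r b a"
  unfolding tornheim_def
  by (rule infsum_reindex_bij_witness[of _ prod.swap prod.swap]) (auto simp: tornheim_term_def mult_ac add_ac)

lemma tornheim_product:
  assumes "a \<ge> 2" "b \<ge> 2"
  shows "tornheim 0 a b = zetar a * zetar b"
proof -
  have "tornheim_term 0 a b summable_on (UNIV \<times> UNIV)"
    using assms by (intro summable_tornheim) (simp add: tornheim_ok_def)
  from infsum_Sigma_banach[OF this]
  have "tornheim 0 a b = infsum (\<lambda>m. infsum (\<lambda>n. (1 / (real m + 1)^a) * (1 / (real n + 1)^b)) UNIV) UNIV"
    by (simp add: tornheim_def tornheim_term_def)
  also have "\<dots> = infsum (\<lambda>m. (1 / (real m + 1)^a) * zetar b) UNIV"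
    by (simp only: infsum_cmult_right' infsum_zetar[OF assms(2)])
  also have "\<dots> = zetar a * zetar b"
    by (simp only: infsum_cmult_left' infsum_zetar[OF assms(1)])
  finally show ?thesis .
qed

lemma infsum_below_diagonal:
  fixes f :: "nat \<times> nat \<Rightarrow> real"
  assumes "\<And>m n. f (m + n + 1, m) = tornheim_term a b 0 (m, n)"
  shows "infsum f {(m, n). n < m} = mzv2 a b"
  unfolding tornheim_def
  by (rule infsum_reindex_bij_witness[of _ "\<lambda>(i, j). (i + j + 1, i)" "\<lambda>(m, n). (n, m - n - 1)"])
     (auto simp: assms[symmetric])

text \<open>The stuffle product: the quadrant of index pairs splits into the parts below and above
  the diagonal and the diagonal itself.\<close>

lemma tornheim_stuffle:
  assumes "a \<ge> 2" "b \<ge> 2"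
  shows "zetar a * zetar b = mzv2 a b + mzv2 b a + zetar (a + b)"
proof -
  define f where "f = tornheim_term 0 a b"
  have sum: "f summable_on A" for A
    unfolding f_def using assms by (intro summable_tornheim) (simp add: tornheim_ok_def)
  have "UNIV = ({(m, n). n < m} \<union> {(m, n). m < n}) \<union> range (\<lambda>n::nat. (n, n))" by auto
  then have "infsum f UNIV = infsum f (({(m, n). n < m} \<union> {(m, n). m < n}) \<union> range (\<lambda>n. (n, n)))" by simp
  also have "\<dots> = infsum f {(m, n). n < m} + infsum f {(m, n). m < n} + infsum f (range (\<lambda>n. (n, n)))"
    by (subst infsum_Un_disjoint infsum_Un_disjoint; (rule sum)?; force?)+
  also have "infsum f {(m, n). n < m} = mzv2 a b"
    by (rule infsum_below_diagonal) (simp add: f_def tornheim_term_def add_ac)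
  also have "infsum f {(m, n). m < n} = infsum (\<lambda>(m, n). f (n, m)) {(m, n). n < m}"
    by (rule infsum_reindex_bij_witness[of _ prod.swap prod.swap]) auto
  also have "\<dots> = mzv2 b a"
    by (rule infsum_below_diagonal) (simp add: f_def tornheim_term_def add_ac mult_ac)
  also have "infsum f (range (\<lambda>n. (n, n))) = infsum (f \<circ> (\<lambda>n. (n, n))) UNIV"
    by (rule infsum_reindex) (auto simp: inj_on_def)
  also have "f \<circ> (\<lambda>n. (n, n)) = (\<lambda>n. 1 / (real n + 1)^(a + b))"
    by (auto simp: f_def tornheim_term_def power_add)
  also have "infsum (\<lambda>n. 1 / (real n + 1)^(a + b)) UNIV = zetar (a + b)"
    using assms by (intro infsum_zetar) auto
  finally show ?thesis using tornheim_product[OF assms] by (simp add: f_def tornheim_def)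
qed

text \<open>Partial fractions in n give a difference of reciprocals at distance m + 1, which
  telescopes to a harmonic number.\<close>

lemma harmonic_sums:
  "(\<lambda>n. 1 / ((real m + real n + 2) * (real n + 1))) sums ((\<Sum>k\<le>m. 1 / (real k + 1)) / (real m + 1))"
proof -
  have "(\<lambda>n. 1 / (real n + 1) - 1 / (real n + 1 + real c)) sums (\<Sum>k<c. 1 / (real k + 1))" for c
  proof (induction c)
    case (Suc c)
    have "(\<lambda>n. 1 / ((1 + real c) + real n)) \<longlonglongrightarrow> 0"
      by (rule tendsto_divide_0[OF tendsto_const filterlim_at_top_imp_at_infinity[OF
          filterlim_tendsto_add_at_top[OF tendsto_const filterlim_real_sequentially]]])
    then have "(\<lambda>n. 1 / (real n + 1 + real c)) \<longlonglongrightarrow> 0" by (simp add: add_ac)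
    from telescope_sums'[OF this]
    have "(\<lambda>n. 1 / (real n + 1 + real c) - 1 / (real n + 1 + real (Suc c))) sums (1 / (real c + 1))"
      by (simp add: add_ac)
    from sums_add[OF Suc this] show ?case by simp
  qed simp
  from sums_divide[OF this[of "Suc m"], of "real m + 1"]
  have "(\<lambda>n. (1 / (real n + 1) - 1 / (real n + 1 + real (Suc m))) / (real m + 1))
      sums ((\<Sum>k\<le>m. 1 / (real k + 1)) / (real m + 1))" by (simp add: lessThan_Suc_atMost)
  moreover have "(1 / (real n + 1) - 1 / (real n + 1 + real (Suc m))) / (real m + 1) = 1 / ((real m + real n + 2) * (real n + 1))" for n
    by (simp add: divide_simps) (simp add: algebra_simps)
  ultimately show ?thesis by simp
qed

text \<open>Summing over n first gives harmonic numbers divided by (m + 1)^(a + 1). Comparison with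
  the partial fraction expansion of the same series is Euler's sum formula; it provides the relation
  that a shuffle with the divergent zeta(1) would suggest.\<close>

lemma tornheim_one_one:
  assumes "a \<ge> 2"
  shows "tornheim 1 a 1 = zetar (a + 2) + mzv2 (a + 1) 1"
proof -
  define g where "g = (\<lambda>(m, n). 1 / ((real m + 1)^(a + 1) * (real n + 1)))"
  have H: "((\<lambda>n. tornheim_term 1 a 1 (m, n)) has_sum (\<Sum>k\<le>m. g (m, k))) UNIV" for m
  proof -
    have "(\<lambda>n. 1 / (real m + 1)^a * (1 / ((real m + real n + 2) * (real n + 1)))) sums
       (1 / (real m + 1)^a * ((\<Sum>k\<le>m. 1 / (real k + 1)) / (real m + 1)))"
      by (rule sums_mult[OF harmonic_sums])
    moreover have "1 / (real m + 1)^a * ((\<Sum>k\<le>m. 1 / (real k + 1)) / (real m + 1)) = (\<Sum>k\<le>m. g (m, k))"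
      by (simp add: g_def sum_divide_distrib sum_distrib_left mult_ac)
    ultimately show ?thesis
      by (intro sums_nonneg_imp_has_sum) (simp_all add: tornheim_term_def mult_ac)
  qed
  have sumt: "tornheim_term 1 a 1 summable_on (UNIV \<times> UNIV)"
    using assms by (intro summable_tornheim) (simp add: tornheim_ok_def)
  have T: "tornheim 1 a 1 = infsum (\<lambda>m. \<Sum>k\<le>m. g (m, k)) UNIV"
    using infsum_Sigma_banach[OF sumt] infsumI[OF H] by (simp add: tornheim_def)
  have "(\<lambda>m. \<Sum>k\<le>m. g (m, k)) summable_on UNIV"
    using summable_on_Sigma_banach[of "\<lambda>m n. tornheim_term 1 a 1 (m, n)" UNIV "\<lambda>_. UNIV"] sumt infsumI[OF H] by simp
  then have sumg: "g summable_on (SIGMA m:UNIV. {..m})"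
    by (intro summable_on_SigmaI[where g = "\<lambda>m. \<Sum>k\<le>m. g (m, k)"] has_sum_finite) (auto simp: g_def)
  have "tornheim 1 a 1 = infsum g (SIGMA m:UNIV. {..m})"
    unfolding T using infsum_Sigma_banach[OF sumg] by (simp add: infsum_finite)
  also have "(SIGMA m:(UNIV :: nat set). {..m}) = {(m, n). n < m} \<union> range (\<lambda>n. (n, n))" by auto
  also have "infsum g \<dots> = infsum g {(m, n). n < m} + infsum g (range (\<lambda>n. (n, n)))"
    by (intro infsum_Un_disjoint summable_on_subset[OF sumg]) auto
  also have "infsum g {(m, n). n < m} = mzv2 (a + 1) 1"
    by (rule infsum_below_diagonal) (simp add: g_def tornheim_term_def add_ac)
  also have "infsum g (range (\<lambda>n. (n, n))) = infsum (g \<circ> (\<lambda>n. (n, n))) UNIV"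
    by (rule infsum_reindex) (auto simp: inj_on_def)
  also have "g \<circ> (\<lambda>n. (n, n)) = (\<lambda>n. 1 / (real n + 1)^(a + 2))"
    by (auto simp: g_def power_add power2_eq_square)
  also have "infsum (\<lambda>n. 1 / (real n + 1)^(a + 2)) UNIV = zetar (a + 2)"
    using assms by (intro infsum_zetar) auto
  finally show ?thesis by simp
qed

text \<open>The instance of symmetry with \<open>Suc b\<close> only moves exponents towards the
  double zeta form, so it is safe as a rewrite rule.\<close>

lemma tornheim_flip: "tornheim r 0 (Suc b) = mzv2 r (Suc b)"
  by (rule tornheim_swap)

section \<open>Relations between double zeta values in weights 6 to 9\<close>

lemmas tornheim_eval = tornheim_rec tornheim_flip tornheim_ok_def eval_nat_numeral

text \<open>The left-hand sides here and in weights 7 to 9 are, up to sign, the Taylor coefficients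
  of \<open>D6\<close> at 0 in degrees 1 to 4. With stuffle, shuffle and the sum formula as linear
  equations, these particular combinations are determined by elimination.\<close>

lemma mzv2_weight_6:
  "2 * mzv2 3 3 + 3 * mzv2 2 4 = 21/2 * zetar 6 - 3 * (zetar 2 * zetar 4) - 2 * (zetar 3)^2"
proof -
  have "tornheim 1 4 1 = zetar 6 + mzv2 5 1" using tornheim_one_one[of 4] by simp
  moreover have "tornheim 1 4 1 = mzv2 2 4 + mzv2 3 3 + mzv2 4 2 + 2 * mzv2 5 1"
    by (simp add: tornheim_eval)
  moreover have "tornheim 0 3 3 = 2 * mzv2 3 3 + 6 * mzv2 4 2 + 12 * mzv2 5 1"
    by (simp add: tornheim_eval)
  moreover have "tornheim 0 3 3 = zetar 3 * zetar 3" by (rule tornheim_product) auto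
  moreover have "zetar 3 * zetar 3 = mzv2 3 3 + mzv2 3 3 + zetar 6" using tornheim_stuffle[of 3 3] by simp
  moreover have "zetar 2 * zetar 4 = mzv2 2 4 + mzv2 4 2 + zetar 6" using tornheim_stuffle[of 2 4] by simp
  ultimately show ?thesis unfolding power2_eq_square by linarith
qed

lemma mzv2_weight_7:
  "3 * mzv2 4 3 + 6 * mzv2 3 4 + 6 * mzv2 2 5 = 3 * zetar 7 + 6 * (zetar 2 * zetar 5) - 6 * (zetar 3 * zetar 4)"
proof -
  have "tornheim 1 5 1 = zetar 7 + mzv2 6 1" using tornheim_one_one[of 5] by simp
  moreover have "tornheim 1 5 1 = mzv2 2 5 + mzv2 3 4 + mzv2 4 3 + mzv2 5 2 + 2 * mzv2 6 1"
    by (simp add: tornheim_eval)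
  moreover have "tornheim 0 2 5 = mzv2 2 5 + 2 * mzv2 3 4 + 3 * mzv2 4 3 + 5 * mzv2 5 2 + 10 * mzv2 6 1"
    by (simp add: tornheim_eval)
  moreover have "tornheim 0 2 5 = zetar 2 * zetar 5" by (rule tornheim_product) auto
  moreover have "tornheim 0 3 4 = mzv2 3 4 + 4 * mzv2 4 3 + 10 * mzv2 5 2 + 20 * mzv2 6 1"
    by (simp add: tornheim_eval)
  moreover have "tornheim 0 3 4 = zetar 3 * zetar 4" by (rule tornheim_product) auto
  moreover have "zetar 2 * zetar 5 = mzv2 2 5 + mzv2 5 2 + zetar 7" using tornheim_stuffle[of 2 5] by simp
  moreover have "zetar 3 * zetar 4 = mzv2 3 4 + mzv2 4 3 + zetar 7" using tornheim_stuffle[of 3 4] by simp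
  ultimately show ?thesis by linarith
qed

text \<open>In this weight the relations used do not remove every double zeta value;
  \<open>mzv2 5 3\<close> is kept as the remaining one and appears on both sides.\<close>

lemma mzv2_weight_8:
  "4 * mzv2 5 3 + 9 * mzv2 4 4 + 12 * mzv2 3 5 + 10 * mzv2 2 6
   = 251/6 * zetar 8 - 10 * (zetar 2 * zetar 6) - 8 * (zetar 3 * zetar 5) - 9/2 * (zetar 4)^2 - 4 * mzv2 5 3"
proof -
  have "tornheim 1 6 1 = zetar 8 + mzv2 7 1" using tornheim_one_one[of 6] by simp
  moreover have "tornheim 1 6 1 = mzv2 2 6 + mzv2 3 5 + mzv2 4 4 + mzv2 5 3 + mzv2 6 2 + 2 * mzv2 7 1"
    by (simp add: tornheim_eval)
  moreover have "tornheim 0 3 5 = mzv2 3 5 + 3 * mzv2 4 4 + 7 * mzv2 5 3 + 15 * mzv2 6 2 + 30 * mzv2 7 1"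
    by (simp add: tornheim_eval)
  moreover have "tornheim 0 3 5 = zetar 3 * zetar 5" by (rule tornheim_product) auto
  moreover have "zetar 2 * zetar 6 = mzv2 2 6 + mzv2 6 2 + zetar 8" using tornheim_stuffle[of 2 6] by simp
  moreover have "zetar 3 * zetar 5 = mzv2 3 5 + mzv2 5 3 + zetar 8" using tornheim_stuffle[of 3 5] by simp
  moreover have "zetar 4 * zetar 4 = mzv2 4 4 + mzv2 4 4 + zetar 8" using tornheim_stuffle[of 4 4] by simp
  ultimately show ?thesis unfolding power2_eq_square by linarith
qed

lemma mzv2_weight_9:
  "5 * mzv2 6 3 + 12 * mzv2 5 4 + 18 * mzv2 4 5 + 20 * mzv2 3 6 + 15 * mzv2 2 7
   = 15 * (zetar 2 * zetar 7) - 10 * (zetar 3 * zetar 6) + 18 * (zetar 4 * zetar 5) - 17 * zetar 9"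
proof -
  have "tornheim 1 7 1 = zetar 9 + mzv2 8 1" using tornheim_one_one[of 7] by simp
  moreover have "tornheim 1 7 1 = mzv2 2 7 + mzv2 3 6 + mzv2 4 5 + mzv2 5 4 + mzv2 6 3 + mzv2 7 2 + 2 * mzv2 8 1"
    by (simp add: tornheim_eval)
  moreover have "tornheim 0 2 7 = mzv2 2 7 + 2 * mzv2 3 6 + 3 * mzv2 4 5 + 4 * mzv2 5 4 + 5 * mzv2 6 3 + 7 * mzv2 7 2 + 14 * mzv2 8 1"
    by (simp add: tornheim_eval)
  moreover have "tornheim 0 2 7 = zetar 2 * zetar 7" by (rule tornheim_product) auto
  moreover have "tornheim 0 3 6 = mzv2 3 6 + 3 * mzv2 4 5 + 6 * mzv2 5 4 + 11 * mzv2 6 3 + 21 * mzv2 7 2 + 42 * mzv2 8 1"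
    by (simp add: tornheim_eval)
  moreover have "tornheim 0 3 6 = zetar 3 * zetar 6" by (rule tornheim_product) auto
  moreover have "tornheim 0 4 5 = mzv2 4 5 + 5 * mzv2 5 4 + 15 * mzv2 6 3 + 35 * mzv2 7 2 + 70 * mzv2 8 1"
    by (simp add: tornheim_eval)
  moreover have "tornheim 0 4 5 = zetar 4 * zetar 5" by (rule tornheim_product) auto
  moreover have "zetar 2 * zetar 7 = mzv2 2 7 + mzv2 7 2 + zetar 9" using tornheim_stuffle[of 2 7] by simp
  moreover have "zetar 3 * zetar 6 = mzv2 3 6 + mzv2 6 3 + zetar 9" using tornheim_stuffle[of 3 6] by simp
  moreover have "zetar 4 * zetar 5 = mzv2 4 5 + mzv2 5 4 + zetar 9" using tornheim_stuffle[of 4 5] by simp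
  ultimately show ?thesis by linarith
qed

lemma zeta_eq_zetar:
  assumes "k \<ge> 2"
  shows "zeta (of_nat k) = of_real (zetar k)"
proof -
  have "(of_nat (Suc n) :: complex) powr (- of_nat k) = of_real (1 / (real n + 1)^k)" for n
  proof -
    have "(of_nat (Suc n) :: complex) \<noteq> 0" by (simp del: of_nat_Suc)
    then have "(of_nat (Suc n) :: complex) powr (- of_nat k) = 1 / of_nat (Suc n) ^ k"
      by (simp add: powr_minus powr_nat inverse_eq_divide del: of_nat_Suc)
    then show ?thesis by (simp add: add_ac)
  qed
  moreover have "summable (\<lambda>n. 1 / (real n + 1)^k)"
    using summable_on_imp_summable[OF summable_on_zetar[OF assms]] .
  ultimately show ?thesis by (simp only: zeta_def zetar_def suminf_of_real)
qed

lemma double_zeta_eq_mzv2: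
  assumes "a \<ge> 2" "b \<ge> 1"
  shows "double_zeta a b = of_real (mzv2 a b)"
proof -
  have "double_zeta a b = infsum (\<lambda>p. complex_of_real (tornheim_term a b 0 p)) UNIV"
    unfolding double_zeta_def
    by (rule infsum_reindex_bij_witness[of _ "\<lambda>(m, n). (m + n + 2, m + 1)" "\<lambda>(k1, k2). (k2 - 1, k1 - k2 - 1)"])
       (auto simp: tornheim_term_def)
  also have "\<dots> = of_real (mzv2 a b)"
    unfolding tornheim_def
    using has_sum_of_real[OF has_sum_infsum[OF summable_tornheim[of a b 0 UNIV]]] assms
    by (intro infsumI) (auto simp: tornheim_ok_def)
  finally show ?thesis .
qed

section \<open>The asymptotic identity\<close>

text \<open>The inner tail sum of a double zeta value; these tails are what the expansion of
  \<open>I6\<close> in t produces.\<close>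

definition mzvI :: "nat \<Rightarrow> nat \<Rightarrow> real" where
  "mzvI a i = (\<Sum>j. 1 / (real (Suc i + j) + 1)^a)"

lemma summable_mzvI: "a \<ge> 2 \<Longrightarrow> summable (\<lambda>j. 1 / (real (Suc i + j) + 1)^a)"
  using Polygamma_converges'[of "real i + 2" a] by (simp add: field_simps add_ac)

lemma mzvI_sums: "a \<ge> 2 \<Longrightarrow> b \<ge> 1 \<Longrightarrow> (\<lambda>i. mzvI a i / (real i + 1)^b) sums mzv2 a b"
proof -
  assume ab: "a \<ge> 2" "b \<ge> 1"
  have inner: "((\<lambda>j. tornheim_term a b 0 (i, j)) has_sum (mzvI a i / (real i + 1)^b)) UNIV" for i
  proof -
    have "(\<lambda>j. 1 / (real (Suc i + j) + 1)^a) sums mzvI a i"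
      unfolding mzvI_def using ab by (intro summable_sums summable_mzvI) auto
    from sums_divide[OF this, of "(real i + 1)^b"] show ?thesis
      by (intro sums_nonneg_imp_has_sum tornheim_term_nonneg) (simp add: tornheim_term_def add_ac)
  qed
  have sumt: "tornheim_term a b 0 summable_on (UNIV \<times> UNIV)"
    using ab by (intro summable_tornheim) (auto simp: tornheim_ok_def)
  have s: "(\<lambda>i. mzvI a i / (real i + 1)^b) summable_on UNIV"
    using summable_on_Sigma_banach[of "\<lambda>m n. tornheim_term a b 0 (m, n)" UNIV "\<lambda>_. UNIV"] sumt infsumI[OF inner] by simp
  have "mzv2 a b = infsum (\<lambda>i. mzvI a i / (real i + 1)^b) UNIV"
    using infsum_Sigma_banach[OF sumt] infsumI[OF inner] by (simp add: tornheim_def)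
  then show ?thesis using has_sum_imp_sums[OF has_sum_infsum[OF s]] by simp
qed

section \<open>Taylor expansion of the double Hurwitz zeta function\<close>

lemma inverse_square_expansion:
  fixes x :: real
  assumes "\<bar>x\<bar> \<le> 1/4"
  shows "\<bar>1 / (1 + x)^2 - (\<Sum>q<5. (-1)^q * (real q + 1) * x^q)\<bar> \<le> 13 * \<bar>x\<bar>^5"
proof -
  have pos: "1 + x \<ge> 3/4" using assms by auto
  then have sq: "(1 + x)^2 \<ge> 9/16" using power_mono[of "3/4" "1 + x" 2] by (simp add: power2_eq_square)
  have "1 / (1 + x)^2 - (\<Sum>q<5. (-1)^q * (real q + 1) * x^q) = - (x^5 * (6 + 5 * x)) / (1 + x)^2"
    using pos by (simp add: eval_nat_numeral divide_simps) (simp add: algebra_simps)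
  also have "\<bar>\<dots>\<bar> = \<bar>x\<bar>^5 * (\<bar>6 + 5 * x\<bar> / (1 + x)^2)" by (simp add: abs_mult power_abs)
  also have "\<dots> \<le> \<bar>x\<bar>^5 * 13"
  proof (intro mult_left_mono)
    \<comment> \<open>Source of 13: for |x| \<le> 1/4 the numerator is at most 29/4 and the
      denominator at least 9/16.\<close>
    have "\<bar>6 + 5 * x\<bar> \<le> 13 * (9/16)" using assms by (simp add: abs_if split: if_splits)
    also have "\<dots> \<le> 13 * (1 + x)^2" using sq by simp
    finally show "\<bar>6 + 5 * x\<bar> / (1 + x)^2 \<le> 13" using sq by (subst pos_divide_le_eq) auto
  qed simp
  finally show ?thesis by simp
qed

lemma inverse_cube_expansion:
  fixes x :: real
  assumes "\<bar>x\<bar> \<le> 1/4"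
  shows "\<bar>1 / (1 + x)^3 - (\<Sum>p<5. (-1)^p * ((real p + 1) * (real p + 2) / 2) * x^p)\<bar> \<le> 73 * \<bar>x\<bar>^5"
proof -
  have pos: "1 + x \<ge> 3/4" using assms by auto
  then have cu: "(1 + x)^3 \<ge> 27/64" using power_mono[of "3/4" "1 + x" 3] by (simp add: power3_eq_cube)
  have "1 / (1 + x)^3 - (\<Sum>p<5. (-1)^p * ((real p + 1) * (real p + 2) / 2) * x^p) = - (x^5 * (21 + 35 * x + 15 * x^2)) / (1 + x)^3"
    using pos by (simp add: eval_nat_numeral divide_simps) (simp add: algebra_simps)
  also have "\<bar>\<dots>\<bar> = \<bar>x\<bar>^5 * (\<bar>21 + 35 * x + 15 * x^2\<bar> / (1 + x)^3)" using pos by (simp add: abs_mult power_abs)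
  also have "\<dots> \<le> \<bar>x\<bar>^5 * 73"
  proof (intro mult_left_mono)
    have "x^2 \<le> 1/16" using power_mono[of "\<bar>x\<bar>" "1/4" 2] assms by (simp add: power2_eq_square)
    moreover have "\<bar>21 + 35 * x + 15 * x^2\<bar> \<le> 21 + 35 * \<bar>x\<bar> + 15 * x^2"
      using abs_ge_minus_self[of x] abs_ge_self[of x] zero_le_power2[of x] by linarith
    ultimately have "\<bar>21 + 35 * x + 15 * x^2\<bar> \<le> 73 * (27/64)" using assms by linarith
    also have "\<dots> \<le> 73 * (1 + x)^3" using cu by simp
    finally have "\<bar>21 + 35 * x + 15 * x^2\<bar> \<le> 73 * (1 + x)^3" .
    moreover have "(1 + x)^3 > 0" using cu by linarith
    ultimately show "\<bar>21 + 35 * x + 15 * x^2\<bar> / (1 + x)^3 \<le> 73" by (simp only: pos_divide_le_eq)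
  qed simp
  finally show ?thesis by simp
qed

lemma inverse_square_shift_expansion:
  fixes y t :: real
  assumes "\<bar>t\<bar> \<le> 1/4" "y \<ge> 1"
  shows "\<bar>1 / (y + t)^2 - (\<Sum>q<5. (-1)^q * (real q + 1) * t^q * (1 / y^(2+q)))\<bar> \<le> 13 * \<bar>t\<bar>^5 * (1 / y^2)"
proof -
  have x: "\<bar>t / y\<bar> \<le> \<bar>t\<bar>" using assms divide_left_mono[of 1 y "\<bar>t\<bar>"] by (simp add: abs_divide)
  have yt: "y + t = y * (1 + t / y)" using assms by (simp add: field_simps)
  have "1 / (y + t)^2 - (\<Sum>q<5. (-1)^q * (real q + 1) * t^q * (1 / y^(2+q)))
     = (1 / y^2) * (1 / (1 + t / y)^2 - (\<Sum>q<5. (-1)^q * (real q + 1) * (t / y)^q))"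
    unfolding yt power_mult_distrib by (simp add: right_diff_distrib sum_distrib_left power_add power_divide power2_eq_square power3_eq_cube mult_ac)
  also have "\<bar>\<dots>\<bar> \<le> (1 / y^2) * (13 * \<bar>t / y\<bar>^5)"
    unfolding abs_mult using inverse_square_expansion[of "t / y"] x assms by (intro mult_mono) auto
  also have "\<dots> \<le> (1 / y^2) * (13 * \<bar>t\<bar>^5)"
    using x by (intro mult_left_mono power_mono) auto
  finally show ?thesis by (simp add: mult_ac)
qed

lemma inverse_cube_shift_expansion:
  fixes y t :: real
  assumes "\<bar>t\<bar> \<le> 1/4" "y \<ge> 1"
  shows "\<bar>1 / (y + t)^3 - (\<Sum>p<5. (-1)^p * ((real p + 1) * (real p + 2) / 2) * t^p * (1 / y^(3+p)))\<bar> \<le> 73 * \<bar>t\<bar>^5 * (1 / y^3)"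
proof -
  have x: "\<bar>t / y\<bar> \<le> \<bar>t\<bar>" using assms divide_left_mono[of 1 y "\<bar>t\<bar>"] by (simp add: abs_divide)
  have yt: "y + t = y * (1 + t / y)" using assms by (simp add: field_simps)
  have "1 / (y + t)^3 - (\<Sum>p<5. (-1)^p * ((real p + 1) * (real p + 2) / 2) * t^p * (1 / y^(3+p)))
     = (1 / y^3) * (1 / (1 + t / y)^3 - (\<Sum>p<5. (-1)^p * ((real p + 1) * (real p + 2) / 2) * (t / y)^p))"
    unfolding yt power_mult_distrib by (simp add: right_diff_distrib sum_distrib_left power_add power_divide power2_eq_square power3_eq_cube mult_ac)
  also have "\<bar>\<dots>\<bar> \<le> (1 / y^3) * (73 * \<bar>t / y\<bar>^5)"
    unfolding abs_mult
  proof (intro mult_mono)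
    show "\<bar>1 / y^3\<bar> \<le> 1 / y^3" using assms by simp
    show "\<bar>1 / (1 + t / y)^3 - (\<Sum>p<5. (-1)^p * ((real p + 1) * (real p + 2) / 2) * (t / y)^p)\<bar> \<le> 73 * \<bar>t / y\<bar>^5"
      using x assms by (intro inverse_cube_expansion) linarith
    show "0 \<le> 1 / y^3" using assms by simp
  qed simp
  also have "\<dots> \<le> (1 / y^3) * (73 * \<bar>t\<bar>^5)"
    using x assms by (intro mult_left_mono power_mono) auto
  finally show ?thesis by (simp add: mult_ac)
qed

text \<open>Product of two expansions cut off separately at degree 4, so it also contains terms of
  degree 5 to 8. They are absorbed by the O(t^5) comparison, and only degrees up to 4 are evaluated
  later.\<close>

definition D6_poly :: "real \<Rightarrow> real" where
  "D6_poly t = (\<Sum>p<5. \<Sum>q<5. (-1)^p * ((real p + 1) * (real p + 2) / 2) * t^p *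
      ((-1)^q * (real q + 1) * t^q) * mzv2 (2 + q) (3 + p))"

text \<open>Inner sum and outer weight are expanded separately with errors relative to 1 / (i +
  1)^3, hence summable. Order 5 is enough since \<open>D6\<close> enters \<open>psi6\<close> with a
  factor t^6.\<close>

lemma D6_expansion:
  "\<exists>K. \<forall>t. -1/4 < t \<and> t < 0 \<longrightarrow> \<bar>D6 t - D6_poly t\<bar> \<le> K * \<bar>t\<bar>^5"
proof (intro exI allI impI)
  fix t :: real assume "-1/4 < t \<and> t < 0"
  then have t: "-1/4 < t" "t < 0" "\<bar>t\<bar> \<le> 1/4" by auto
  define U where "U = (\<lambda>i. \<Sum>q<5. (-1)^q * (real q + 1) * t^q * mzvI (2 + q) i)"
  define R where "R = (\<lambda>i. \<Sum>p<5. (-1)^p * ((real p + 1) * (real p + 2) / 2) * t^p * (1 / (real i + 1)^(3+p)))"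
  have t5: "\<bar>t\<bar>^5 \<le> 1" using t power_le_one[of "\<bar>t\<bar>" 5] by simp
  have U: "\<bar>I6 t i - U i\<bar> \<le> 26 * \<bar>t\<bar>^5" for i
  proof -
    have "(\<lambda>j. 1 / (real (Suc i + j) + 1 + t)^2 - (\<Sum>q<5. (-1)^q * (real q + 1) * t^q * (1 / (real (Suc i + j) + 1)^(2+q))))
       sums (I6 t i - U i)" (is "?f sums _")
      unfolding I6_def U_def mzvI_def using t
      by (intro sums_diff sums_sum sums_mult summable_sums summable_I6 summable_mzvI) auto
    then have "\<bar>I6 t i - U i\<bar> = norm (suminf ?f)" by (simp add: sums_iff)
    also have "norm (suminf ?f) \<le> (\<Sum>j. 13 * \<bar>t\<bar>^5 * (1 / (real (Suc i + j) + 1)^2))"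
    proof (rule norm_suminf_le)
      show "summable (\<lambda>j. 13 * \<bar>t\<bar>^5 * (1 / (real (Suc i + j) + 1)^2))"
        by (intro summable_mult summable_mzvI) auto
      show "norm (?f j) \<le> 13 * \<bar>t\<bar>^5 * (1 / (real (Suc i + j) + 1)^2)" for j
        using inverse_square_shift_expansion[OF t(3), of "real (Suc i + j) + 1"] by simp
    qed
    also have "\<dots> = 13 * \<bar>t\<bar>^5 * mzvI 2 i" unfolding mzvI_def by (intro suminf_mult summable_mzvI) auto
    also have "\<dots> \<le> 13 * \<bar>t\<bar>^5 * 2"
    proof (intro mult_left_mono)
      show "mzvI 2 i \<le> 2" unfolding mzvI_def
        by (intro suminf_le_const summable_mzvI inverse_square_sum_le[of "Suc i"]) auto
    qed auto
    finally show ?thesis by simp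
  qed
  have bound: "\<bar>I6 t i / (real i + 1 + t)^3 - U i * R i\<bar> \<le> 2400 * \<bar>t\<bar>^5 * (1 / (real i + 1)^3)" for i
  proof -
    define w where "w = real i + 1"
    have w: "w \<ge> 1" by (simp add: w_def)
    have R: "\<bar>1 / (w + t)^3 - R i\<bar> \<le> 73 * \<bar>t\<bar>^5 * (1 / w^3)"
      unfolding R_def w_def[symmetric] using inverse_cube_shift_expansion[OF t(3) w] by simp
    have "(3/4 * w)^3 \<le> (w + t)^3" using w t by (intro power_mono) auto
    then have "w^3 * 27 \<le> (w + t)^3 * 64" by (simp add: power_mult_distrib power3_eq_cube)
    then have "w^3 \<le> 3 * (w + t)^3" using zero_less_power[of "w + t" 3] w t by linarith
    then have iw: "1 / (w + t)^3 \<le> 3 * (1 / w^3)" using w t by (simp add: field_simps)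
    \<comment> \<open>The bound 4 on \<open>I6\<close> plus the expansion error of at most
      26.\<close>
    have U30: "\<bar>U i\<bar> \<le> 30" using U[of i] I6_bounds[of t i] t t5 by linarith
    have "I6 t i / (w + t)^3 - U i * R i = (I6 t i - U i) * (1 / (w + t)^3) + U i * (1 / (w + t)^3 - R i)"
      by (simp add: algebra_simps diff_divide_distrib)
    also have "\<bar>\<dots>\<bar> \<le> \<bar>I6 t i - U i\<bar> * \<bar>1 / (w + t)^3\<bar> + \<bar>U i\<bar> * \<bar>1 / (w + t)^3 - R i\<bar>"
      by (intro order.trans[OF abs_triangle_ineq]) (simp only: abs_mult order_refl)
    also have "\<dots> \<le> 26 * \<bar>t\<bar>^5 * (3 * (1 / w^3)) + 30 * (73 * \<bar>t\<bar>^5 * (1 / w^3))"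
    proof (intro add_mono mult_mono U U30 R)
      show "\<bar>1 / (w + t)^3\<bar> \<le> 3 * (1 / w^3)" using iw w t by simp
    qed (use w in auto)
    also have "\<dots> = 2268 * (\<bar>t\<bar>^5 * (1 / w^3))" by (simp add: algebra_simps)
    also have "\<dots> \<le> 2400 * (\<bar>t\<bar>^5 * (1 / w^3))" using w by (intro mult_right_mono) auto
    finally show ?thesis by (simp add: w_def mult_ac)
  qed
  have "(\<lambda>i. I6 t i / (real i + 1 + t)^3) sums D6 t"
    unfolding D6_alt
  proof (rule summable_sums, rule summable_comparison_test'[where N = 0])
    show "summable (\<lambda>i. 4 * (1 / (real i + 1 + t)^3))" using t by (intro summable_mult summable_cube) auto
    fix i
    show "norm (I6 t i / (real i + 1 + t)^3) \<le> 4 * (1 / (real i + 1 + t)^3)"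
      using I6_bounds[of t i] t by (simp add: divide_right_mono)
  qed
  moreover have "(\<lambda>i. U i * R i) sums D6_poly t"
  proof -
    have "(\<lambda>i. \<Sum>p<5. \<Sum>q<5. (-1)^p * ((real p + 1) * (real p + 2) / 2) * t^p *
      ((-1)^q * (real q + 1) * t^q) * (mzvI (2 + q) i / (real i + 1)^(3 + p))) sums D6_poly t"
      unfolding D6_poly_def by (intro sums_sum sums_mult mzvI_sums) auto
    moreover have "(\<Sum>p<5. \<Sum>q<5. (-1)^p * ((real p + 1) * (real p + 2) / 2) * t^p *
      ((-1)^q * (real q + 1) * t^q) * (mzvI (2 + q) i / (real i + 1)^(3 + p))) = R i * U i" for i
      unfolding U_def R_def sum_product by (intro sum.cong refl) (simp add: mult_ac)
    ultimately show ?thesis by (simp add: mult.commute)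
  qed
  ultimately have "(\<lambda>i. I6 t i / (real i + 1 + t)^3 - U i * R i) sums (D6 t - D6_poly t)" (is "?g sums _")
    by (rule sums_diff)
  then have "\<bar>D6 t - D6_poly t\<bar> = norm (suminf ?g)" by (simp add: sums_iff)
  also have "norm (suminf ?g) \<le> (\<Sum>i. 2400 * \<bar>t\<bar>^5 * (1 / (real i + 1)^3))"
    using summable_cube[of 0] bound by (intro norm_suminf_le summable_mult) auto
  also have "\<dots> = (2400 * (\<Sum>i. 1 / (real i + 1)^3)) * \<bar>t\<bar>^5"
    using summable_cube[of 0] by (subst suminf_mult) auto
  finally show "\<bar>D6 t - D6_poly t\<bar> \<le> (2400 * (\<Sum>i. 1 / (real i + 1)^3)) * \<bar>t\<bar>^5" by simp
qed

lemma D6_0: "D6 0 = mzv2 2 3"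
  using mzvI_sums[of 2 3] by (simp add: D6_alt I6_def mzvI_def sums_iff)

text \<open>
  Eliminating the sums \<open>S6\<close> leaves \<open>V (2 * t) t\<close>, Gamma functions, Hurwitz zeta values and \<open>D6\<close>. All
  formulas were multiplied by \<open>t ^ 4\<close> to clear denominators, so order 10 determines six derivatives.
\<close>

definition psi6 :: "real \<Rightarrow> real" where
  "psi6 t = t * (- (Gamma (1 + t)^2 / (Gamma (1 - t) * Gamma (1 + 3 * t)))) + sin (2 * pi * t) / (2 * pi)
     - 2 * t^3 * (sin (pi * t) / pi) * (4 * Gamma (1 + t)^2 * V (2 * t) t)
     + 8 * t^3 * (sin (2 * pi * t) / pi) * hurwitz3 (2 * t)
     - 128 * (2 * t * (Gamma (1 + t) * Gamma (1 - t) * (1 + t * (Digamma (1 - t) - Digamma (1 + t))))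
        - t * (Gamma (1 + t)^2 / Gamma (1 + 2 * t)) - sin (pi * t) / pi + 2 * t^3 * (sin (pi * t) / pi) * hurwitz3 (-t))
     + 120 * t^4 * (hurwitz3 t - hurwitz3 0) - 96 * t^6 * (D6_poly t - mzv2 2 3)"

text \<open>\<open>psi6\<close> is 8 t^4 times the combination of order 7, with the differences of
  \<open>S6\<close> replaced by their closed forms and \<open>D6\<close> by its polynomial. Hence
  the constants 128, 120 and 96, which are 8 times 16, 15 and 12.\<close>

lemma psi6_bound: "\<exists>K. \<forall>t. -1/4 < t \<and> t < 0 \<longrightarrow> \<bar>psi6 t\<bar> \<le> K * \<bar>t\<bar>^11"
proof -
  obtain K1 where K1: "\<And>t. -1/4 < t \<Longrightarrow> t < 0 \<Longrightarrow>
    \<bar>(S6 (2 * t) t - 16 * S6 t t + 15 * hurwitz3 t - 12 * t^2 * D6 t)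
      - (S6 (2 * t) 0 - 16 * S6 t 0 + 15 * hurwitz3 0 - 12 * t^2 * D6 0)\<bar> \<le> K1 * \<bar>t\<bar>^7"
    using S6_combination_bound by blast
  obtain K2 where K2: "\<And>t. -1/4 < t \<Longrightarrow> t < 0 \<Longrightarrow> \<bar>D6 t - D6_poly t\<bar> \<le> K2 * \<bar>t\<bar>^5"
    using D6_expansion by blast
  have "\<bar>psi6 t\<bar> \<le> (8 * K1 + 96 * K2) * \<bar>t\<bar>^11" if t: "-1/4 < t" "t < 0" for t
  proof -
    define X where "X = (S6 (2 * t) t - 16 * S6 t t + 15 * hurwitz3 t - 12 * t^2 * D6 t)
      - (S6 (2 * t) 0 - 16 * S6 t 0 + 15 * hurwitz3 0 - 12 * t^2 * D6 0)"
    define L2 where "L2 = 8 * t^3 * (S6 (2*t) t - S6 (2*t) 0)"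
    define L1 where "L1 = t^3 * (S6 t t - S6 t 0)"
    have "psi6 t = t * L2 - 128 * t * L1 + 120 * t^4 * (hurwitz3 t - hurwitz3 0) - 96 * t^6 * (D6_poly t - mzv2 2 3)"
      unfolding L2_def L1_def S6_difference_double[OF t] S6_difference_diagonal[OF t] psi6_def
      using t by (simp add: field_simps) (simp add: power_numeral_reduce field_simps)?
    also have "\<dots> = 8 * t^4 * X + 96 * t^6 * (D6 t - D6_poly t)"
      unfolding L1_def L2_def X_def D6_0 by (simp add: algebra_simps power_numeral_reduce)
    also have "\<bar>\<dots>\<bar> \<le> 8 * t^4 * (K1 * \<bar>t\<bar>^7) + 96 * t^6 * (K2 * \<bar>t\<bar>^5)"
      using K1[OF t] K2[OF t] unfolding X_def[symmetric]
      by (intro order.trans[OF abs_triangle_ineq] add_mono) (auto simp: abs_mult intro!: mult_left_mono)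
    also have "\<dots> = (8 * K1 + 96 * K2) * \<bar>t\<bar>^11"
    proof -
      have "t^4 * \<bar>t\<bar>^7 = \<bar>t\<bar>^11" "t^6 * \<bar>t\<bar>^5 = \<bar>t\<bar>^11"
        using power_add[of "\<bar>t\<bar>" 4 7] power_add[of "\<bar>t\<bar>" 6 5] by simp_all
      then show ?thesis by (simp add: algebra_simps)
    qed
    finally show ?thesis .
  qed
  then show ?thesis by blast
qed

section \<open>Termwise differentiation\<close>

text \<open>The holomorphic extension of \<open>f6\<close>. It makes termwise differentiation a
  consequence of locally uniform convergence, with no separate estimate for each derivative.\<close>

definition f6c :: "complex \<Rightarrow> complex" where
  "f6c z = exp (of_real pi * \<i> * z) * ((56 * z^2 - 32 * z + 5) / (2 * z - 1)^2) * (Gamma z ^ 3 * rGamma (3 * z + 1))"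

lemma f6c_of_real: "f6c (of_real x) = exp (of_real pi * \<i> * of_real x) * of_real (g6 x)"
proof -
  have e: "3 * complex_of_real x + 1 = of_real (3 * x + 1)" "2 * complex_of_real x - 1 = of_real (2 * x - 1)"
    "56 * complex_of_real x ^ 2 - 32 * complex_of_real x + 5 = of_real (56 * x^2 - 32 * x + 5)"
    by simp_all
  have "g6 x = (56 * x^2 - 32 * x + 5) / (2 * x - 1)^2 * (Gamma x ^ 3 * rGamma (3 * x + 1))"
    by (simp add: g6_def rGamma_inverse_Gamma divide_inverse)
  then show ?thesis
    unfolding f6c_def e Gamma_complex_of_real rGamma_complex_of_real
    by (simp only: of_real_mult of_real_divide of_real_power mult.assoc)
qed

lemma f6_eq_f6c: "f6 x = f6c (of_real x)"
  unfolding f6c_of_real by (simp add: f6_def g6_def)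

lemma not_nonpos_Ints_Re: "Re z > 0 \<Longrightarrow> z \<notin> \<int>\<^sub>\<le>\<^sub>0"
  by (auto elim!: nonpos_Ints_cases)

lemma open_Re_gt: "open {z. Re z > c}"
  by (rule open_halfspace_Re_gt)

lemma holomorphic_f6c: "f6c holomorphic_on {z. Re z > 1/2}"
proof -
  let ?A = "{z. 1/2 < Re z}"
  have "(2 * z - 1)^2 \<noteq> 0" if "z \<in> ?A" for z
  proof -
    have "Re (2 * z - 1) > 0" using that by simp
    then have "2 * z - 1 \<noteq> 0" by force
    then show ?thesis by simp
  qed
  then have 1: "(\<lambda>z. (56 * z^2 - 32 * z + 5) / (2 * z - 1)^2) holomorphic_on ?A"
    by (intro holomorphic_on_divide) (auto intro!: holomorphic_intros)
  have "z \<notin> \<int>\<^sub>\<le>\<^sub>0" if "1/2 < Re z" for z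
    by (rule not_nonpos_Ints_Re) (use that in linarith)
  then have 2: "Gamma holomorphic_on ?A"
    by (intro holomorphic_Gamma) blast
  have "(rGamma \<circ> (\<lambda>z. 3 * z + 1)) holomorphic_on ?A"
    by (rule holomorphic_on_compose_gen[OF _ holomorphic_rGamma[of UNIV]]) (auto intro!: holomorphic_intros)
  then have 3: "(\<lambda>z. rGamma (3 * z + 1)) holomorphic_on ?A" by (simp add: o_def)
  have 4: "(\<lambda>z. exp (of_real pi * \<i> * z)) holomorphic_on ?A" by (intro holomorphic_intros)
  show ?thesis unfolding f6c_def
    by (rule holomorphic_on_mult[OF holomorphic_on_mult[OF 4 1] holomorphic_on_mult[OF holomorphic_on_power[OF 2] 3]])
qed

text \<open>Along the real axis the vector derivative of a holomorphic function is its complex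
  derivative. The induction runs over the whole open half-line x > 1/2, since differentiating needs
  the previous equality near x.\<close>

lemma higher_vector_deriv_f6:
  "x > 1/2 \<Longrightarrow> higher_vector_deriv m f6 x = (deriv ^^ m) f6c (of_real x)"
proof (induction m arbitrary: x)
  case 0 then show ?case by (simp add: higher_vector_deriv_def f6_eq_f6c)
next
  case (Suc m)
  have "(deriv ^^ m) f6c holomorphic_on {z. Re z > 1/2}"
    by (intro holomorphic_higher_deriv holomorphic_f6c open_Re_gt)
  then have "((deriv ^^ m) f6c has_field_derivative deriv ((deriv ^^ m) f6c) (of_real x)) (at (of_real x))"
    by (rule holomorphic_derivI[OF _ open_Re_gt]) (use Suc.prems in auto)
  then have "((\<lambda>x. (deriv ^^ m) f6c (of_real x)) has_vector_derivative deriv ((deriv ^^ m) f6c) (of_real x)) (at x)"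
    by (rule has_vector_derivative_real_field)
  then have "(higher_vector_deriv m f6 has_vector_derivative deriv ((deriv ^^ m) f6c) (of_real x)) (at x)"
    by (rule has_vector_derivative_transform_within_open[of _ _ _ "{1/2<..}"]) (use Suc in auto)
  then have "vector_derivative (higher_vector_deriv m f6) (at x) = deriv ((deriv ^^ m) f6c) (of_real x)"
    by (rule vector_derivative_at)
  then show ?case by (simp add: higher_vector_deriv_def)
qed

text \<open>The shifted sum as a function of z: its m-th derivative at 0 is the sum of the m-th
  derivatives of \<open>f6\<close> at the positive integers.\<close>

definition F6 :: "complex \<Rightarrow> complex" where
  "F6 z = (\<Sum>k. f6c (1 + z + of_nat k))"

lemma norm_linear_ge: "Re w > 0 \<Longrightarrow> norm (3 * w + of_nat j) \<ge> 3 * norm w"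
proof -
  assume w: "Re w > 0"
  have "(3 * norm w)^2 \<le> norm (3 * w + of_nat j)^2"
    using w by (simp add: cmod_power2 power_mult_distrib power2_sum)
  then show ?thesis by (rule power2_le_imp_le) simp
qed

text \<open>One step multiplies by w^3 / ((3w + 1)(3w + 2)(3w + 3)), of modulus at most 1/27 when Re
  w > 0; the cruder 1/2 suffices for geometric convergence.\<close>

lemma Gamma_ratio_bound:
  assumes "Re z > 0"
  shows "norm (Gamma (z + of_nat k) ^ 3 * rGamma (3 * (z + of_nat k) + 1))
    \<le> (1/2)^k * norm (Gamma z ^ 3 * rGamma (3 * z + 1))"
proof (induction k)
  case (Suc k)
  define w where "w = z + of_nat k"
  have w: "Re w > 0" using assms by (simp add: w_def)
  then have wn: "w \<notin> \<int>\<^sub>\<le>\<^sub>0" by (rule not_nonpos_Ints_Re)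
  have w0: "norm w > 0" using w by auto
  have G: "Gamma (w + 1) = w * Gamma w" using wn by (rule Gamma_plus1)
  define u where "u = 3 * w"
  have r: "rGamma (u + 1) = (u + 1) * ((u + 2) * ((u + 3) * rGamma (u + 4)))"
    using rGamma_plus1[of "u + 1"] rGamma_plus1[of "u + 2"] rGamma_plus1[of "u + 3"] by (simp add: add_ac)
  have ge: "norm (u + 1) \<ge> 3 * norm w" "norm (u + 2) \<ge> 3 * norm w" "norm (u + 3) \<ge> 3 * norm w"
    using norm_linear_ge[OF w, of 1] norm_linear_ge[OF w, of 2] norm_linear_ge[OF w, of 3] by (simp_all add: u_def)
  have "(3 * norm w) * ((3 * norm w) * (3 * norm w)) \<le> norm (u + 1) * (norm (u + 2) * norm (u + 3))"
    using ge by (intro mult_mono) auto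
  then have "2 * norm w ^ 3 \<le> norm (u + 1) * (norm (u + 2) * norm (u + 3))"
  proof -
    have "(3 * norm w) * ((3 * norm w) * (3 * norm w)) = 27 * norm w ^ 3" by (simp add: power3_eq_cube)
    moreover assume "(3 * norm w) * ((3 * norm w) * (3 * norm w)) \<le> norm (u + 1) * (norm (u + 2) * norm (u + 3))"
    ultimately show ?thesis using zero_less_power[OF w0, of 3] by linarith
  qed
  then have "2 * norm w ^ 3 * (norm (Gamma w)^3 * norm (rGamma (u + 4)))
      \<le> norm (u + 1) * (norm (u + 2) * norm (u + 3)) * (norm (Gamma w)^3 * norm (rGamma (u + 4)))"
    by (intro mult_right_mono) auto
  then have "norm (Gamma (w + 1) ^ 3 * rGamma (u + 4)) \<le> (1/2) * norm (Gamma w ^ 3 * rGamma (u + 1))"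
    unfolding G r by (simp add: norm_mult norm_power power_mult_distrib mult_ac)
  also have "\<dots> \<le> (1/2) * ((1/2)^k * norm (Gamma z ^ 3 * rGamma (3 * z + 1)))"
    using Suc by (simp add: w_def u_def)
  finally show ?case by (simp add: w_def u_def algebra_simps)
qed simp

lemma F6_uniform_limit:
  "uniform_limit (ball 0 (1/4)) (\<lambda>n z. \<Sum>k<n. f6c (1 + z + of_nat k)) F6 sequentially"
proof -
  define q where "q = (\<lambda>z::complex. Gamma (1 + z) ^ 3 * rGamma (3 * (1 + z) + 1))"
  have Re: "Re (1 + z) \<ge> 3/4" if "z \<in> cball 0 (1/4)" for z :: complex
    using that abs_Re_le_cmod[of z] by auto
  have "continuous_on (cball 0 (1/4)) q"
  proof -
    have "continuous_on {z::complex. Re z > 0} Gamma"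
      using not_nonpos_Ints_Re by (intro continuous_on_Gamma) blast
    then have "continuous_on (cball 0 (1/4)) (\<lambda>z::complex. Gamma (1 + z))"
      by (rule continuous_on_compose2) (use Re in \<open>force intro!: continuous_intros\<close>)+
    moreover have "continuous_on (cball 0 (1/4)) (\<lambda>z::complex. rGamma (3 * (1 + z) + 1))"
      by (rule continuous_on_compose2[OF continuous_on_rGamma[of UNIV]]) (auto intro!: continuous_intros)
    ultimately show ?thesis unfolding q_def by (intro continuous_intros)
  qed
  then have "compact (q ` cball 0 (1/4))" by (intro compact_continuous_image) auto
  then obtain C where C: "\<And>z. z \<in> cball 0 (1/4) \<Longrightarrow> norm (q z) \<le> C"
    using compact_imp_bounded[THEN bounded_iff[THEN iffD1]] by force
  have bound: "norm (f6c (1 + z + of_nat k)) \<le> exp pi * 50 * ((1/2)^k * C)" if z: "z \<in> ball 0 (1/4)" for z k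
  proof -
    define w where "w = 1 + z + of_nat k"
    have z': "z \<in> cball 0 (1/4)" using z by auto
    have Rew: "Re w \<ge> 3/4" using Re[OF z'] by (simp add: w_def)
    have "Im w = Im z" by (simp add: w_def)
    then have Imw: "\<bar>Im w\<bar> \<le> 1" using z abs_Im_le_cmod[of z] by auto
    have "pi * (- Im w) \<le> pi * 1" using Imw by (intro mult_left_mono) auto
    \<comment> \<open>The modulus of the phase depends only on Im w, which does not change with
      k.\<close>
    then have 1: "norm (exp (of_real pi * \<i> * w)) \<le> exp pi" by simp
    define d where "d = 2 * w - 1"
    have "norm d \<ge> Re d" by (rule complex_Re_le_cmod)
    then have d: "norm d \<ge> 1/2" using Rew by (simp add: d_def)
    then have d0: "d \<noteq> 0" by auto
    \<comment> \<open>In powers of d = 2w - 1 the rational factor is 14 + 12/d + 3/d^2; with |d|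
      \<ge> 1/2 this is at most 14 + 24 + 12 = 50.\<close>
    have "(56 * w^2 - 32 * w + 5) / d^2 = 14 + 12 / d + 3 / d^2"
    proof -
      have "56 * w^2 - 32 * w + 5 = 14 * d^2 + 12 * d + 3"
        by (simp add: d_def power2_eq_square algebra_simps)
      then show ?thesis using d0 by (simp add: field_simps power2_eq_square)
    qed
    also have "norm \<dots> \<le> norm (14 :: complex) + norm (12 / d) + norm (3 / d^2)"
      by (intro order.trans[OF norm_triangle_ineq] add_mono) auto
    also have "\<dots> \<le> 14 + 24 + 12"
    proof (intro add_mono)
      show "norm (12 / d) \<le> 24" using d d0 divide_left_mono[of "1/2" "norm d" 12] by (simp add: norm_divide)
      have "(1/2)^2 \<le> norm d^2" using d by (intro power_mono) auto
      then show "norm (3 / d^2) \<le> 12" using d d0 divide_left_mono[of "(1/2)^2" "norm d^2" 3]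
        by (simp add: norm_divide norm_power norm_mult power2_eq_square)
    qed simp
    finally have 2: "norm ((56 * w^2 - 32 * w + 5) / (2 * w - 1)^2) \<le> 50" by (simp add: d_def)
    have "norm (Gamma w ^ 3 * rGamma (3 * w + 1)) \<le> (1/2)^k * norm (q z)"
      using Gamma_ratio_bound[of "1 + z" k] Re[OF z'] by (simp add: w_def q_def)
    also have "\<dots> \<le> (1/2)^k * C" using C[OF z'] by (intro mult_left_mono) auto
    finally have 3: "norm (Gamma w ^ 3 * rGamma (3 * w + 1)) \<le> (1/2)^k * C" .
    show ?thesis unfolding w_def[symmetric] f6c_def norm_mult[of _ "Gamma w ^ 3 * _"] norm_mult[of "exp _"]
      using 1 2 3 by (intro mult_mono) auto
  qed
  have "summable (\<lambda>k. exp pi * 50 * ((1/2)^k * C))"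
    by (intro summable_mult summable_mult2 summable_geometric) simp
  then show ?thesis unfolding F6_def[abs_def]
    by (rule Weierstrass_m_test[rotated]) (use bound in auto)
qed

lemma partial_sums_holomorphic: "(\<lambda>z. \<Sum>k<n. f6c (1 + z + of_nat k)) holomorphic_on ball 0 (1/4)"
proof (intro holomorphic_on_sum)
  fix k
  have "(f6c \<circ> (\<lambda>z. 1 + z + of_nat k)) holomorphic_on ball 0 (1/4)"
  proof (rule holomorphic_on_compose_gen[OF _ holomorphic_f6c])
    show "(\<lambda>z::complex. 1 + z + of_nat k) ` ball 0 (1/4) \<subseteq> {z. Re z > 1/2}"
    proof safe
      fix z :: complex assume "z \<in> ball 0 (1/4)"
      then show "Re (1 + z + of_nat k) > 1/2" using abs_Re_le_cmod[of z] by auto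
    qed
  qed (intro holomorphic_intros)
  then show "(\<lambda>z. f6c (1 + z + of_nat k)) holomorphic_on ball 0 (1/4)" by (simp add: o_def)
qed

lemma F6_holomorphic: "F6 holomorphic_on ball 0 (1/4)"
proof (rule holomorphic_uniform_sequence[OF open_ball partial_sums_holomorphic])
  fix x :: complex assume "x \<in> ball 0 (1/4)"
  then obtain d where "d > 0" "cball x d \<subseteq> ball 0 (1/4)"
    by (metis open_ball open_contains_cball)
  then show "\<exists>d>0. cball x d \<subseteq> ball 0 (1/4) \<and>
      uniform_limit (cball x d) (\<lambda>n z. \<Sum>k<n. f6c (1 + z + of_nat k)) F6 sequentially"
    using uniform_limit_on_subset[OF F6_uniform_limit] by blast
qed

lemma higher_deriv_partial_sum:
  "(deriv ^^ m) (\<lambda>z. \<Sum>k<n. f6c (1 + z + of_nat k)) 0 = (\<Sum>k<n. (deriv ^^ m) f6c (of_nat (Suc k)))"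
proof (induction n)
  case (Suc n)
  have an: "(\<lambda>z. f6c (1 + z + of_nat n)) holomorphic_on ball 0 (1/4)"
  proof -
    have "(\<lambda>z. (\<Sum>k<Suc n. f6c (1 + z + of_nat k)) - (\<Sum>k<n. f6c (1 + z + of_nat k))) holomorphic_on ball 0 (1/4)"
      by (intro holomorphic_on_diff partial_sums_holomorphic)
    then show ?thesis by simp
  qed
  have "(deriv ^^ m) (\<lambda>z. (\<Sum>k<n. f6c (1 + z + of_nat k)) + f6c (1 + z + of_nat n)) 0
    = (deriv ^^ m) (\<lambda>z. \<Sum>k<n. f6c (1 + z + of_nat k)) 0 + (deriv ^^ m) (\<lambda>z. f6c (1 + z + of_nat n)) 0"
    by (rule higher_deriv_add[OF partial_sums_holomorphic an]) auto
  also have "(deriv ^^ m) (\<lambda>z. f6c (1 + z + of_nat n)) 0 = (deriv ^^ m) f6c (of_nat (Suc n))"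
    using higher_deriv_shift_0[of m f6c "of_nat (Suc n)"] by (simp add: o_def add_ac)
  finally show ?case using Suc by simp
qed simp

text \<open>Uniform convergence of holomorphic partial sums on a disc carries over to all
  derivatives at its centre, which yields convergence and value together.\<close>

lemma higher_vector_deriv_f6_sums:
  "(\<lambda>k. higher_vector_deriv m f6 (real (Suc k))) sums (deriv ^^ m) F6 0"
proof -
  have "(\<lambda>n. (deriv ^^ m) (\<lambda>z. \<Sum>k<n. f6c (1 + z + of_nat k)) 0) \<longlonglongrightarrow> (deriv ^^ m) F6 0"
    by (rule higher_deriv_complex_uniform_limit[OF F6_uniform_limit])
       (auto intro!: always_eventually partial_sums_holomorphic)
  then have "(\<lambda>k. (deriv ^^ m) f6c (of_nat (Suc k))) sums (deriv ^^ m) F6 0"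
    unfolding higher_deriv_partial_sum sums_def .
  moreover have "higher_vector_deriv m f6 (real (Suc k)) = (deriv ^^ m) f6c (of_nat (Suc k))" for k
    using higher_vector_deriv_f6[of "real (Suc k)" m] by simp
  ultimately show ?thesis by simp
qed

text \<open>The phase at 1 + t + k is -(-1)^k exp(pi i t): the sign matches the alternating series
  of \<open>g6\<close>, and the rest factors out.\<close>

lemma F6_of_real:
  assumes "-1/4 < t" "t < 1/4"
  shows "F6 (of_real t) = - exp (of_real pi * \<i> * of_real t) * of_real (4 * Gamma (1 + t)^2 * V (2 * t) t)"
proof -
  have "f6c (1 + of_real t + of_nat k) = - exp (of_real pi * \<i> * of_real t) * of_real ((-1)^k * g6 (1 + t + real k))" for k
  proof -
    have "1 + of_real t + of_nat k = complex_of_real (1 + t + real k)" by simp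
    then have "f6c (1 + of_real t + of_nat k) = exp (of_real pi * \<i> * of_real (1 + t + real k)) * of_real (g6 (1 + t + real k))"
      by (simp only: f6c_of_real)
    also have "of_real pi * \<i> * of_real (1 + t + real k) = of_real pi * \<i> * of_real t + (of_real pi * \<i> + of_nat k * (of_real pi * \<i>))"
      by (simp add: algebra_simps)
    also have "exp \<dots> = exp (of_real pi * \<i> * of_real t) * (exp (of_real pi * \<i>) * exp (of_real pi * \<i>) ^ k)"
      by (simp only: exp_add exp_of_nat_mult)
    also have "exp (of_real pi * \<i>) = -1" by simp
    finally show ?thesis by simp
  qed
  moreover have "(\<lambda>k. - exp (of_real pi * \<i> * of_real t) * complex_of_real ((-1)^k * g6 (1 + t + real k))) sums
     (- exp (of_real pi * \<i> * of_real t) * of_real (4 * Gamma (1 + t)^2 * V (2 * t) t))"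
    by (intro sums_mult sums_of_real g6_series_eq_V assms)
  ultimately show ?thesis by (simp add: F6_def sums_iff)
qed

section \<open>Power series expansions\<close>

text \<open>If the order of vanishing d were below N, then f / z^d would tend to a nonzero
  coefficient, whereas the bound forces the limit 0 along the negative reals.\<close>

lemma has_fps_expansion_eq_0:
  fixes f :: "complex \<Rightarrow> complex"
  assumes f: "f has_fps_expansion F"
    and bound: "\<And>t. -1/4 < t \<Longrightarrow> t < 0 \<Longrightarrow> norm (f (of_real t)) \<le> K * \<bar>t\<bar>^N"
    and k: "k < N"
  shows "fps_nth F k = 0"
proof (cases "F = 0")
  case False
  define d where "d = subdegree F"
  have "d \<ge> N"
  proof (rule ccontr)
    assume "\<not> d \<ge> N"
    then have d: "d < N" by simp
    have F: "fps_nth F d \<noteq> 0" unfolding d_def using False by (rule nth_subdegree_nonzero)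
    define g where "g = (\<lambda>x. if x = 0 then fps_nth F d else f x / x ^ d)"
    have "g has_fps_expansion fps_shift d F"
      unfolding g_def by (rule has_fps_expansion_shift[OF f]) (simp_all add: d_def)
    then have "(g \<longlongrightarrow> fps_nth F d) (nhds 0)"
      using has_fps_expansion_imp_tendsto_0 by fastforce
    moreover have "((\<lambda>t. complex_of_real t) \<longlongrightarrow> 0) (at_left 0)"
      by (auto intro!: tendsto_eq_intros)
    ultimately have "((\<lambda>t. g (complex_of_real t)) \<longlongrightarrow> fps_nth F d) (at_left 0)"
      by (rule filterlim_compose)
    then have lim: "((\<lambda>t. norm (g (complex_of_real t))) \<longlongrightarrow> norm (fps_nth F d)) (at_left 0)"
      by (rule tendsto_norm)
    have "((\<lambda>t::real. K * \<bar>t\<bar>^(N - d)) \<longlongrightarrow> K * \<bar>0\<bar>^(N - d)) (at_left 0)"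
      by (intro tendsto_mult tendsto_const tendsto_power tendsto_rabs tendsto_ident_at)
    then have lim0: "((\<lambda>t::real. K * \<bar>t\<bar>^(N - d)) \<longlongrightarrow> 0) (at_left 0)" using d by (simp add: power_0_left)
    have "eventually (\<lambda>t::real. t \<in> {-1/4<..<0}) (at_left 0)"
      by (rule eventually_at_left_real) simp
    then have "eventually (\<lambda>t. norm (g (complex_of_real t)) \<le> K * \<bar>t\<bar>^(N - d)) (at_left 0)"
    proof eventually_elim
      case (elim t)
      then have t: "-1/4 < t" "t < 0" by auto
      have "norm (g (complex_of_real t)) = norm (f (of_real t)) / \<bar>t\<bar>^d"
        using t by (simp add: g_def norm_divide norm_power)
      also have "\<dots> \<le> (K * \<bar>t\<bar>^N) / \<bar>t\<bar>^d" using bound[OF t] by (intro divide_right_mono) auto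
      also have "\<dots> = K * \<bar>t\<bar>^(N - d)" using d t by (simp add: power_diff)
      finally show ?case .
    qed
    then have "norm (fps_nth F d) \<le> 0"
      using tendsto_le[OF _ lim0 lim] by simp
    with F show False by simp
  qed
  with k show ?thesis by (intro nth_less_subdegree_zero) (simp add: d_def)
qed simp

text \<open>Turns a logarithmic derivative into an equation of formal power series, which computes
  the coefficients of Gamma quotients recursively from those of digamma functions.\<close>

lemma fps_deriv_eq_mult_logderiv:
  fixes f g :: "complex \<Rightarrow> complex"
  assumes f: "f has_fps_expansion F" and g: "g has_fps_expansion G" and r: "r > 0"
    and d: "\<And>z. z \<in> ball 0 r \<Longrightarrow> (f has_field_derivative f z * g z) (at z)"
  shows "fps_deriv F = F * G"
proof -
  have "deriv f has_fps_expansion fps_deriv F" by (rule has_fps_expansion_deriv[OF f])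
  moreover have "eventually (\<lambda>z. z \<in> ball 0 r) (nhds (0::complex))"
    using r by (intro eventually_nhds_in_open) auto
  then have "eventually (\<lambda>z. deriv f z = f z * g z) (nhds 0)"
    by eventually_elim (rule DERIV_imp_deriv[OF d])
  ultimately have "(\<lambda>z. f z * g z) has_fps_expansion fps_deriv F"
    by (subst (asm) has_fps_expansion_cong[OF _ refl]) auto
  then show ?thesis using has_fps_expansion_mult[OF f g] fps_expansion_unique_complex by blast
qed

section \<open>Taylor series of polygamma functions\<close>

definition Polygamma_fps :: "nat \<Rightarrow> complex \<Rightarrow> complex fps" where
  "Polygamma_fps m c = Abs_fps (\<lambda>n. c ^ n * Polygamma (m + n) 1 / fact n)"

lemma DERIV_compose_1_plus:
  fixes f :: "complex \<Rightarrow> complex"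
  assumes "(f has_field_derivative D) (at (1 + c * z))"
  shows "((\<lambda>z. f (1 + c * z)) has_field_derivative D * c) (at z)"
  by (rule DERIV_chain2[where g = "\<lambda>z. 1 + c * z", OF assms]) (auto intro!: derivative_eq_intros)

lemma not_nonpos_Ints_1_plus:
  fixes c z :: complex
  assumes "norm (c * z) < 1"
  shows "1 + c * z \<notin> \<int>\<^sub>\<le>\<^sub>0"
  using assms abs_Re_le_cmod[of "c * z"] by (intro not_nonpos_Ints_Re) auto

lemma higher_deriv_Polygamma_linear:
  fixes c z :: complex
  assumes "norm c * r \<le> 1" "z \<in> ball 0 r"
  shows "(deriv ^^ n) (\<lambda>z. Polygamma m (1 + c * z)) z = c ^ n * Polygamma (m + n) (1 + c * z)"
  using assms(2)
proof (induction n arbitrary: z)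
  case (Suc n)
  have ev: "eventually (\<lambda>z. z \<in> ball 0 r) (nhds z)"
    using Suc.prems by (intro eventually_nhds_in_open) auto
  have nz: "1 + c * z \<notin> \<int>\<^sub>\<le>\<^sub>0"
  proof (rule not_nonpos_Ints_1_plus)
    have z: "norm z < r" using Suc.prems by simp
    show "norm (c * z) < 1"
    proof (cases "c = 0")
      case False
      then have "norm c * norm z < norm c * r" using z by simp
      then show ?thesis using assms(1) by (simp add: norm_mult)
    qed simp
  qed
  have "(deriv ^^ Suc n) (\<lambda>z. Polygamma m (1 + c * z)) z = deriv (\<lambda>z. c ^ n * Polygamma (m + n) (1 + c * z)) z"
    using ev by (auto intro!: deriv_cong_ev elim!: eventually_mono simp: Suc.IH)
  also have "\<dots> = c ^ Suc n * Polygamma (m + Suc n) (1 + c * z)"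
    using DERIV_cmult[OF DERIV_compose_1_plus[OF has_field_derivative_Polygamma[OF nz, of "m + n"]], of "c ^ n"]
    by (intro DERIV_imp_deriv) (simp add: mult_ac)
  finally show ?case .
qed simp

lemma Polygamma_has_fps_expansion:
  "(\<lambda>z. Polygamma m (1 + c * z)) has_fps_expansion Polygamma_fps m c"
proof -
  define r where "r = 1 / (norm c + 1)"
  have r: "r > 0" by (simp add: r_def add_nonneg_pos)
  have cr: "norm c * r \<le> 1" by (simp add: r_def divide_le_eq add_nonneg_pos)
  have nz: "1 + c * z \<notin> \<int>\<^sub>\<le>\<^sub>0" if "z \<in> ball 0 r" for z
  proof (rule not_nonpos_Ints_1_plus)
    have "norm c * norm z \<le> norm c * r" using that by (intro mult_left_mono) auto
    also have "\<dots> < 1" by (simp add: r_def divide_less_eq add_nonneg_pos)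
    finally show "norm (c * z) < 1" by (simp add: norm_mult)
  qed
  have "(\<lambda>z. Polygamma m (1 + c * z)) holomorphic_on ball 0 r"
  proof -
    have "(\<lambda>z. Polygamma m (1 + c * z)) field_differentiable at z" if "z \<in> ball 0 r" for z
      using DERIV_compose_1_plus[OF has_field_derivative_Polygamma[OF nz[OF that], of m]]
      unfolding field_differentiable_def by blast
    then show ?thesis by (auto simp: holomorphic_on_def intro: field_differentiable_at_within)
  qed
  then have "(\<lambda>z. Polygamma m (1 + c * z)) has_fps_expansion fps_expansion (\<lambda>z. Polygamma m (1 + c * z)) 0"
    using r by (intro has_fps_expansion_fps_expansion[of "ball 0 r"]) auto
  also have "fps_expansion (\<lambda>z. Polygamma m (1 + c * z)) 0 = Polygamma_fps m c"
    using higher_deriv_Polygamma_linear[OF cr, of 0] r by (simp add: fps_expansion_def Polygamma_fps_def fps_eq_iff)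
  finally show ?thesis .
qed

definition zetac :: "nat \<Rightarrow> complex" where "zetac k = of_real (zetar k)"

lemma Polygamma_at_1:
  assumes "n \<ge> 1"
  shows "Polygamma n (1::complex) = (-1)^(n + 1) * fact n * zetac (n + 1)"
proof -
  have "(\<lambda>k. inverse ((1 + of_nat k :: complex) ^ Suc n)) sums ((-1) ^ Suc n * Polygamma n 1 / fact n)"
    using assms by (intro Polygamma_LIMSEQ) auto
  moreover have "(\<lambda>k. inverse ((1 + of_nat k :: complex) ^ Suc n)) sums zetac (n + 1)"
  proof -
    have "(\<lambda>k. 1 / (real k + 1)^(n+1)) sums zetar (n+1)"
      unfolding zetar_def using assms by (intro summable_sums summable_on_imp_summable summable_on_zetar) auto
    from sums_of_real[OF this, where 'a = complex] show ?thesis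
      by (simp add: zetac_def inverse_eq_divide add_ac)
  qed
  ultimately have "zetac (n + 1) = (-1) ^ Suc n * Polygamma n 1 / fact n" by (rule sums_unique2[rotated])
  then have "(-1)^(n + 1) * fact n * zetac (n + 1) = ((-1)^(n+1) * (-1)^(n+1)) * Polygamma n 1"
    by simp
  also have "(-1)^(n+1) * (-1)^(n+1) = (1::complex)" by (simp flip: power_mult_distrib)
  finally show ?thesis by simp
qed

text \<open>The first formula starts at n = 1 because the constant term is Digamma(1), minus the
  Euler-Mascheroni constant, and not a zeta value.\<close>

lemma Polygamma_fps_nth:
  "n \<ge> 1 \<Longrightarrow> fps_nth (Polygamma_fps 0 c) n = c ^ n * (-1)^(n + 1) * zetac (n + 1)"
  "fps_nth (Polygamma_fps 2 c) n = c ^ n * (-1)^(n + 1) * (of_nat (n + 1) * of_nat (n + 2)) * zetac (n + 3)"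
proof -
  show "n \<ge> 1 \<Longrightarrow> fps_nth (Polygamma_fps 0 c) n = c ^ n * (-1)^(n + 1) * zetac (n + 1)"
    by (simp add: Polygamma_fps_def Polygamma_at_1)
  have "fact (n + 2) = (of_nat (n + 1) * of_nat (n + 2)) * (fact n :: complex)" by (simp add: algebra_simps)
  then show "fps_nth (Polygamma_fps 2 c) n = c ^ n * (-1)^(n + 1) * (of_nat (n + 1) * of_nat (n + 2)) * zetac (n + 3)"
    using Polygamma_at_1[of "2 + n"]
    by (simp add: Polygamma_fps_def add_ac del: fact_Suc of_nat_Suc of_nat_add) (simp add: add_ac numeral_3_eq_3)
qed

text \<open>\<open>F6\<close> with the phase removed. At real t near 0 it equals
  \<open>4 * Gamma (1 + t)^2 * V (2 * t) t\<close>, the unknown in \<open>psi6\<close>.\<close>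

definition T6 :: "complex \<Rightarrow> complex" where
  "T6 z = - F6 z * exp (- (of_real pi * \<i>) * z)"

section \<open>The three Gamma quotients of the asymptotic identity\<close>

definition cC :: "complex \<Rightarrow> complex" where "cC z = Gamma (1 + z)^2 * rGamma (1 - z) * rGamma (1 + 3 * z)"
definition cE :: "complex \<Rightarrow> complex" where "cE z = Gamma (1 + z)^2 * rGamma (1 + 2 * z)"
definition cP :: "complex \<Rightarrow> complex" where "cP z = Gamma (1 + z) * Gamma (1 - z)"

lemma ball_shift_not_nonpos:
  fixes c z :: complex
  assumes "z \<in> ball 0 (1/4)" "norm c \<le> 4"
  shows "1 + c * z \<notin> \<int>\<^sub>\<le>\<^sub>0"
proof (rule not_nonpos_Ints_1_plus)
  have "norm c * norm z \<le> 4 * norm z" using assms by (intro mult_right_mono) auto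
  also have "\<dots> < 1" using assms by simp
  finally show "norm (c * z) < 1" by (simp add: norm_mult)
qed

text \<open>The arguments are written as \<open>1 + 1 * z\<close> and \<open>1 + (-1) * z\<close> so
  that they match the shape \<open>1 + c * z\<close> of the polygamma expansions literally.\<close>

lemma has_field_derivative_cCEP:
  assumes z: "z \<in> ball 0 (1/4)"
  shows "(cC has_field_derivative cC z * (2 * Digamma (1 + 1 * z) + Digamma (1 + (-1) * z) - 3 * Digamma (1 + 3 * z))) (at z)"
    and "(cE has_field_derivative cE z * (2 * Digamma (1 + 1 * z) - 2 * Digamma (1 + 2 * z))) (at z)"
    and "(cP has_field_derivative cP z * (Digamma (1 + 1 * z) - Digamma (1 + (-1) * z))) (at z)"
proof -
  have n: "1 + z \<notin> \<int>\<^sub>\<le>\<^sub>0" "1 - z \<notin> \<int>\<^sub>\<le>\<^sub>0" "1 + 2 * z \<notin> \<int>\<^sub>\<le>\<^sub>0" "1 + 3 * z \<notin> \<int>\<^sub>\<le>\<^sub>0"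
    using ball_shift_not_nonpos[OF z, of 1] ball_shift_not_nonpos[OF z, of "-1"]
      ball_shift_not_nonpos[OF z, of 2] ball_shift_not_nonpos[OF z, of 3] by simp_all
  note G = DERIV_compose_1_plus[OF has_field_derivative_Gamma]
  note R = DERIV_compose_1_plus[OF has_field_derivative_rGamma_no_nonpos_int]
  have g: "((\<lambda>z. Gamma (1 + z)) has_field_derivative Gamma (1 + z) * Digamma (1 + z)) (at z)"
    using G[of 1 z] n by simp
  have gm: "((\<lambda>z. Gamma (1 - z)) has_field_derivative - (Gamma (1 - z) * Digamma (1 - z))) (at z)"
    using G[of "-1" z] n by simp
  have rm: "((\<lambda>z. rGamma (1 - z)) has_field_derivative (rGamma (1 - z) * Digamma (1 - z))) (at z)"
    using R[of "-1" z] n by simp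
  have r2: "((\<lambda>z. rGamma (1 + 2 * z)) has_field_derivative - (2 * rGamma (1 + 2 * z) * Digamma (1 + 2 * z))) (at z)"
    using R[of 2 z] n by (simp add: mult_ac)
  have r3: "((\<lambda>z. rGamma (1 + 3 * z)) has_field_derivative - (3 * rGamma (1 + 3 * z) * Digamma (1 + 3 * z))) (at z)"
    using R[of 3 z] n by (simp add: mult_ac)
  have g2: "((\<lambda>z. Gamma (1 + z)^2) has_field_derivative 2 * Gamma (1 + z)^2 * Digamma (1 + z)) (at z)"
    using DERIV_mult[OF g g] by (simp add: power2_eq_square algebra_simps)
  show "(cC has_field_derivative cC z * (2 * Digamma (1 + 1 * z) + Digamma (1 + (-1) * z) - 3 * Digamma (1 + 3 * z))) (at z)"
    using DERIV_mult[OF DERIV_mult[OF g2 rm] r3] unfolding cC_def[abs_def] by (simp add: algebra_simps)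
  show "(cE has_field_derivative cE z * (2 * Digamma (1 + 1 * z) - 2 * Digamma (1 + 2 * z))) (at z)"
    using DERIV_mult[OF g2 r2] unfolding cE_def[abs_def] by (simp add: algebra_simps)
  show "(cP has_field_derivative cP z * (Digamma (1 + 1 * z) - Digamma (1 + (-1) * z))) (at z)"
    using DERIV_mult[OF g gm] unfolding cP_def[abs_def] by (simp add: algebra_simps)
qed

abbreviation "fC \<equiv> fps_expansion cC 0"
abbreviation "fE \<equiv> fps_expansion cE 0"
abbreviation "fP \<equiv> fps_expansion cP 0"
abbreviation "fT \<equiv> fps_expansion T6 0"
abbreviation "fF \<equiv> fps_expansion F6 0"

lemma has_fps_expansion_cCEP: "cC has_fps_expansion fC" "cE has_fps_expansion fE" "cP has_fps_expansion fP"
  by (rule has_fps_expansion_fps_expansion[of "ball 0 (1/4)"];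
      (auto intro!: holomorphic_on_open[THEN iffD2] exI has_field_derivative_cCEP simp del: mult_1 mult_1_left mult_minus1)?)+

lemma fps_deriv_cCEP:
  "fps_deriv fC = fC * (fps_const 2 * Polygamma_fps 0 1 + Polygamma_fps 0 (-1) - fps_const 3 * Polygamma_fps 0 3)"
  "fps_deriv fE = fE * (fps_const 2 * Polygamma_fps 0 1 - fps_const 2 * Polygamma_fps 0 2)"
  "fps_deriv fP = fP * (Polygamma_fps 0 1 - Polygamma_fps 0 (-1))"
proof -
  note P = Polygamma_has_fps_expansion[of 0]
  note r = zero_less_divide_1_iff[of "4::real", THEN iffD2, OF zero_less_numeral]
  show "fps_deriv fC = fC * (fps_const 2 * Polygamma_fps 0 1 + Polygamma_fps 0 (-1) - fps_const 3 * Polygamma_fps 0 3)"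
    by (rule fps_deriv_eq_mult_logderiv[OF has_fps_expansion_cCEP(1)
        has_fps_expansion_diff[OF has_fps_expansion_add[OF has_fps_expansion_mult[OF has_fps_expansion_const P] P]
           has_fps_expansion_mult[OF has_fps_expansion_const P]] r has_field_derivative_cCEP(1)])
  show "fps_deriv fE = fE * (fps_const 2 * Polygamma_fps 0 1 - fps_const 2 * Polygamma_fps 0 2)"
    by (rule fps_deriv_eq_mult_logderiv[OF has_fps_expansion_cCEP(2)
        has_fps_expansion_diff[OF has_fps_expansion_mult[OF has_fps_expansion_const P]
           has_fps_expansion_mult[OF has_fps_expansion_const P]] r has_field_derivative_cCEP(2)])
  show "fps_deriv fP = fP * (Polygamma_fps 0 1 - Polygamma_fps 0 (-1))"
    by (rule fps_deriv_eq_mult_logderiv[OF has_fps_expansion_cCEP(3) has_fps_expansion_diff[OF P P] r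
        has_field_derivative_cCEP(3)])
qed

lemma fps_cCEP_nth_0: "fps_nth fC 0 = 1" "fps_nth fE 0 = 1" "fps_nth fP 0 = 1"
  by (simp_all add: fps_expansion_def cC_def cE_def cP_def)

text \<open>The reflection formula in the form Gamma(1 + z) Gamma(1 - z) sin(pi z) = pi z. It
  expresses the coefficients of \<open>fP\<close> by powers of pi, independently of the logarithmic
  derivative.\<close>

lemma fP_times_sin: "fP * fps_sin (of_real pi) = fps_const (of_real pi) * fps_X"
proof -
  have "(\<lambda>z. cP z * sin (of_real pi * z)) has_fps_expansion fP * fps_sin (of_real pi)"
    by (intro has_fps_expansion_mult has_fps_expansion_cCEP has_fps_expansion_sin)
  moreover have "eventually (\<lambda>z. cP z * sin (of_real pi * z) = of_real pi * z) (nhds 0)"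
  proof -
    have "eventually (\<lambda>z::complex. z \<in> ball 0 (1/4)) (nhds 0)" by (intro eventually_nhds_in_open) auto
    then show ?thesis
    proof eventually_elim
      case (elim z)
      have "1 + z \<notin> \<int>\<^sub>\<le>\<^sub>0" "1 - z \<notin> \<int>\<^sub>\<le>\<^sub>0"
        using ball_shift_not_nonpos[OF elim, of 1] ball_shift_not_nonpos[OF elim, of "-1"] by simp_all
      then have G: "Gamma (1 + z) * rGamma (1 + z) = 1" "Gamma (1 - z) * rGamma (1 - z) = 1"
        by (simp_all add: rGamma_inverse_Gamma Gamma_eq_zero_iff)
      have "z * rGamma (1 + z) * rGamma (1 - z) = sin (of_real pi * z) / of_real pi"
        using rGamma_plus1[of z] rGamma_reflection_complex[of z] by (simp add: add_ac)
      then have "sin (of_real pi * z) = of_real pi * (z * rGamma (1 + z) * rGamma (1 - z))" by simp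
      then have "cP z * sin (of_real pi * z) = of_real pi * z * (Gamma (1 + z) * rGamma (1 + z)) * (Gamma (1 - z) * rGamma (1 - z))"
        by (simp add: cP_def mult_ac)
      then show ?case by (simp only: G mult_1_right)
    qed
  qed
  ultimately have "(\<lambda>z. of_real pi * z) has_fps_expansion fP * fps_sin (of_real pi)"
    by (subst (asm) has_fps_expansion_cong[OF _ refl]) auto
  moreover have "(\<lambda>z::complex. of_real pi * z) has_fps_expansion fps_const (of_real pi) * fps_X"
    by (intro has_fps_expansion_mult has_fps_expansion_const has_fps_expansion_fps_X)
  ultimately show ?thesis by (rule fps_expansion_unique_complex)
qed

lemma has_fps_expansion_F6: "F6 has_fps_expansion fF"
  by (rule has_fps_expansion_fps_expansion[OF _ _ F6_holomorphic]) auto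

lemma has_fps_expansion_T6: "T6 has_fps_expansion fT"
  by (rule has_fps_expansion_fps_expansion[of "ball 0 (1/4)"])
     (auto simp: T6_def[abs_def] intro!: holomorphic_intros F6_holomorphic)

lemma fF_eq: "fF = - (fT * fps_exp (of_real pi * \<i>))"
proof -
  have "(\<lambda>z. - (T6 z * exp (of_real pi * \<i> * z))) has_fps_expansion - (fT * fps_exp (of_real pi * \<i>))"
    by (intro has_fps_expansion_minus has_fps_expansion_mult has_fps_expansion_T6 has_fps_expansion_exp)
  also have "(\<lambda>z. - (T6 z * exp (of_real pi * \<i> * z))) = F6"
  proof
    fix z
    have "exp (- (of_real pi * \<i>) * z) * exp (of_real pi * \<i> * z) = 1" by (simp flip: exp_add)
    then show "- (T6 z * exp (of_real pi * \<i> * z)) = F6 z" by (simp add: T6_def mult.assoc)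
  qed
  finally show ?thesis using has_fps_expansion_F6 fps_expansion_unique_complex by blast
qed

lemma higher_vector_deriv_f6_suminf:
  "summable (\<lambda>k. higher_vector_deriv m f6 (real (Suc k)))"
  "(\<Sum>k. higher_vector_deriv m f6 (real (Suc k))) = fact m * fps_nth fF m"
  using higher_vector_deriv_f6_sums[of m] by (auto simp: sums_iff fps_expansion_def)

section \<open>The asymptotic identity as a formal power series\<close>

definition dcoef :: "nat \<Rightarrow> nat \<Rightarrow> complex" where
  "dcoef p q = of_real ((-1)^p * ((real p + 1) * (real p + 2) / 2) * ((-1)^q * (real q + 1)) * mzv2 (2 + q) (3 + p))"

definition D6c :: "complex \<Rightarrow> complex" where
  "D6c z = (\<Sum>p<5. \<Sum>q<5. dcoef p q * z^(p + q))"

definition fD :: "complex fps" where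
  "fD = (\<Sum>p<5. \<Sum>q<5. fps_const (dcoef p q) * fps_X^(p + q))"

lemma D6c_of_real: "D6c (of_real t) = of_real (D6_poly t)"
  by (simp add: D6c_def D6_poly_def dcoef_def power_add mult_ac)

lemma D6c_has_fps_expansion: "D6c has_fps_expansion fD"
  unfolding D6c_def[abs_def] fD_def
  by (intro has_fps_expansion_sum has_fps_expansion_mult has_fps_expansion_const has_fps_expansion_fps_X_power)

text \<open>Since the second derivative of the digamma function at x is -2 zeta(3, x), this is the
  Hurwitz zeta value zeta(3, 1 + c z), holomorphic near z = 0.\<close>

definition h3c :: "complex \<Rightarrow> complex \<Rightarrow> complex" where
  "h3c c z = - 1 / 2 * Polygamma 2 (1 + c * z)"

definition fh :: "complex \<Rightarrow> complex fps" where
  "fh c = fps_const (- 1 / 2) * Polygamma_fps 2 c"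

lemma h3c_has_fps_expansion: "h3c c has_fps_expansion fh c"
  unfolding h3c_def[abs_def] fh_def
  by (intro has_fps_expansion_mult has_fps_expansion_const Polygamma_has_fps_expansion)

lemma fh_nth: "fps_nth (fh c) n = c^n * (-1)^n * (of_nat (n + 1) * of_nat (n + 2) / 2) * zetac (n + 3)"
  by (simp add: fh_def Polygamma_fps_nth)

lemma h3c_of_real:
  assumes "x > -1"
  shows "- 1 / 2 * Polygamma 2 (1 + complex_of_real x) = of_real (hurwitz3 x)"
proof -
  have "(\<lambda>k. inverse ((1 + x + real k) ^ Suc 2)) sums ((-1) ^ Suc 2 * Polygamma 2 (1 + x) / fact 2)"
    using assms by (intro Polygamma_LIMSEQ) auto
  then have "hurwitz3 x = - 1 / 2 * Polygamma 2 (1 + x)"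
    by (simp add: hurwitz3_def sums_iff numeral_3_eq_3 inverse_eq_divide add_ac)
  moreover have "Polygamma 2 (complex_of_real (1 + x)) = of_real (Polygamma 2 (1 + x))"
    using assms by (intro Polygamma_of_real) auto
  ultimately show ?thesis by simp
qed

abbreviation "pic \<equiv> complex_of_real pi"

text \<open>The holomorphic counterpart of \<open>psi6\<close>, regrouped into products of functions
  with known expansions, with the constants and powers of z pulled to the front.\<close>

definition Psi6 :: "complex \<Rightarrow> complex" where
  "Psi6 z = - (z * cC z) + 1 / (2 * pic) * sin ((2 * pic) * z) - 2 / pic * (z^3 * (sin (pic * z) * T6 z))
     + 8 / pic * (z^3 * (sin ((2 * pic) * z) * h3c 2 z))
     - 256 * (z * (cP z * (1 + z * (Digamma (1 + (-1) * z) - Digamma (1 + 1 * z))))) + 128 * (z * cE z)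
     + 128 / pic * sin (pic * z) - 256 / pic * (z^3 * (sin (pic * z) * h3c (-1) z))
     + 120 * (z^4 * (h3c 1 z - zetac 3)) - 96 * (z^6 * (D6c z - dcoef 0 0))"

definition fPsi :: "complex fps" where
  "fPsi = - (fps_X * fC) + fps_const (1 / (2 * pic)) * fps_sin (2 * pic) - fps_const (2 / pic) * (fps_X^3 * (fps_sin pic * fT))
     + fps_const (8 / pic) * (fps_X^3 * (fps_sin (2 * pic) * fh 2))
     - fps_const 256 * (fps_X * (fP * (fps_const 1 + fps_X * (Polygamma_fps 0 (-1) - Polygamma_fps 0 1)))) + fps_const 128 * (fps_X * fE)
     + fps_const (128 / pic) * fps_sin pic - fps_const (256 / pic) * (fps_X^3 * (fps_sin pic * fh (-1)))
     + fps_const 120 * (fps_X^4 * (fh 1 - fps_const (zetac 3))) - fps_const 96 * (fps_X^6 * (fD - fps_const (dcoef 0 0)))"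

lemma Psi6_has_fps_expansion: "Psi6 has_fps_expansion fPsi"
  unfolding Psi6_def[abs_def] fPsi_def
  by (intro has_fps_expansion_add has_fps_expansion_diff has_fps_expansion_minus has_fps_expansion_mult
      has_fps_expansion_const has_fps_expansion_fps_X_power has_fps_expansion_fps_X has_fps_expansion_sin
      has_fps_expansion_cCEP has_fps_expansion_T6 h3c_has_fps_expansion D6c_has_fps_expansion Polygamma_has_fps_expansion)

lemma hurwitz3_0: "hurwitz3 0 = zetar 3"
  by (simp add: hurwitz3_def zetar_def)

lemma Psi6_of_real:
  assumes t: "-1/4 < t" "t < 0"
  shows "Psi6 (of_real t) = of_real (psi6 t)"
proof -
  have G: "Gamma (complex_of_real x) = of_real (Gamma x)" "rGamma (complex_of_real x) = of_real (rGamma x)" for x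
    by (simp_all add: Gamma_complex_of_real rGamma_complex_of_real)
  have C: "cC (of_real t) = of_real (Gamma (1 + t)^2 / (Gamma (1 - t) * Gamma (1 + 3 * t)))"
    using G[of "1 + t"] G[of "1 - t"] G[of "1 + 3 * t"]
    by (simp add: cC_def rGamma_inverse_Gamma divide_inverse)
  have E: "cE (of_real t) = of_real (Gamma (1 + t)^2 / Gamma (1 + 2 * t))"
    using G[of "1 + t"] G[of "1 + 2 * t"] by (simp add: cE_def rGamma_inverse_Gamma divide_inverse)
  have P: "cP (of_real t) = of_real (Gamma (1 + t) * Gamma (1 - t))"
    using G[of "1 + t"] G[of "1 - t"] by (simp add: cP_def)
  have D: "Digamma (1 + (-1) * complex_of_real t) = of_real (Digamma (1 - t))"
      "Digamma (1 + 1 * complex_of_real t) = of_real (Digamma (1 + t))"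
    using Polygamma_of_real[of "1 - t" 0, where 'a = complex] Polygamma_of_real[of "1 + t" 0, where 'a = complex] t by simp_all
  have H: "h3c 2 (of_real t) = of_real (hurwitz3 (2 * t))" "h3c (-1) (of_real t) = of_real (hurwitz3 (-t))"
      "h3c 1 (of_real t) = of_real (hurwitz3 t)"
    using h3c_of_real[of "2 * t"] h3c_of_real[of "- t"] h3c_of_real[of t] t by (simp_all add: h3c_def)
  have T: "T6 (of_real t) = of_real (4 * Gamma (1 + t)^2 * V (2 * t) t)"
  proof -
    have "exp (pic * \<i> * of_real t) * exp (- (pic * \<i>) * of_real t) = 1" by (simp flip: exp_add)
    then have "of_real x * (exp (pic * \<i> * of_real t) * exp (- (pic * \<i>) * of_real t)) = complex_of_real x" for x
      by simp
    then show ?thesis using t by (simp add: T6_def F6_of_real mult_ac)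
  qed
  have S: "sin ((2 * pic) * of_real t) = of_real (sin (2 * pi * t))" "sin (pic * of_real t) = of_real (sin (pi * t))"
    by (simp_all add: sin_of_real[symmetric])
  have z3: "zetac 3 = of_real (hurwitz3 0)" by (simp add: zetac_def hurwitz3_0)
  have d0: "dcoef 0 0 = of_real (mzv2 2 3)" by (simp add: dcoef_def)
  show ?thesis
    unfolding Psi6_def C E P D H T S z3 d0 D6c_of_real psi6_def
    by (simp add: algebra_simps)
qed

lemma fPsi_nth: "n < 11 \<Longrightarrow> fps_nth fPsi n = 0"
proof -
  assume n: "n < 11"
  obtain K where K: "\<And>t. -1/4 < t \<Longrightarrow> t < 0 \<Longrightarrow> \<bar>psi6 t\<bar> \<le> K * \<bar>t\<bar>^11"
    using psi6_bound by blast
  show ?thesis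
    by (rule has_fps_expansion_eq_0[OF Psi6_has_fps_expansion _ n, of K]) (use K Psi6_of_real in auto)
qed

text \<open>The digamma difference is minus the logarithmic derivative of P, so the product
  collapses to P - z P' and its coefficients are those of \<open>fP\<close> multiplied by 1 -
  n.\<close>

lemma fP_Digamma: "fP * (fps_const 1 + fps_X * (Polygamma_fps 0 (-1) - Polygamma_fps 0 1)) = fP - fps_X * fps_deriv fP"
  unfolding fps_deriv_cCEP by (simp add: algebra_simps)

section \<open>Explicit Taylor coefficients\<close>

lemma fps_mult_nth_unroll:
  fixes A B :: "complex fps"
  shows
    "fps_nth (A * B) 0 = fps_nth A 0 * fps_nth B 0"
    "fps_nth (A * B) 1 = fps_nth A 0 * fps_nth B 1 + fps_nth A 1 * fps_nth B 0"
    "fps_nth (A * B) 2 = fps_nth A 0 * fps_nth B 2 + fps_nth A 1 * fps_nth B 1 + fps_nth A 2 * fps_nth B 0"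
    "fps_nth (A * B) 3 = fps_nth A 0 * fps_nth B 3 + fps_nth A 1 * fps_nth B 2 + fps_nth A 2 * fps_nth B 1 + fps_nth A 3 * fps_nth B 0"
    "fps_nth (A * B) 4 = fps_nth A 0 * fps_nth B 4 + fps_nth A 1 * fps_nth B 3 + fps_nth A 2 * fps_nth B 2 + fps_nth A 3 * fps_nth B 1 + fps_nth A 4 * fps_nth B 0"
    "fps_nth (A * B) 5 = fps_nth A 0 * fps_nth B 5 + fps_nth A 1 * fps_nth B 4 + fps_nth A 2 * fps_nth B 3 + fps_nth A 3 * fps_nth B 2 + fps_nth A 4 * fps_nth B 1 + fps_nth A 5 * fps_nth B 0"
    "fps_nth (A * B) 6 = fps_nth A 0 * fps_nth B 6 + fps_nth A 1 * fps_nth B 5 + fps_nth A 2 * fps_nth B 4 + fps_nth A 3 * fps_nth B 3 + fps_nth A 4 * fps_nth B 2 + fps_nth A 5 * fps_nth B 1 + fps_nth A 6 * fps_nth B 0"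
    "fps_nth (A * B) 7 = fps_nth A 0 * fps_nth B 7 + fps_nth A 1 * fps_nth B 6 + fps_nth A 2 * fps_nth B 5 + fps_nth A 3 * fps_nth B 4 + fps_nth A 4 * fps_nth B 3 + fps_nth A 5 * fps_nth B 2 + fps_nth A 6 * fps_nth B 1 + fps_nth A 7 * fps_nth B 0"
    "fps_nth (A * B) 8 = fps_nth A 0 * fps_nth B 8 + fps_nth A 1 * fps_nth B 7 + fps_nth A 2 * fps_nth B 6 + fps_nth A 3 * fps_nth B 5 + fps_nth A 4 * fps_nth B 4 + fps_nth A 5 * fps_nth B 3 + fps_nth A 6 * fps_nth B 2 + fps_nth A 7 * fps_nth B 1 + fps_nth A 8 * fps_nth B 0"
    "fps_nth (A * B) 9 = fps_nth A 0 * fps_nth B 9 + fps_nth A 1 * fps_nth B 8 + fps_nth A 2 * fps_nth B 7 + fps_nth A 3 * fps_nth B 6 + fps_nth A 4 * fps_nth B 5 + fps_nth A 5 * fps_nth B 4 + fps_nth A 6 * fps_nth B 3 + fps_nth A 7 * fps_nth B 2 + fps_nth A 8 * fps_nth B 1 + fps_nth A 9 * fps_nth B 0"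
    "fps_nth (A * B) 10 = fps_nth A 0 * fps_nth B 10 + fps_nth A 1 * fps_nth B 9 + fps_nth A 2 * fps_nth B 8 + fps_nth A 3 * fps_nth B 7 + fps_nth A 4 * fps_nth B 6 + fps_nth A 5 * fps_nth B 5 + fps_nth A 6 * fps_nth B 4 + fps_nth A 7 * fps_nth B 3 + fps_nth A 8 * fps_nth B 2 + fps_nth A 9 * fps_nth B 1 + fps_nth A 10 * fps_nth B 0"
  by (simp_all add: fps_mult_nth eval_nat_numeral)

lemma fps_sin_nth_unroll:
  fixes c :: complex
  shows
    "fps_nth (fps_sin c) 0 = 0"
    "fps_nth (fps_sin c) 1 = c"
    "fps_nth (fps_sin c) 2 = 0"
    "fps_nth (fps_sin c) 3 = - (c ^ 3 / 6)"
    "fps_nth (fps_sin c) 4 = 0"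
    "fps_nth (fps_sin c) 5 = c ^ 5 / 120"
    "fps_nth (fps_sin c) 6 = 0"
    "fps_nth (fps_sin c) 7 = - (c ^ 7 / 5040)"
    "fps_nth (fps_sin c) 8 = 0"
    "fps_nth (fps_sin c) 9 = c ^ 9 / 362880"
    "fps_nth (fps_sin c) 10 = 0"
  by (simp_all add: fps_sin_def fact_numeral)

lemma numeral_mult_cancel: "k * a = k * b \<Longrightarrow> k \<noteq> 0 \<Longrightarrow> a = (b :: complex)"
  by simp

lemma minus_two_mult_eq_0D: "0 = - 2 * (a - b) \<Longrightarrow> a = (b :: complex)"
  by simp

named_theorems fP_nths
named_theorems fC_nths
named_theorems fE_nths
named_theorems fT_nths

declare fps_cCEP_nth_0(3) [fP_nths] fps_cCEP_nth_0 [fC_nths, fE_nths]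

text \<open>Since the sine series starts with pi z, coefficient n + 1 of the product with
  \<open>fP\<close> contains coefficient n of \<open>fP\<close> linearly, and for n \<ge> 1 it must
  vanish. The coefficients of \<open>fP\<close> are found one after another in this way.\<close>

lemma fP_nth_1 [fP_nths]: "fps_nth fP 1 = 0"
proof -
  have "fps_nth (fP * fps_sin pic) 2 = pic * (fps_nth fP 1 - (0))"
    unfolding fps_mult_nth_unroll fps_sin_nth_unroll fps_cCEP_nth_0
    by (simp add: power_numeral_reduce field_simps del: One_nat_def)
  moreover have "fps_nth (fP * fps_sin pic) 2 = 0" unfolding fP_times_sin by simp
  ultimately show ?thesis by simp
qed

lemma fP_nth_2 [fP_nths]: "fps_nth fP 2 = 1 / 6 * pic ^ 2"
proof -
  have "fps_nth (fP * fps_sin pic) 3 = pic * (fps_nth fP 2 - (1 / 6 * pic ^ 2))"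
    unfolding fps_mult_nth_unroll fps_sin_nth_unroll fps_cCEP_nth_0 fP_nths
    by (simp add: power_numeral_reduce field_simps del: One_nat_def)
  moreover have "fps_nth (fP * fps_sin pic) 3 = 0" unfolding fP_times_sin by simp
  ultimately show ?thesis by simp
qed

lemma fP_nth_3 [fP_nths]: "fps_nth fP 3 = 0"
proof -
  have "fps_nth (fP * fps_sin pic) 4 = pic * (fps_nth fP 3 - (0))"
    unfolding fps_mult_nth_unroll fps_sin_nth_unroll fps_cCEP_nth_0 fP_nths
    by (simp add: power_numeral_reduce field_simps del: One_nat_def)
  moreover have "fps_nth (fP * fps_sin pic) 4 = 0" unfolding fP_times_sin by simp
  ultimately show ?thesis by simp
qed

lemma fP_nth_4 [fP_nths]: "fps_nth fP 4 = 7 / 360 * pic ^ 4"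
proof -
  have "fps_nth (fP * fps_sin pic) 5 = pic * (fps_nth fP 4 - (7 / 360 * pic ^ 4))"
    unfolding fps_mult_nth_unroll fps_sin_nth_unroll fps_cCEP_nth_0 fP_nths
    by (simp add: power_numeral_reduce field_simps del: One_nat_def)
  moreover have "fps_nth (fP * fps_sin pic) 5 = 0" unfolding fP_times_sin by simp
  ultimately show ?thesis by simp
qed

lemma fP_nth_5 [fP_nths]: "fps_nth fP 5 = 0"
proof -
  have "fps_nth (fP * fps_sin pic) 6 = pic * (fps_nth fP 5 - (0))"
    unfolding fps_mult_nth_unroll fps_sin_nth_unroll fps_cCEP_nth_0 fP_nths
    by (simp add: power_numeral_reduce field_simps del: One_nat_def)
  moreover have "fps_nth (fP * fps_sin pic) 6 = 0" unfolding fP_times_sin by simp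
  ultimately show ?thesis by simp
qed

lemma fP_nth_6 [fP_nths]: "fps_nth fP 6 = 31 / 15120 * pic ^ 6"
proof -
  have "fps_nth (fP * fps_sin pic) 7 = pic * (fps_nth fP 6 - (31 / 15120 * pic ^ 6))"
    unfolding fps_mult_nth_unroll fps_sin_nth_unroll fps_cCEP_nth_0 fP_nths
    by (simp add: power_numeral_reduce field_simps del: One_nat_def)
  moreover have "fps_nth (fP * fps_sin pic) 7 = 0" unfolding fP_times_sin by simp
  ultimately show ?thesis by simp
qed

lemma fP_nth_7 [fP_nths]: "fps_nth fP 7 = 0"
proof -
  have "fps_nth (fP * fps_sin pic) 8 = pic * (fps_nth fP 7 - (0))"
    unfolding fps_mult_nth_unroll fps_sin_nth_unroll fps_cCEP_nth_0 fP_nths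
    by (simp add: power_numeral_reduce field_simps del: One_nat_def)
  moreover have "fps_nth (fP * fps_sin pic) 8 = 0" unfolding fP_times_sin by simp
  ultimately show ?thesis by simp
qed

lemma fP_nth_8 [fP_nths]: "fps_nth fP 8 = 127 / 604800 * pic ^ 8"
proof -
  have "fps_nth (fP * fps_sin pic) 9 = pic * (fps_nth fP 8 - (127 / 604800 * pic ^ 8))"
    unfolding fps_mult_nth_unroll fps_sin_nth_unroll fps_cCEP_nth_0 fP_nths
    by (simp add: power_numeral_reduce field_simps del: One_nat_def)
  moreover have "fps_nth (fP * fps_sin pic) 9 = 0" unfolding fP_times_sin by simp
  ultimately show ?thesis by simp
qed

lemma fP_nth_9 [fP_nths]: "fps_nth fP 9 = 0"
proof -
  have "fps_nth (fP * fps_sin pic) 10 = pic * (fps_nth fP 9 - (0))"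
    unfolding fps_mult_nth_unroll fps_sin_nth_unroll fps_cCEP_nth_0 fP_nths
    by (simp add: power_numeral_reduce field_simps del: One_nat_def)
  moreover have "fps_nth (fP * fps_sin pic) 10 = 0" unfolding fP_times_sin by simp
  ultimately show ?thesis by simp
qed


text \<open>The three logarithmic derivatives. In each of them the multipliers of the digamma terms
  add up to 0, so the Euler-Mascheroni constant cancels.\<close>

definition fGP :: "complex fps" where "fGP = Polygamma_fps 0 1 - Polygamma_fps 0 (-1)"
definition fGC :: "complex fps" where "fGC = fps_const 2 * Polygamma_fps 0 1 + Polygamma_fps 0 (-1) - fps_const 3 * Polygamma_fps 0 3"
definition fGE :: "complex fps" where "fGE = fps_const 2 * Polygamma_fps 0 1 - fps_const 2 * Polygamma_fps 0 2"

lemma fGP_nth: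
  shows "fps_nth fGP 0 = 0"
    "fps_nth fGP 1 = 2 * zetac 2"
    "fps_nth fGP 2 = 0"
    "fps_nth fGP 3 = 2 * zetac 4"
    "fps_nth fGP 4 = 0"
    "fps_nth fGP 5 = 2 * zetac 6"
    "fps_nth fGP 6 = 0"
    "fps_nth fGP 7 = 2 * zetac 8"
    "fps_nth fGP 8 = 0"
  by (simp_all add: fGP_def Polygamma_fps_nth del: One_nat_def) (simp_all add: Polygamma_fps_def)?

lemma fGC_nth:
  shows "fps_nth fGC 0 = 0"
    "fps_nth fGC 1 = -8 * zetac 2"
    "fps_nth fGC 2 = 24 * zetac 3"
    "fps_nth fGC 3 = -80 * zetac 4"
    "fps_nth fGC 4 = 240 * zetac 5"
    "fps_nth fGC 5 = -728 * zetac 6"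
    "fps_nth fGC 6 = 2184 * zetac 7"
    "fps_nth fGC 7 = -6560 * zetac 8"
    "fps_nth fGC 8 = 19680 * zetac 9"
  by (simp_all add: fGC_def Polygamma_fps_nth del: One_nat_def) (simp_all add: Polygamma_fps_def)?

lemma fGE_nth:
  shows "fps_nth fGE 0 = 0"
    "fps_nth fGE 1 = -2 * zetac 2"
    "fps_nth fGE 2 = 6 * zetac 3"
    "fps_nth fGE 3 = -14 * zetac 4"
    "fps_nth fGE 4 = 30 * zetac 5"
    "fps_nth fGE 5 = -62 * zetac 6"
    "fps_nth fGE 6 = 126 * zetac 7"
    "fps_nth fGE 7 = -254 * zetac 8"
    "fps_nth fGE 8 = 510 * zetac 9"
  by (simp_all add: fGE_def Polygamma_fps_nth del: One_nat_def) (simp_all add: Polygamma_fps_def)?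

lemma fps_deriv_nths:
  "fps_nth (fps_deriv fP) n = fps_nth (fP * fGP) n"
  "fps_nth (fps_deriv fC) n = fps_nth (fC * fGC) n"
  "fps_nth (fps_deriv fE) n = fps_nth (fE * fGE) n"
  unfolding fGP_def fGC_def fGE_def fps_deriv_cCEP by (rule refl)+

text \<open>\<open>fP\<close> is now known in two ways, by reflection and by its logarithmic
  derivative; comparing them gives Euler's even zeta values. Replacing these by powers of pi gives
  later coefficients a normal form in pi, odd zeta values and \<open>dz\<close>.\<close>

lemma zetac_2: "zetac 2 = 1 / 6 * pic ^ 2"
  using fps_deriv_nths(1)[of 1]
  unfolding fps_mult_nth_unroll fGP_nth fP_nths
  by (simp add: fP_nths power_numeral_reduce field_simps del: One_nat_def)

lemma zetac_4: "zetac 4 = 1 / 90 * pic ^ 4"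
  using fps_deriv_nths(1)[of 3]
  unfolding fps_mult_nth_unroll fGP_nth fP_nths zetac_2
  by (simp add: fP_nths power_numeral_reduce field_simps del: One_nat_def)

lemma zetac_6: "zetac 6 = 1 / 945 * pic ^ 6"
  using fps_deriv_nths(1)[of 5]
  unfolding fps_mult_nth_unroll fGP_nth fP_nths zetac_2 zetac_4
  by (simp add: fP_nths power_numeral_reduce field_simps del: One_nat_def)

lemma zetac_8: "zetac 8 = 1 / 9450 * pic ^ 8"
  using fps_deriv_nths(1)[of 7]
  unfolding fps_mult_nth_unroll fGP_nth fP_nths zetac_2 zetac_4 zetac_6
  by (simp add: fP_nths power_numeral_reduce field_simps del: One_nat_def)

lemmas zetac_even = zetac_2 zetac_4 zetac_6 zetac_8

text \<open>Coefficient n - 1 of C' = C * G reads n c_n = sum of c_k g_(n-1-k), a recursion that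
  also serves for \<open>fE\<close>.\<close>

lemma fC_nth_1 [fC_nths]: "fps_nth fC 1 = 0"
proof (rule numeral_mult_cancel[of 1])
  have "1 * fps_nth fC 1 = fps_nth (fps_deriv fC) 0" by (simp add: numeral_2_eq_2[symmetric])
  also have "\<dots> = fps_nth (fC * fGC) 0" by (rule fps_deriv_nths)
  also have "\<dots> = 1 * (0)"
    unfolding fps_mult_nth_unroll fGC_nth fps_cCEP_nth_0 zetac_even
    by (simp add: power_numeral_reduce field_simps del: One_nat_def)
  finally show "1 * fps_nth fC 1 = 1 * (0)" .
qed simp

lemma fC_nth_2 [fC_nths]: "fps_nth fC 2 = - (2 / 3 * pic ^ 2)"
proof (rule numeral_mult_cancel[of 2])
  have "2 * fps_nth fC 2 = fps_nth (fps_deriv fC) 1" by (simp add: numeral_2_eq_2[symmetric])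
  also have "\<dots> = fps_nth (fC * fGC) 1" by (rule fps_deriv_nths)
  also have "\<dots> = 2 * (- (2 / 3 * pic ^ 2))"
    unfolding fps_mult_nth_unroll fGC_nth fps_cCEP_nth_0 fC_nths zetac_even
    by (simp add: power_numeral_reduce field_simps del: One_nat_def)
  finally show "2 * fps_nth fC 2 = 2 * (- (2 / 3 * pic ^ 2))" .
qed simp

lemma fC_nth_3 [fC_nths]: "fps_nth fC 3 = 8 * zetac 3"
proof (rule numeral_mult_cancel[of 3])
  have "3 * fps_nth fC 3 = fps_nth (fps_deriv fC) 2" by (simp add: numeral_2_eq_2[symmetric])
  also have "\<dots> = fps_nth (fC * fGC) 2" by (rule fps_deriv_nths)
  also have "\<dots> = 3 * (8 * zetac 3)"
    unfolding fps_mult_nth_unroll fGC_nth fps_cCEP_nth_0 fC_nths zetac_even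
    by (simp add: power_numeral_reduce field_simps del: One_nat_def)
  finally show "3 * fps_nth fC 3 = 3 * (8 * zetac 3)" .
qed simp

lemma fC_nth_4 [fC_nths]: "fps_nth fC 4 = 0"
proof (rule numeral_mult_cancel[of 4])
  have "4 * fps_nth fC 4 = fps_nth (fps_deriv fC) 3" by (simp add: numeral_2_eq_2[symmetric])
  also have "\<dots> = fps_nth (fC * fGC) 3" by (rule fps_deriv_nths)
  also have "\<dots> = 4 * (0)"
    unfolding fps_mult_nth_unroll fGC_nth fps_cCEP_nth_0 fC_nths zetac_even
    by (simp add: power_numeral_reduce field_simps del: One_nat_def)
  finally show "4 * fps_nth fC 4 = 4 * (0)" .
qed simp

lemma fC_nth_5 [fC_nths]: "fps_nth fC 5 = - (16 / 3 * pic ^ 2 * zetac 3) + 48 * zetac 5"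
proof (rule numeral_mult_cancel[of 5])
  have "5 * fps_nth fC 5 = fps_nth (fps_deriv fC) 4" by (simp add: numeral_2_eq_2[symmetric])
  also have "\<dots> = fps_nth (fC * fGC) 4" by (rule fps_deriv_nths)
  also have "\<dots> = 5 * (- (16 / 3 * pic ^ 2 * zetac 3) + 48 * zetac 5)"
    unfolding fps_mult_nth_unroll fGC_nth fps_cCEP_nth_0 fC_nths zetac_even
    by (simp add: power_numeral_reduce field_simps del: One_nat_def)
  finally show "5 * fps_nth fC 5 = 5 * (- (16 / 3 * pic ^ 2 * zetac 3) + 48 * zetac 5)" .
qed simp

lemma fC_nth_6 [fC_nths]: "fps_nth fC 6 = - (4 / 135 * pic ^ 6) + 32 * zetac 3 ^ 2"
proof (rule numeral_mult_cancel[of 6])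
  have "6 * fps_nth fC 6 = fps_nth (fps_deriv fC) 5" by (simp add: numeral_2_eq_2[symmetric])
  also have "\<dots> = fps_nth (fC * fGC) 5" by (rule fps_deriv_nths)
  also have "\<dots> = 6 * (- (4 / 135 * pic ^ 6) + 32 * zetac 3 ^ 2)"
    unfolding fps_mult_nth_unroll fGC_nth fps_cCEP_nth_0 fC_nths zetac_even
    by (simp add: power_numeral_reduce field_simps del: One_nat_def)
  finally show "6 * fps_nth fC 6 = 6 * (- (4 / 135 * pic ^ 6) + 32 * zetac 3 ^ 2)" .
qed simp

lemma fC_nth_7 [fC_nths]: "fps_nth fC 7 = - (32 * pic ^ 2 * zetac 5) + 312 * zetac 7"
proof (rule numeral_mult_cancel[of 7])
  have "7 * fps_nth fC 7 = fps_nth (fps_deriv fC) 6" by (simp add: numeral_2_eq_2[symmetric])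
  also have "\<dots> = fps_nth (fC * fGC) 6" by (rule fps_deriv_nths)
  also have "\<dots> = 7 * (- (32 * pic ^ 2 * zetac 5) + 312 * zetac 7)"
    unfolding fps_mult_nth_unroll fGC_nth fps_cCEP_nth_0 fC_nths zetac_even
    by (simp add: power_numeral_reduce field_simps del: One_nat_def)
  finally show "7 * fps_nth fC 7 = 7 * (- (32 * pic ^ 2 * zetac 5) + 312 * zetac 7)" .
qed simp

lemma fC_nth_8 [fC_nths]: "fps_nth fC 8 = - (10 / 567 * pic ^ 8) - 64 / 3 * pic ^ 2 * zetac 3 ^ 2 + 384 * zetac 3 * zetac 5"
proof (rule numeral_mult_cancel[of 8])
  have "8 * fps_nth fC 8 = fps_nth (fps_deriv fC) 7" by (simp add: numeral_2_eq_2[symmetric])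
  also have "\<dots> = fps_nth (fC * fGC) 7" by (rule fps_deriv_nths)
  also have "\<dots> = 8 * (- (10 / 567 * pic ^ 8) - 64 / 3 * pic ^ 2 * zetac 3 ^ 2 + 384 * zetac 3 * zetac 5)"
    unfolding fps_mult_nth_unroll fGC_nth fps_cCEP_nth_0 fC_nths zetac_even
    by (simp add: power_numeral_reduce field_simps del: One_nat_def)
  finally show "8 * fps_nth fC 8 = 8 * (- (10 / 567 * pic ^ 8) - 64 / 3 * pic ^ 2 * zetac 3 ^ 2 + 384 * zetac 3 * zetac 5)" .
qed simp

lemma fC_nth_9 [fC_nths]: "fps_nth fC 9 = - (32 / 135 * pic ^ 6 * zetac 3) - 208 * pic ^ 2 * zetac 7 + 256 / 3 * zetac 3 ^ 3 + 6560 / 3 * zetac 9"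
proof (rule numeral_mult_cancel[of 9])
  have "9 * fps_nth fC 9 = fps_nth (fps_deriv fC) 8" by (simp add: numeral_2_eq_2[symmetric])
  also have "\<dots> = fps_nth (fC * fGC) 8" by (rule fps_deriv_nths)
  also have "\<dots> = 9 * (- (32 / 135 * pic ^ 6 * zetac 3) - 208 * pic ^ 2 * zetac 7 + 256 / 3 * zetac 3 ^ 3 + 6560 / 3 * zetac 9)"
    unfolding fps_mult_nth_unroll fGC_nth fps_cCEP_nth_0 fC_nths zetac_even
    by (simp add: power_numeral_reduce field_simps del: One_nat_def)
  finally show "9 * fps_nth fC 9 = 9 * (- (32 / 135 * pic ^ 6 * zetac 3) - 208 * pic ^ 2 * zetac 7 + 256 / 3 * zetac 3 ^ 3 + 6560 / 3 * zetac 9)" .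
qed simp


lemma fE_nth_1 [fE_nths]: "fps_nth fE 1 = 0"
proof (rule numeral_mult_cancel[of 1])
  have "1 * fps_nth fE 1 = fps_nth (fps_deriv fE) 0" by (simp add: numeral_2_eq_2[symmetric])
  also have "\<dots> = fps_nth (fE * fGE) 0" by (rule fps_deriv_nths)
  also have "\<dots> = 1 * (0)"
    unfolding fps_mult_nth_unroll fGE_nth fps_cCEP_nth_0 zetac_even
    by (simp add: power_numeral_reduce field_simps del: One_nat_def)
  finally show "1 * fps_nth fE 1 = 1 * (0)" .
qed simp

lemma fE_nth_2 [fE_nths]: "fps_nth fE 2 = - (1 / 6 * pic ^ 2)"
proof (rule numeral_mult_cancel[of 2])
  have "2 * fps_nth fE 2 = fps_nth (fps_deriv fE) 1" by (simp add: numeral_2_eq_2[symmetric])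
  also have "\<dots> = fps_nth (fE * fGE) 1" by (rule fps_deriv_nths)
  also have "\<dots> = 2 * (- (1 / 6 * pic ^ 2))"
    unfolding fps_mult_nth_unroll fGE_nth fps_cCEP_nth_0 fE_nths zetac_even
    by (simp add: power_numeral_reduce field_simps del: One_nat_def)
  finally show "2 * fps_nth fE 2 = 2 * (- (1 / 6 * pic ^ 2))" .
qed simp

lemma fE_nth_3 [fE_nths]: "fps_nth fE 3 = 2 * zetac 3"
proof (rule numeral_mult_cancel[of 3])
  have "3 * fps_nth fE 3 = fps_nth (fps_deriv fE) 2" by (simp add: numeral_2_eq_2[symmetric])
  also have "\<dots> = fps_nth (fE * fGE) 2" by (rule fps_deriv_nths)
  also have "\<dots> = 3 * (2 * zetac 3)"
    unfolding fps_mult_nth_unroll fGE_nth fps_cCEP_nth_0 fE_nths zetac_even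
    by (simp add: power_numeral_reduce field_simps del: One_nat_def)
  finally show "3 * fps_nth fE 3 = 3 * (2 * zetac 3)" .
qed simp

lemma fE_nth_4 [fE_nths]: "fps_nth fE 4 = - (1 / 40 * pic ^ 4)"
proof (rule numeral_mult_cancel[of 4])
  have "4 * fps_nth fE 4 = fps_nth (fps_deriv fE) 3" by (simp add: numeral_2_eq_2[symmetric])
  also have "\<dots> = fps_nth (fE * fGE) 3" by (rule fps_deriv_nths)
  also have "\<dots> = 4 * (- (1 / 40 * pic ^ 4))"
    unfolding fps_mult_nth_unroll fGE_nth fps_cCEP_nth_0 fE_nths zetac_even
    by (simp add: power_numeral_reduce field_simps del: One_nat_def)
  finally show "4 * fps_nth fE 4 = 4 * (- (1 / 40 * pic ^ 4))" .
qed simp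

lemma fE_nth_5 [fE_nths]: "fps_nth fE 5 = - (1 / 3 * pic ^ 2 * zetac 3) + 6 * zetac 5"
proof (rule numeral_mult_cancel[of 5])
  have "5 * fps_nth fE 5 = fps_nth (fps_deriv fE) 4" by (simp add: numeral_2_eq_2[symmetric])
  also have "\<dots> = fps_nth (fE * fGE) 4" by (rule fps_deriv_nths)
  also have "\<dots> = 5 * (- (1 / 3 * pic ^ 2 * zetac 3) + 6 * zetac 5)"
    unfolding fps_mult_nth_unroll fGE_nth fps_cCEP_nth_0 fE_nths zetac_even
    by (simp add: power_numeral_reduce field_simps del: One_nat_def)
  finally show "5 * fps_nth fE 5 = 5 * (- (1 / 3 * pic ^ 2 * zetac 3) + 6 * zetac 5)" .
qed simp

lemma fE_nth_6 [fE_nths]: "fps_nth fE 6 = - (79 / 15120 * pic ^ 6) + 2 * zetac 3 ^ 2"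
proof (rule numeral_mult_cancel[of 6])
  have "6 * fps_nth fE 6 = fps_nth (fps_deriv fE) 5" by (simp add: numeral_2_eq_2[symmetric])
  also have "\<dots> = fps_nth (fE * fGE) 5" by (rule fps_deriv_nths)
  also have "\<dots> = 6 * (- (79 / 15120 * pic ^ 6) + 2 * zetac 3 ^ 2)"
    unfolding fps_mult_nth_unroll fGE_nth fps_cCEP_nth_0 fE_nths zetac_even
    by (simp add: power_numeral_reduce field_simps del: One_nat_def)
  finally show "6 * fps_nth fE 6 = 6 * (- (79 / 15120 * pic ^ 6) + 2 * zetac 3 ^ 2)" .
qed simp

lemma fE_nth_7 [fE_nths]: "fps_nth fE 7 = - (1 / 20 * pic ^ 4 * zetac 3) - pic ^ 2 * zetac 5 + 18 * zetac 7"
proof (rule numeral_mult_cancel[of 7])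
  have "7 * fps_nth fE 7 = fps_nth (fps_deriv fE) 6" by (simp add: numeral_2_eq_2[symmetric])
  also have "\<dots> = fps_nth (fE * fGE) 6" by (rule fps_deriv_nths)
  also have "\<dots> = 7 * (- (1 / 20 * pic ^ 4 * zetac 3) - pic ^ 2 * zetac 5 + 18 * zetac 7)"
    unfolding fps_mult_nth_unroll fGE_nth fps_cCEP_nth_0 fE_nths zetac_even
    by (simp add: power_numeral_reduce field_simps del: One_nat_def)
  finally show "7 * fps_nth fE 7 = 7 * (- (1 / 20 * pic ^ 4 * zetac 3) - pic ^ 2 * zetac 5 + 18 * zetac 7)" .
qed simp

lemma fE_nth_8 [fE_nths]: "fps_nth fE 8 = - (2339 / 1814400 * pic ^ 8) - 1 / 3 * pic ^ 2 * zetac 3 ^ 2 + 12 * zetac 3 * zetac 5"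
proof (rule numeral_mult_cancel[of 8])
  have "8 * fps_nth fE 8 = fps_nth (fps_deriv fE) 7" by (simp add: numeral_2_eq_2[symmetric])
  also have "\<dots> = fps_nth (fE * fGE) 7" by (rule fps_deriv_nths)
  also have "\<dots> = 8 * (- (2339 / 1814400 * pic ^ 8) - 1 / 3 * pic ^ 2 * zetac 3 ^ 2 + 12 * zetac 3 * zetac 5)"
    unfolding fps_mult_nth_unroll fGE_nth fps_cCEP_nth_0 fE_nths zetac_even
    by (simp add: power_numeral_reduce field_simps del: One_nat_def)
  finally show "8 * fps_nth fE 8 = 8 * (- (2339 / 1814400 * pic ^ 8) - 1 / 3 * pic ^ 2 * zetac 3 ^ 2 + 12 * zetac 3 * zetac 5)" .
qed simp

lemma fE_nth_9 [fE_nths]: "fps_nth fE 9 = - (79 / 7560 * pic ^ 6 * zetac 3) - 3 / 20 * pic ^ 4 * zetac 5 - 3 * pic ^ 2 * zetac 7 + 4 / 3 * zetac 3 ^ 3 + 170 / 3 * zetac 9"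
proof (rule numeral_mult_cancel[of 9])
  have "9 * fps_nth fE 9 = fps_nth (fps_deriv fE) 8" by (simp add: numeral_2_eq_2[symmetric])
  also have "\<dots> = fps_nth (fE * fGE) 8" by (rule fps_deriv_nths)
  also have "\<dots> = 9 * (- (79 / 7560 * pic ^ 6 * zetac 3) - 3 / 20 * pic ^ 4 * zetac 5 - 3 * pic ^ 2 * zetac 7 + 4 / 3 * zetac 3 ^ 3 + 170 / 3 * zetac 9)"
    unfolding fps_mult_nth_unroll fGE_nth fps_cCEP_nth_0 fE_nths zetac_even
    by (simp add: power_numeral_reduce field_simps del: One_nat_def)
  finally show "9 * fps_nth fE 9 = 9 * (- (79 / 7560 * pic ^ 6 * zetac 3) - 3 / 20 * pic ^ 4 * zetac 5 - 3 * pic ^ 2 * zetac 7 + 4 / 3 * zetac 3 ^ 3 + 170 / 3 * zetac 9)" .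
qed simp


lemma fh_nths:
  "fps_nth (fh c) 0 = 1 * c ^ 0 * zetac 3"
  "fps_nth (fh c) 1 = -3 * c ^ 1 * zetac 4"
  "fps_nth (fh c) 2 = 6 * c ^ 2 * zetac 5"
  "fps_nth (fh c) 3 = -10 * c ^ 3 * zetac 6"
  "fps_nth (fh c) 4 = 15 * c ^ 4 * zetac 7"
  "fps_nth (fh c) 5 = -21 * c ^ 5 * zetac 8"
  "fps_nth (fh c) 6 = 28 * c ^ 6 * zetac 9"
  by (simp_all add: fh_nth)

abbreviation "dz \<equiv> complex_of_real (mzv2 5 3)"

lemma fD_nth: "fps_nth fD n = (\<Sum>p<5. \<Sum>q<5. if n = p + q then dcoef p q else 0)"
  by (simp add: fD_def fps_sum_nth fps_X_power_nth if_distrib cong: if_cong)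

lemma fD_nths:
  "fps_nth fD 0 = dcoef 0 0"
  "fps_nth fD 1 = dcoef 0 1 + dcoef 1 0"
  "fps_nth fD 2 = dcoef 0 2 + dcoef 1 1 + dcoef 2 0"
  "fps_nth fD 3 = dcoef 0 3 + dcoef 1 2 + dcoef 2 1 + dcoef 3 0"
  "fps_nth fD 4 = dcoef 0 4 + dcoef 1 3 + dcoef 2 2 + dcoef 3 1 + dcoef 4 0"
  by (simp_all add: fD_nth eval_nat_numeral)

text \<open>Degree n of \<open>fD\<close> collects the \<open>dcoef p q\<close> with p + q = n.
  Their common sign is (-1)^n, and the sum is the combination evaluated in weight n + 5.\<close>

lemma fD_value_1: "fps_nth fD 1 = - (1 / 180 * pic ^ 6) + 2 * zetac 3 ^ 2"
proof -
  have "fps_nth fD 1 = of_real (- (2 * mzv2 3 3 + 3 * mzv2 2 4))"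
    by (simp add: fD_nths dcoef_def del: One_nat_def)
  also have "\<dots> = - (21/2 * zetac 6 - 3 * (zetac 2 * zetac 4) - 2 * (zetac 3)^2)"
    unfolding mzv2_weight_6 by (simp add: zetac_def)
  also have "\<dots> = - (1 / 180 * pic ^ 6) + 2 * zetac 3 ^ 2"
    unfolding zetac_even by (simp add: power_numeral_reduce field_simps del: One_nat_def)
  finally show ?thesis .
qed

lemma fD_value_2: "fps_nth fD 2 = - (1 / 15 * pic ^ 4 * zetac 3) + pic ^ 2 * zetac 5 + 3 * zetac 7"
proof -
  have "fps_nth fD 2 = of_real (3 * mzv2 4 3 + 6 * mzv2 3 4 + 6 * mzv2 2 5)"
    by (simp add: fD_nths dcoef_def del: One_nat_def)
  also have "\<dots> = 3 * zetac 7 + 6 * (zetac 2 * zetac 5) - 6 * (zetac 3 * zetac 4)"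
    unfolding mzv2_weight_7 by (simp add: zetac_def)
  also have "\<dots> = - (1 / 15 * pic ^ 4 * zetac 3) + pic ^ 2 * zetac 5 + 3 * zetac 7"
    unfolding zetac_even by (simp add: power_numeral_reduce field_simps del: One_nat_def)
  finally show ?thesis .
qed

lemma fD_value_3: "fps_nth fD 3 = - (239 / 113400 * pic ^ 8) + 8 * zetac 3 * zetac 5 + 4 * dz"
proof -
  have "fps_nth fD 3 = of_real (- (4 * mzv2 5 3 + 9 * mzv2 4 4 + 12 * mzv2 3 5 + 10 * mzv2 2 6))"
    by (simp add: fD_nths dcoef_def del: One_nat_def)
  also have "\<dots> = - (251/6 * zetac 8 - 10 * (zetac 2 * zetac 6) - 8 * (zetac 3 * zetac 5) - 9/2 * (zetac 4)^2 - 4 * dz)"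
    unfolding mzv2_weight_8 by (simp add: zetac_def)
  also have "\<dots> = - (239 / 113400 * pic ^ 8) + 8 * zetac 3 * zetac 5 + 4 * dz"
    unfolding zetac_even by (simp add: power_numeral_reduce field_simps del: One_nat_def)
  finally show ?thesis .
qed

lemma fD_value_4: "fps_nth fD 4 = - (2 / 189 * pic ^ 6 * zetac 3) + 1 / 5 * pic ^ 4 * zetac 5 + 5 / 2 * pic ^ 2 * zetac 7 - 17 * zetac 9"
proof -
  have "fps_nth fD 4 = of_real (5 * mzv2 6 3 + 12 * mzv2 5 4 + 18 * mzv2 4 5 + 20 * mzv2 3 6 + 15 * mzv2 2 7)"
    by (simp add: fD_nths dcoef_def del: One_nat_def)
  also have "\<dots> = 15 * (zetac 2 * zetac 7) - 10 * (zetac 3 * zetac 6) + 18 * (zetac 4 * zetac 5) - 17 * zetac 9"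
    unfolding mzv2_weight_9 by (simp add: zetac_def)
  also have "\<dots> = - (2 / 189 * pic ^ 6 * zetac 3) + 1 / 5 * pic ^ 4 * zetac 5 + 5 / 2 * pic ^ 2 * zetac 7 - 17 * zetac 9"
    unfolding zetac_even by (simp add: power_numeral_reduce field_simps del: One_nat_def)
  finally show ?thesis .
qed

lemmas fD_values = fD_nths(1) fD_value_1 fD_value_2 fD_value_3 fD_value_4

lemma fPsi_nth_unroll:
  "fps_nth fPsi n = - fps_nth (fps_X * fC) n + fps_nth (fps_sin (2 * pic)) n / (2 * pic)
     - 2 / pic * fps_nth (fps_X^3 * (fps_sin pic * fT)) n
     + 8 / pic * fps_nth (fps_X^3 * (fps_sin (2 * pic) * fh 2)) n
     - 256 * fps_nth (fps_X * (fP - fps_X * fps_deriv fP)) n + 128 * fps_nth (fps_X * fE) n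
     + 128 / pic * fps_nth (fps_sin pic) n - 256 / pic * fps_nth (fps_X^3 * (fps_sin pic * fh (-1))) n
     + 120 * fps_nth (fps_X^4 * (fh 1 - fps_const (zetac 3))) n - 96 * fps_nth (fps_X^6 * (fD - fps_const (dcoef 0 0))) n"
  unfolding fPsi_def fP_Digamma by simp

text \<open>-(2 / pi) z^3 sin(pi z) T6 begins with -2 z^4 T6, so coefficient n + 4 of
  \<open>fPsi\<close> is -2 times coefficient n of \<open>fT\<close> plus known terms. Its vanishing
  for n + 4 \<le> 10 gives \<open>fT\<close> up to degree 6, each value feeding the next.\<close>

lemma fT_nth_0 [fT_nths]: "fps_nth fT 0 = 4 * zetac 3"
proof -
  have "0 = fps_nth fPsi 4" by (rule fPsi_nth[symmetric]) simp
  also have "\<dots> = - 2 * (fps_nth fT 0 - (4 * zetac 3))"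
    unfolding fPsi_nth_unroll fps_X_power_mult_nth fps_X_mult_nth fps_sub_nth
    by (simp add: fps_mult_nth_unroll fps_sin_nth_unroll fC_nths fE_nths fP_nths fh_nths
        fD_values zetac_even fps_cCEP_nth_0  One_nat_def[symmetric] power_numeral_reduce field_simps del: One_nat_def)
  finally show ?thesis by (rule minus_two_mult_eq_0D)
qed

lemma fT_nth_1 [fT_nths]: "fps_nth fT 1 = - (1 / 3 * pic ^ 4)"
proof -
  have "0 = fps_nth fPsi 5" by (rule fPsi_nth[symmetric]) simp
  also have "\<dots> = - 2 * (fps_nth fT 1 - (- (1 / 3 * pic ^ 4)))"
    unfolding fPsi_nth_unroll fps_X_power_mult_nth fps_X_mult_nth fps_sub_nth
    by (simp add: fps_mult_nth_unroll fps_sin_nth_unroll fC_nths fE_nths fP_nths fh_nths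
        fD_values zetac_even fps_cCEP_nth_0 fT_nths One_nat_def[symmetric] power_numeral_reduce field_simps del: One_nat_def)
  finally show ?thesis by (rule minus_two_mult_eq_0D)
qed

lemma fT_nth_2 [fT_nths]: "fps_nth fT 2 = - (2 * pic ^ 2 * zetac 3) + 144 * zetac 5"
proof -
  have "0 = fps_nth fPsi 6" by (rule fPsi_nth[symmetric]) simp
  also have "\<dots> = - 2 * (fps_nth fT 2 - (- (2 * pic ^ 2 * zetac 3) + 144 * zetac 5))"
    unfolding fPsi_nth_unroll fps_X_power_mult_nth fps_X_mult_nth fps_sub_nth
    by (simp add: fps_mult_nth_unroll fps_sin_nth_unroll fC_nths fE_nths fP_nths fh_nths
        fD_values zetac_even fps_cCEP_nth_0 fT_nths One_nat_def[symmetric] power_numeral_reduce field_simps del: One_nat_def)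
  finally show ?thesis by (rule minus_two_mult_eq_0D)
qed

lemma fT_nth_3 [fT_nths]: "fps_nth fT 3 = - (157 / 378 * pic ^ 6) + 16 * zetac 3 ^ 2"
proof -
  have "0 = fps_nth fPsi 7" by (rule fPsi_nth[symmetric]) simp
  also have "\<dots> = - 2 * (fps_nth fT 3 - (- (157 / 378 * pic ^ 6) + 16 * zetac 3 ^ 2))"
    unfolding fPsi_nth_unroll fps_X_power_mult_nth fps_X_mult_nth fps_sub_nth
    by (simp add: fps_mult_nth_unroll fps_sin_nth_unroll fC_nths fE_nths fP_nths fh_nths
        fD_values zetac_even fps_cCEP_nth_0 fT_nths One_nat_def[symmetric] power_numeral_reduce field_simps del: One_nat_def)
  finally show ?thesis by (rule minus_two_mult_eq_0D)
qed

lemma fT_nth_4 [fT_nths]: "fps_nth fT 4 = - (11 / 30 * pic ^ 4 * zetac 3) - 72 * pic ^ 2 * zetac 5 + 1752 * zetac 7"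
proof -
  have "0 = fps_nth fPsi 8" by (rule fPsi_nth[symmetric]) simp
  also have "\<dots> = - 2 * (fps_nth fT 4 - (- (11 / 30 * pic ^ 4 * zetac 3) - 72 * pic ^ 2 * zetac 5 + 1752 * zetac 7))"
    unfolding fPsi_nth_unroll fps_X_power_mult_nth fps_X_mult_nth fps_sub_nth
    by (simp add: fps_mult_nth_unroll fps_sin_nth_unroll fC_nths fE_nths fP_nths fh_nths
        fD_values zetac_even fps_cCEP_nth_0 fT_nths One_nat_def[symmetric] power_numeral_reduce field_simps del: One_nat_def)
  finally show ?thesis by (rule minus_two_mult_eq_0D)
qed

lemma fT_nth_5 [fT_nths]: "fps_nth fT 5 = - (10069 / 37800 * pic ^ 8) - 8 * pic ^ 2 * zetac 3 ^ 2 + 192 * zetac 3 * zetac 5 - 192 * dz"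
proof -
  have "0 = fps_nth fPsi 9" by (rule fPsi_nth[symmetric]) simp
  also have "\<dots> = - 2 * (fps_nth fT 5 - (- (10069 / 37800 * pic ^ 8) - 8 * pic ^ 2 * zetac 3 ^ 2 + 192 * zetac 3 * zetac 5 - 192 * dz))"
    unfolding fPsi_nth_unroll fps_X_power_mult_nth fps_X_mult_nth fps_sub_nth
    by (simp add: fps_mult_nth_unroll fps_sin_nth_unroll fC_nths fE_nths fP_nths fh_nths
        fD_values zetac_even fps_cCEP_nth_0 fT_nths One_nat_def[symmetric] power_numeral_reduce field_simps del: One_nat_def)
  finally show ?thesis by (rule minus_two_mult_eq_0D)
qed

lemma fT_nth_6 [fT_nths]: "fps_nth fT 6 = - (613 / 3780 * pic ^ 6 * zetac 3) - 66 / 5 * pic ^ 4 * zetac 5 - 876 * pic ^ 2 * zetac 7 + 128 / 3 * zetac 3 ^ 3 + 47344 / 3 * zetac 9"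
proof -
  have "0 = fps_nth fPsi 10" by (rule fPsi_nth[symmetric]) simp
  also have "\<dots> = - 2 * (fps_nth fT 6 - (- (613 / 3780 * pic ^ 6 * zetac 3) - 66 / 5 * pic ^ 4 * zetac 5 - 876 * pic ^ 2 * zetac 7 + 128 / 3 * zetac 3 ^ 3 + 47344 / 3 * zetac 9))"
    unfolding fPsi_nth_unroll fps_X_power_mult_nth fps_X_mult_nth fps_sub_nth
    by (simp add: fps_mult_nth_unroll fps_sin_nth_unroll fC_nths fE_nths fP_nths fh_nths
        fD_values zetac_even fps_cCEP_nth_0 fT_nths One_nat_def[symmetric] power_numeral_reduce field_simps del: One_nat_def)
  finally show ?thesis by (rule minus_two_mult_eq_0D)
qed


section \<open>From the Taylor coefficients to the six series\<close>

lemma fF_nth_unroll: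
  "fps_nth fF n = - fps_nth (fT * fps_exp (pic * \<i>)) n"
  unfolding fF_eq by simp

lemma zeta_eq_zetac:
  "zeta 2 = zetac 2" "zeta 3 = zetac 3" "zeta 4 = zetac 4" "zeta 5 = zetac 5" "zeta 6 = zetac 6"
  "zeta 7 = zetac 7" "zeta 8 = zetac 8" "zeta 9 = zetac 9"
  using zeta_eq_zetar[of 2] zeta_eq_zetar[of 3] zeta_eq_zetar[of 4] zeta_eq_zetar[of 5] zeta_eq_zetar[of 6]
    zeta_eq_zetar[of 7] zeta_eq_zetar[of 8] zeta_eq_zetar[of 9]
  by (simp_all add: zetac_def)

lemma fps_exp_nth_unroll:
  fixes c :: complex
  shows "fps_nth (fps_exp c) 0 = 1" "fps_nth (fps_exp c) 1 = c" "fps_nth (fps_exp c) 2 = c^2 / 2"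
    "fps_nth (fps_exp c) 3 = c^3 / 6" "fps_nth (fps_exp c) 4 = c^4 / 24" "fps_nth (fps_exp c) 5 = c^5 / 120"
    "fps_nth (fps_exp c) 6 = c^6 / 720"
  by (simp_all add: fact_numeral)

lemmas f6_simps = fF_nth_unroll fps_mult_nth_unroll fps_exp_nth_unroll fT_nths

(* The coefficient 480 of double_zeta 5 3 in the fifth identity corrects a misprint (48) in the
   source, which is numerically false and contradicts the sixth identity. *)
theorem theorem1p8:
  defines "D \<equiv> (\<lambda>m k. higher_vector_deriv m f6 (real (Suc k)))"
  shows "(\<forall>m\<in>{1..6}. summable (D m)) \<and>
    (\<Sum>k. D 1 k) = of_real pi ^ 4 / 3 - 4 * of_real pi * \<i> * zeta 3 \<and>
    (\<Sum>k. D 2 k) = 8 * of_real pi ^ 2 * zeta 3 - 288 * zeta 5 + 2 / 3 * of_real pi ^ 5 * \<i> \<and>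
    (\<Sum>k. D 3 k) = 1410 * zeta 6 - 96 * zeta 3 ^ 2
      + 16 * of_real pi * \<i> * (of_real pi ^ 2 * zeta 3 - 54 * zeta 5) \<and>
    1 / 576 * (\<Sum>k. D 4 k) = 36 * zeta 2 * zeta 5 - 3 * zeta 3 * zeta 4 - 73 * zeta 7
      + of_real pi * \<i> / 6 * (85 * zeta 6 - 4 * zeta 3 ^ 2) \<and>
    1 / 48 * (\<Sum>k. D 5 k) = 1715 * zeta 8 + 240 * zeta 2 * zeta 3 ^ 2 - 480 * zeta 3 * zeta 5
      + 480 * double_zeta 5 3
      + 60 * of_real pi * \<i> * (24 * zeta 2 * zeta 5 - 73 * zeta 7) \<and>
    1 / 3840 * (\<Sum>k. D 6 k) = 1971 * zeta 2 * zeta 7 + 12 * zeta 3 * zeta 6 - 486 * zeta 4 * zeta 5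
      - 8 * zeta 3 ^ 3 - 2959 * zeta 9
      + of_real pi * \<i> / 4 * (1417 * zeta 8 + 48 * zeta 2 * zeta 3 ^ 2 - 144 * zeta 3 * zeta 5
          + 144 * double_zeta 5 3)"
proof -
  have dz: "double_zeta 5 3 = dz" by (rule double_zeta_eq_mzv2) auto
  have "summable (D m)" for m
    unfolding D_def by (rule higher_vector_deriv_f6_suminf)
  moreover have S: "(\<Sum>k. D m k) = fact m * fps_nth fF m" for m
    unfolding D_def by (rule higher_vector_deriv_f6_suminf)
  \<comment> \<open>Each sum is -m! times a Cauchy product of the real coefficients of
    \<open>T6\<close> with (pi i)^k / k!; even k yield the real part and odd k the imaginary part.
    Where even zeta values occur, they are turned into powers of pi, so that a polynomial identity
    remains.\<close>
  have "(\<Sum>k. D 1 k) = pic ^ 4 / 3 - 4 * pic * \<i> * zeta 3"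
    unfolding S f6_simps zeta_eq_zetac by (simp add: fact_numeral field_simps)
  moreover have "(\<Sum>k. D 2 k) = 8 * pic ^ 2 * zeta 3 - 288 * zeta 5 + 2 / 3 * pic ^ 5 * \<i>"
    unfolding S f6_simps zeta_eq_zetac by (simp add: fact_numeral power_numeral_reduce field_simps)
  moreover have "(\<Sum>k. D 3 k) = 1410 * zeta 6 - 96 * zeta 3 ^ 2 + 16 * pic * \<i> * (pic ^ 2 * zeta 3 - 54 * zeta 5)"
    unfolding S f6_simps zeta_eq_zetac zetac_even by (simp add: fact_numeral power_numeral_reduce field_simps)
  moreover have "1 / 576 * (\<Sum>k. D 4 k) = 36 * zeta 2 * zeta 5 - 3 * zeta 3 * zeta 4 - 73 * zeta 7
      + pic * \<i> / 6 * (85 * zeta 6 - 4 * zeta 3 ^ 2)"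
    unfolding S f6_simps zeta_eq_zetac zetac_even by (simp add: fact_numeral power_numeral_reduce field_simps)
  moreover have "1 / 48 * (\<Sum>k. D 5 k) = 1715 * zeta 8 + 240 * zeta 2 * zeta 3 ^ 2 - 480 * zeta 3 * zeta 5
      + 480 * double_zeta 5 3 + 60 * pic * \<i> * (24 * zeta 2 * zeta 5 - 73 * zeta 7)"
    unfolding S f6_simps zeta_eq_zetac zetac_even dz by (simp add: fact_numeral power_numeral_reduce field_simps)
  moreover have "1 / 3840 * (\<Sum>k. D 6 k) = 1971 * zeta 2 * zeta 7 + 12 * zeta 3 * zeta 6 - 486 * zeta 4 * zeta 5
      - 8 * zeta 3 ^ 3 - 2959 * zeta 9
      + pic * \<i> / 4 * (1417 * zeta 8 + 48 * zeta 2 * zeta 3 ^ 2 - 144 * zeta 3 * zeta 5 + 144 * double_zeta 5 3)"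
    unfolding S f6_simps zeta_eq_zetac zetac_even dz by (simp add: fact_numeral power_numeral_reduce field_simps)
  ultimately show ?thesis by blast
qed

end
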